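(* Let $\mathscr{S}$ be the class of finite solvable groups and let $g\geq1$, $n\geq 0$ with $2g-2+n>0$. Then the pro-$\mathscr{S}$ congruence mapping class group $\check{\Gamma}_{g,n}^{\mathscr{S}}$ is not virtually pro-$\mathscr{S}$, i.e. it contains no open subgroup which is a pro-$\mathscr{S}$ (prosolvable) group. In particular, $\mathrm{Out}(\widehat{\Pi}_{g,n}^{\mathscr{S}})$ and $\mathrm{Aut}(\widehat{\Pi}_{g,n}^{\mathscr{S}})$ are not virtually pro-$\mathscr{S}$ either.
   Context: $S_{g,n}$ is a closed orientable surface of genus $g$ with $n$ points removed, $\Pi_{g,n}=\pi_1(S_{g,n})$, and $\widehat{\Pi}_{g,n}^{\mathscr{S}}$ is the prosolvable completion of $\Pi_{g,n}$ (inverse limit of its finite solvable quotients). $\Gamma_{g,n}$ is the pure mapping class group of $S_{g,n}$ (isotopy classes of orientation preserving homeomorphisms not permuting the punctures). The natural representation $\Gamma_{g,n}\to\mathrm{Out}(\widehat{\Pi}_{g,n}^{\mathscr{S}})$ is faithful; $\check{\Gamma}_{g,n}^{\mathscr{S}}$ is the closure of its image in the profinite group $\mathrm{Out}(\widehat{\Pi}_{g,n}^{\mathscr{S}})$. Equivalently it is the completion of $\Gamma_{g,n}$ with respect to the kernels of $\Gamma_{g,n}\to\mathrm{Out}(\Pi_{g,n}/K)$ for $K$ characteristic in $\Pi_{g,n}$ with finite solvable quotient. $\mathrm{Aut}$ and $\mathrm{Out}$ of $\widehat{\Pi}_{g,n}^{\mathscr{S}}$ carry their natural profinite topologies. *)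

theory Defs
  imports "HOL-Homology.Homology" "HOL-Algebra.Solvable_Groups" "HOL-Algebra.Bij"
begin

section \<open>Punctured surfaces and their mapping class groups\<close>

text \<open>
  The closed orientable surface of genus \<open>g \<ge> 1\<close> is the unit disc, regarded as a \<open>4g\<close>-gon, with its
  boundary sides identified in pairs according to the word
  \<open>a\<^sub>1 b\<^sub>1 a\<^sub>1\<inverse> b\<^sub>1\<inverse> \<dots> a\<^sub>g b\<^sub>g a\<^sub>g\<inverse> b\<^sub>g\<inverse>\<close>.
  The \<open>k\<close>-th side is the arc \<open>{polygon_point g t | t. k \<le> t \<le> k + 1}\<close>.
\<close>

definition polygon_point :: "nat \<Rightarrow> real \<Rightarrow> complex" where
  "polygon_point g t = cis (2 * pi * t / (4 * real g))"

definition side_pairing :: "nat \<Rightarrow> complex \<Rightarrow> complex \<Rightarrow> bool" where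
  "side_pairing g z w \<longleftrightarrow> (\<exists>i<g. \<exists>s\<in>{0..1}.
     z = polygon_point g (4 * real i + s) \<and> w = polygon_point g (4 * real i + 3 - s) \<or>
     z = polygon_point g (4 * real i + 1 + s) \<and> w = polygon_point g (4 * real i + 4 - s))"

text \<open>
  The subspace \<open>X\<close> is a closed orientable surface of genus \<open>g\<close> iff it is homeomorphic to the
  quotient above, that is, iff it is the target of a quotient map with exactly those fibres.
  For \<open>g = 0\<close> the definition is meaningless (nothing would be identified).
\<close>

definition closed_orientable_surface :: "nat \<Rightarrow> 'a::topological_space set \<Rightarrow> bool" where
  "closed_orientable_surface g X \<longleftrightarrow>
     (\<exists>q. quotient_map (top_of_set (cball (0::complex) 1)) (top_of_set X) q \<and>
          (\<forall>z\<in>cball 0 1. \<forall>w\<in>cball 0 1. q z = q w \<longleftrightarrow> equivclp (side_pairing g) z w))"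

text \<open>
  An orientation is a locally coherent choice of generators of the local homology groups
  \<open>H\<^sub>2(S, S - {x})\<close>. A connected orientable surface has exactly two orientations, each the
  negative of the other, so preserving one of them and preserving both is the same.
\<close>

definition orientation_of :: "'a::topological_space set \<Rightarrow> ('a \<Rightarrow> 'a chain set) \<Rightarrow> bool" where
  "orientation_of S \<mu> \<longleftrightarrow>
     (\<forall>x\<in>S. \<mu> x \<in> carrier (relative_homology_group 2 (top_of_set S) (S - {x})) \<and>
            generate (relative_homology_group 2 (top_of_set S) (S - {x})) {\<mu> x} =
              carrier (relative_homology_group 2 (top_of_set S) (S - {x}))) \<and>
     (\<forall>x\<in>S. \<exists>V. openin (top_of_set S) V \<and> x \<in> V \<and>
        (\<exists>c\<in>carrier (relative_homology_group 2 (top_of_set S) (S - V)).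
           \<forall>y\<in>V. hom_induced 2 (top_of_set S) (S - V) (top_of_set S) (S - {y}) id c = \<mu> y))"

definition orientation_preserving :: "'a::topological_space set \<Rightarrow> ('a \<Rightarrow> 'a) \<Rightarrow> bool" where
  "orientation_preserving S f \<longleftrightarrow> (\<forall>\<mu>. orientation_of S \<mu> \<longrightarrow>
     (\<forall>x\<in>S. hom_induced 2 (top_of_set S) (S - {x}) (top_of_set S) (S - {f x}) f (\<mu> x) = \<mu> (f x)))"

text \<open>
  In the following definitions \<open>X\<close> is the closed surface and \<open>P\<close> the set of punctures.
  A homeomorphism of \<open>X - P\<close> extends to \<open>X\<close>; it does not permute the punctures
  iff the extension fixes each \<open>p \<in> P\<close>, i.e. iff it tends to \<open>p\<close> at \<open>p\<close>.
\<close>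

definition pure_homeos :: "'a::topological_space set \<Rightarrow> 'a set \<Rightarrow> ('a \<Rightarrow> 'a) set" where
  "pure_homeos X P = {f. (\<exists>f'. homeomorphism (X - P) (X - P) f f') \<and>
     orientation_preserving (X - P) f \<and> (\<forall>p\<in>P. (f \<longlongrightarrow> p) (at p within (X - P)))}"

definition isotopy_rel :: "'a::topological_space set \<Rightarrow> 'a set \<Rightarrow> (('a \<Rightarrow> 'a) \<times> ('a \<Rightarrow> 'a)) set" where
  "isotopy_rel X P = {(f, h). f \<in> pure_homeos X P \<and> h \<in> pure_homeos X P \<and>
     homotopic_with_canon (\<lambda>k. \<exists>k'. homeomorphism (X - P) (X - P) k k') (X - P) (X - P) f h}"

definition pure_mapping_class_group ::
    "'a::topological_space set \<Rightarrow> 'a set \<Rightarrow> ('a \<Rightarrow> 'a) set monoid" where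
  "pure_mapping_class_group X P =
     \<lparr>carrier = pure_homeos X P // isotopy_rel X P,
      mult = (\<lambda>A B. isotopy_rel X P `` {f \<circ> h | f h. f \<in> A \<and> h \<in> B}),
      one = isotopy_rel X P `` {id}\<rparr>"

section \<open>The fundamental group\<close>

definition path_class :: "'a::topological_space set \<Rightarrow> (real \<Rightarrow> 'a) \<Rightarrow> (real \<Rightarrow> 'a) set" where
  "path_class S p = {r. homotopic_paths S p r}"

definition fundamental_group :: "'a::topological_space set \<Rightarrow> 'a \<Rightarrow> (real \<Rightarrow> 'a) set monoid" where
  "fundamental_group S x =
     \<lparr>carrier = {path_class S p | p. path p \<and> path_image p \<subseteq> S \<and> pathstart p = x \<and> pathfinish p = x},
      mult = (\<lambda>A B. \<Union>p\<in>A. \<Union>q\<in>B. path_class S (p +++ q)),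
      one = path_class S (\<lambda>_. x)\<rparr>"

text \<open>
  A self-map \<open>f\<close> of \<open>S\<close> need not fix the base point; a path \<open>c\<close> from \<open>x\<close> to \<open>f x\<close> turns
  \<open>f\<^sub>*\<close> into the endomorphism \<open>[p] \<mapsto> [c (f \<circ> p) c\<inverse>]\<close> of \<open>\<pi>\<^sub>1(S, x)\<close>.
\<close>

definition pi1_map ::
    "'a::topological_space set \<Rightarrow> (real \<Rightarrow> 'a) \<Rightarrow> ('a \<Rightarrow> 'a) \<Rightarrow> (real \<Rightarrow> 'a) set \<Rightarrow> (real \<Rightarrow> 'a) set" where
  "pi1_map S c f A = (\<Union>p\<in>A. path_class S (c +++ (f \<circ> p) +++ reversepath c))"

section \<open>Inverse limits and prosolvable groups\<close>

text \<open>A topological group is represented by a group together with a topology on its carrier.\<close>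

definition inverse_system ::
    "'i set \<Rightarrow> ('i \<Rightarrow> 'i \<Rightarrow> bool) \<Rightarrow> ('i \<Rightarrow> 'b monoid) \<Rightarrow> ('i \<Rightarrow> 'i \<Rightarrow> 'b \<Rightarrow> 'b) \<Rightarrow> bool" where
  "inverse_system I R F \<pi> \<longleftrightarrow>
     I \<noteq> {} \<and>
     (\<forall>i\<in>I. R i i) \<and>
     (\<forall>i\<in>I. \<forall>j\<in>I. \<forall>k\<in>I. R i j \<and> R j k \<longrightarrow> R i k) \<and>
     (\<forall>i\<in>I. \<forall>j\<in>I. \<exists>k\<in>I. R i k \<and> R j k) \<and>
     (\<forall>i\<in>I. group (F i)) \<and>
     (\<forall>i\<in>I. \<forall>j\<in>I. R i j \<longrightarrow> \<pi> i j \<in> hom (F j) (F i)) \<and>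
     (\<forall>i\<in>I. \<forall>a\<in>carrier (F i). \<pi> i i a = a) \<and>
     (\<forall>i\<in>I. \<forall>j\<in>I. \<forall>k\<in>I. R i j \<and> R j k \<longrightarrow>
        (\<forall>a\<in>carrier (F k). \<pi> i j (\<pi> j k a) = \<pi> i k a))"

definition inverse_limit ::
    "'i set \<Rightarrow> ('i \<Rightarrow> 'i \<Rightarrow> bool) \<Rightarrow> ('i \<Rightarrow> 'b monoid) \<Rightarrow> ('i \<Rightarrow> 'i \<Rightarrow> 'b \<Rightarrow> 'b) \<Rightarrow> ('i \<Rightarrow> 'b) monoid" where
  "inverse_limit I R F \<pi> = (product_group I F)
     \<lparr>carrier := {x \<in> carrier (product_group I F). \<forall>i\<in>I. \<forall>j\<in>I. R i j \<longrightarrow> \<pi> i j (x j) = x i}\<rparr>"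

definition inverse_limit_topology ::
    "'i set \<Rightarrow> ('i \<Rightarrow> 'i \<Rightarrow> bool) \<Rightarrow> ('i \<Rightarrow> 'b monoid) \<Rightarrow> ('i \<Rightarrow> 'i \<Rightarrow> 'b \<Rightarrow> 'b) \<Rightarrow> ('i \<Rightarrow> 'b) topology" where
  "inverse_limit_topology I R F \<pi> =
     subtopology (product_topology (\<lambda>i. discrete_topology (carrier (F i))) I)
       (carrier (inverse_limit I R F \<pi>))"

text \<open>
  A group is pro-\<open>\<S>\<close> if it is an inverse limit of finite solvable groups. The types of the
  index set and of the finite groups are no restriction: a pro-\<open>\<S>\<close> group \<open>G\<close> is
  the inverse limit of its quotients \<open>G Mod N\<close>, indexed by the open normal subgroups \<open>N\<close>.
\<close>

definition prosolvable :: "('a, 'm) monoid_scheme \<Rightarrow> 'a topology \<Rightarrow> bool" where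
  "prosolvable G T \<longleftrightarrow>
     (\<exists>(I :: 'a set set) R (F :: 'a set \<Rightarrow> 'a set monoid) \<pi> \<phi>.
        inverse_system I R F \<pi> \<and>
        (\<forall>i\<in>I. finite (carrier (F i)) \<and> solvable (F i)) \<and>
        \<phi> \<in> iso G (inverse_limit I R F \<pi>) \<and>
        homeomorphic_map T (inverse_limit_topology I R F \<pi>) \<phi>)"

definition virtually_prosolvable :: "('a, 'm) monoid_scheme \<Rightarrow> 'a topology \<Rightarrow> bool" where
  "virtually_prosolvable G T \<longleftrightarrow>
     (\<exists>U. subgroup U G \<and> openin T U \<and> prosolvable (G\<lparr>carrier := U\<rparr>) (subtopology T U))"

section \<open>The prosolvable completion\<close>

definition solvable_quotient_kernels :: "'a monoid \<Rightarrow> 'a set set" where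
  "solvable_quotient_kernels G = {N. N \<lhd> G \<and> finite (carrier (G Mod N)) \<and> solvable (G Mod N)}"

definition prosolvable_completion :: "'a monoid \<Rightarrow> ('a set \<Rightarrow> 'a set) monoid" where
  "prosolvable_completion G =
     inverse_limit (solvable_quotient_kernels G) (\<lambda>M N. N \<subseteq> M) (\<lambda>N. G Mod N) (\<lambda>M N C. M <#>\<^bsub>G\<^esub> C)"

definition prosolvable_completion_topology :: "'a monoid \<Rightarrow> ('a set \<Rightarrow> 'a set) topology" where
  "prosolvable_completion_topology G =
     inverse_limit_topology (solvable_quotient_kernels G) (\<lambda>M N. N \<subseteq> M) (\<lambda>N. G Mod N)
       (\<lambda>M N C. M <#>\<^bsub>G\<^esub> C)"

text \<open>
  The automorphism of the completion induced by an automorphism \<open>\<theta>\<close> of \<open>G\<close>: its component in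
  \<open>G/N\<close> is the component in \<open>G/\<theta>\<inverse>(N)\<close> followed by the isomorphism
  \<open>G/\<theta>\<inverse>(N) \<rightarrow> G/N\<close> induced by \<open>\<theta>\<close>.
\<close>

definition completion_map ::
    "'a monoid \<Rightarrow> ('a \<Rightarrow> 'a) \<Rightarrow> ('a set \<Rightarrow> 'a set) \<Rightarrow> ('a set \<Rightarrow> 'a set)" where
  "completion_map G \<theta> = (\<lambda>x\<in>carrier (prosolvable_completion G).
     \<lambda>N\<in>solvable_quotient_kernels G. \<theta> ` x {a \<in> carrier G. \<theta> a \<in> N})"

section \<open>Automorphism groups of topological groups\<close>

text \<open>
  \<open>Aut\<close> consists of the automorphisms of the topological group. Its topology
  has the sets of \<open>\<psi>\<close> with \<open>\<psi>(x) \<in> \<phi>(x) U\<close> for all \<open>x\<close>, where \<open>U\<close> is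
  an open normal subgroup, as basic neighbourhoods of \<open>\<phi>\<close>. If the open
  characteristic subgroups are cofinal among the open normal ones (as in any topologically
  finitely generated profinite group), this is the topology in which the kernels of
  \<open>Aut G \<rightarrow> Aut (G/K)\<close>, \<open>K\<close> open characteristic, are the basic neighbourhoods of the identity.
\<close>

definition Aut_group :: "'a monoid \<Rightarrow> 'a topology \<Rightarrow> ('a \<Rightarrow> 'a) monoid" where
  "Aut_group G T = (AutoGroup G)\<lparr>carrier := {\<phi> \<in> carrier (AutoGroup G). homeomorphic_map T T \<phi>}\<rparr>"

definition Aut_topology :: "'a monoid \<Rightarrow> 'a topology \<Rightarrow> ('a \<Rightarrow> 'a) topology" where
  "Aut_topology G T = topology_generated_by
     {{\<psi> \<in> carrier (Aut_group G T). \<forall>x\<in>carrier G. \<psi> x \<in> \<phi> x <#\<^bsub>G\<^esub> U} | \<phi> U.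
        \<phi> \<in> carrier (Aut_group G T) \<and> U \<lhd> G \<and> openin T U}"

definition Inn :: "'a monoid \<Rightarrow> ('a \<Rightarrow> 'a) set" where
  "Inn G = {(\<lambda>x\<in>carrier G. a \<otimes>\<^bsub>G\<^esub> x \<otimes>\<^bsub>G\<^esub> inv\<^bsub>G\<^esub> a) | a. a \<in> carrier G}"

definition Out_group :: "'a monoid \<Rightarrow> 'a topology \<Rightarrow> ('a \<Rightarrow> 'a) set monoid" where
  "Out_group G T = Aut_group G T Mod Inn G"

definition quotient_topology :: "'a topology \<Rightarrow> ('a \<Rightarrow> 'b) \<Rightarrow> 'b topology" where
  "quotient_topology T p =
     topology (\<lambda>V. V \<subseteq> p ` topspace T \<and> openin T {x \<in> topspace T. p x \<in> V})"

lemma openin_quotient_topology: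
  "openin (quotient_topology T p) V \<longleftrightarrow> V \<subseteq> p ` topspace T \<and> openin T {x \<in> topspace T. p x \<in> V}"
proof -
  let ?pre = "\<lambda>V. {x \<in> topspace T. p x \<in> V}"
  have Int: "?pre (A \<inter> B) = ?pre A \<inter> ?pre B" for A B
    by blast
  have Union: "?pre (\<Union>\<K>) = \<Union>(?pre ` \<K>)" for \<K>
    by blast
  have "istopology (\<lambda>V. V \<subseteq> p ` topspace T \<and> openin T (?pre V))"
    unfolding istopology_def
  proof (intro conjI allI impI)
    fix A B
    assume "A \<subseteq> p ` topspace T \<and> openin T (?pre A)" "B \<subseteq> p ` topspace T \<and> openin T (?pre B)"
    then show "A \<inter> B \<subseteq> p ` topspace T" "openin T (?pre (A \<inter> B))"
      unfolding Int by (blast, blast intro: openin_Int)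
  next
    fix \<K>
    assume *: "\<forall>K\<in>\<K>. K \<subseteq> p ` topspace T \<and> openin T (?pre K)"
    show "\<Union>\<K> \<subseteq> p ` topspace T"
      using * by blast
    show "openin T (?pre (\<Union>\<K>))"
      unfolding Union using * by (intro openin_Union) blast
  qed
  then show ?thesis
    unfolding quotient_topology_def by (subst topology_inverse') (assumption, rule refl)
qed

lemma quotient_map_quotient_topology: "quotient_map T (quotient_topology T p) p"
proof -
  have "openin (quotient_topology T p) (p ` topspace T)"
    unfolding openin_quotient_topology
    by (metis (no_types, lifting) Collect_cong Collect_mem_eq imageI openin_topspace order_refl)
  then have "topspace (quotient_topology T p) = p ` topspace T"
    using openin_quotient_topology[of T p "topspace (quotient_topology T p)"] openin_subset by fast
  then show ?thesis
    unfolding quotient_map_def openin_quotient_topology by blast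
qed

definition Out_topology :: "'a monoid \<Rightarrow> 'a topology \<Rightarrow> ('a \<Rightarrow> 'a) set topology" where
  "Out_topology G T =
     quotient_topology (Aut_topology G T) (\<lambda>\<phi>. Inn G #>\<^bsub>Aut_group G T\<^esub> \<phi>)"

section \<open>The prosolvable congruence mapping class group\<close>

abbreviation Pi_hat :: "'a::topological_space set \<Rightarrow> 'a set \<Rightarrow> 'a \<Rightarrow>
    ((real \<Rightarrow> 'a) set set \<Rightarrow> (real \<Rightarrow> 'a) set set) monoid" where
  "Pi_hat X P x \<equiv> prosolvable_completion (fundamental_group (X - P) x)"

abbreviation Pi_hat_topology :: "'a::topological_space set \<Rightarrow> 'a set \<Rightarrow> 'a \<Rightarrow>
    ((real \<Rightarrow> 'a) set set \<Rightarrow> (real \<Rightarrow> 'a) set set) topology" where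
  "Pi_hat_topology X P x \<equiv> prosolvable_completion_topology (fundamental_group (X - P) x)"

text \<open>
  The outer automorphism of a mapping class \<open>A\<close>. All members of the union below are the
  same coset of the inner automorphisms, so the union is that coset.
\<close>

definition outer_representation :: "'a::topological_space set \<Rightarrow> 'a set \<Rightarrow> 'a \<Rightarrow> ('a \<Rightarrow> 'a) set \<Rightarrow>
    (((real \<Rightarrow> 'a) set set \<Rightarrow> (real \<Rightarrow> 'a) set set) \<Rightarrow>
     ((real \<Rightarrow> 'a) set set \<Rightarrow> (real \<Rightarrow> 'a) set set)) set" where
  "outer_representation X P x A =
     \<Union>{Inn (Pi_hat X P x) #>\<^bsub>Aut_group (Pi_hat X P x) (Pi_hat_topology X P x)\<^esub>
          completion_map (fundamental_group (X - P) x) (pi1_map (X - P) c f) | f c.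
        f \<in> A \<and> path c \<and> path_image c \<subseteq> X - P \<and> pathstart c = x \<and> pathfinish c = f x}"

definition congruence_mcg_carrier where
  "congruence_mcg_carrier X P x =
     (Out_topology (Pi_hat X P x) (Pi_hat_topology X P x)) closure_of
       (outer_representation X P x ` carrier (pure_mapping_class_group X P))"

definition congruence_mcg where
  "congruence_mcg X P x =
     (Out_group (Pi_hat X P x) (Pi_hat_topology X P x))\<lparr>carrier := congruence_mcg_carrier X P x\<rparr>"

definition congruence_mcg_topology where
  "congruence_mcg_topology X P x =
     subtopology (Out_topology (Pi_hat X P x) (Pi_hat_topology X P x)) (congruence_mcg_carrier X P x)"

end

theory Submission
  imports Defs "HOL-Number_Theory.Cong" "HOL-Analysis.Further_Topology"
begin

text \<open>
  Glue the sides of the \<open>4g\<close>-gon as prescribed. The band across the polygon that joins side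
  \<open>0\<close> to side \<open>2\<close> becomes an annulus, and so does the band that joins side \<open>1\<close> to side \<open>3\<close>;
  their core curves meet exactly once. Both bands contain thinner ones that avoid the
  punctures and the base point (\<open>strip_avoiding\<close>), so the annuli may be taken in the punctured
  surface \<open>S\<close>. Counting the signed crossings of a loop with either annulus gives two
  homomorphisms \<open>c\<^sub>1, c\<^sub>2\<close> from \<open>\<Pi> = \<pi>\<^sub>1(S)\<close> to the integers. The Dehn twists along the annuli
  fix the base point, and their powers act on the pair \<open>(c\<^sub>1, c\<^sub>2)\<close> through all the elementary
  matrices of size two (\<open>winding_twist\<close>, \<open>crossing_winding\<close>).

  The essential point is that sufficiently divisible powers of the twists are close to the
  identity. Let \<open>\<Pi>/N\<close> be a finite quotient whose order divides \<open>k\<close>. Rotating the annulus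
  deforms the identity into the \<open>k\<close>-fold twist, except that it moves the points on one side of
  the annulus \<open>k\<close> times around it. The tracks of these points are \<open>k\<close>-th powers of loops,
  hence are trivial in \<open>\<Pi>/N\<close>, and therefore the \<open>k\<close>-fold twist induces the identity on \<open>\<Pi>/N\<close>
  (\<open>path_functor_twist\<close>). Consequently every neighbourhood of the identity contains the
  \<open>k\<close>-fold twists for all multiples \<open>k\<close> of some \<open>m > 0\<close> (\<open>twists_small\<close>).

  Now suppose that an open subgroup \<open>U\<close> is prosolvable, and let \<open>p > m\<close> be a prime with
  \<open>p \<ge> 5\<close>. Since \<open>m\<close> is invertible modulo \<open>p\<close>, the twists in \<open>U\<close> realize all elementary matrices
  over \<open>\<int>/p\<close>. The quotient of \<open>\<Pi>\<close> by the common kernel of \<open>c\<^sub>1\<close> and \<open>c\<^sub>2\<close> modulo \<open>p\<close> is finite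
  and abelian, hence one of the quotients that define the completion, so acting trivially on
  it is an open condition. It is stable under inner automorphisms, because these act trivially
  on an abelian quotient, and therefore makes sense in \<open>Out\<close> as well. By prosolvability \<open>U\<close>
  has a homomorphism \<open>h\<close> to a finite solvable group such that the kernel of \<open>h\<close> acts trivially
  on this quotient (\<open>prosolvable_small_kernel\<close>). But elementary matrices over \<open>\<int>/p\<close> are
  commutators of a diagonal matrix and an elementary matrix, as \<open>2\<close> and \<open>3\<close> are invertible,
  and so by induction they are realized by elements of \<open>U\<close> that \<open>h\<close> maps into any given term
  of the derived series (\<open>solvable_quotient_kernel_lift\<close>). In the end some element of the
  kernel of \<open>h\<close> acts by a nontrivial matrix, which is absurd.

  The argument uses only that the group contains the classes of the twists. It applies to the
  congruence mapping class group, because twists preserve orientations and are the identity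
  near the punctures, and equally to \<open>Out\<close> and \<open>Aut\<close>.
\<close>

section \<open>Inverse limits and prosolvable groups\<close>

lemma inverse_systemD:
  assumes "inverse_system I R F \<pi>"
  shows "I \<noteq> {}"
    and "\<And>i j. \<lbrakk>i \<in> I; j \<in> I\<rbrakk> \<Longrightarrow> \<exists>k\<in>I. R i k \<and> R j k"
    and "\<And>i j k. \<lbrakk>i \<in> I; j \<in> I; k \<in> I; R i j; R j k\<rbrakk> \<Longrightarrow> R i k"
    and "\<And>i. i \<in> I \<Longrightarrow> group (F i)"
    and "\<And>i j. \<lbrakk>i \<in> I; j \<in> I; R i j\<rbrakk> \<Longrightarrow> \<pi> i j \<in> hom (F j) (F i)"
proof -
  note A = assms[unfolded inverse_system_def]
  show "I \<noteq> {}" using A by (elim conjE)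
  have "\<forall>i\<in>I. \<forall>j\<in>I. \<exists>k\<in>I. R i k \<and> R j k" using A by (elim conjE)
  then show "\<And>i j. \<lbrakk>i \<in> I; j \<in> I\<rbrakk> \<Longrightarrow> \<exists>k\<in>I. R i k \<and> R j k" by blast
  have "\<forall>i\<in>I. \<forall>j\<in>I. \<forall>k\<in>I. R i j \<and> R j k \<longrightarrow> R i k" using A by (elim conjE)
  then show "\<And>i j k. \<lbrakk>i \<in> I; j \<in> I; k \<in> I; R i j; R j k\<rbrakk> \<Longrightarrow> R i k" by blast
  have "\<forall>i\<in>I. group (F i)" using A by (elim conjE)
  then show "\<And>i. i \<in> I \<Longrightarrow> group (F i)" by blast
  have "\<forall>i\<in>I. \<forall>j\<in>I. R i j \<longrightarrow> \<pi> i j \<in> hom (F j) (F i)" using A by (elim conjE)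
  then show "\<And>i j. \<lbrakk>i \<in> I; j \<in> I; R i j\<rbrakk> \<Longrightarrow> \<pi> i j \<in> hom (F j) (F i)" by blast
qed

lemma inverse_system_bound:
  assumes sys: "inverse_system I R F \<pi>" and "finite J" "J \<subseteq> I"
  shows "\<exists>k\<in>I. \<forall>j\<in>J. R j k"
  using assms(2,3)
proof (induction J)
  case empty
  then show ?case using inverse_systemD(1)[OF sys] by blast
next
  case (insert j J)
  then obtain k where k: "k \<in> I" "\<forall>i\<in>J. R i k" by auto
  have "\<exists>l\<in>I. R j l \<and> R k l"
    using inverse_systemD(2)[OF sys] k insert.prems by blast
  then obtain l where l: "l \<in> I" "R j l" "R k l" by blast
  have "R i l" if "i \<in> J" for i
  proof -
    have "i \<in> I" "R i k" using that insert.prems k by auto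
    then show ?thesis using inverse_systemD(3)[OF sys] k(1) l by blast
  qed
  then show ?case using l by auto
qed

lemma subgroup_inverse_limit:
  assumes gr: "\<And>i. i \<in> I \<Longrightarrow> group (F i)"
    and hm: "\<And>i j. \<lbrakk>i \<in> I; j \<in> I; R i j\<rbrakk> \<Longrightarrow> \<pi> i j \<in> hom (F j) (F i)"
  shows "subgroup (carrier (inverse_limit I R F \<pi>)) (product_group I F)"
proof -
  interpret P: group "product_group I F"
    by (rule product_group) (use gr in auto)
  have gh: "group_hom (F j) (F i) (\<pi> i j)" if "i \<in> I" "j \<in> I" "R i j" for i j
    using gr hm that by (simp add: group_hom_def group_hom_axioms_def)
  show ?thesis
  proof (rule subgroup.intro)
    show "carrier (inverse_limit I R F \<pi>) \<subseteq> carrier (product_group I F)"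
      by (auto simp: inverse_limit_def)
    show "\<one>\<^bsub>product_group I F\<^esub> \<in> carrier (inverse_limit I R F \<pi>)"
      using P.one_closed group_hom.hom_one[OF gh] by (auto simp: inverse_limit_def)
  next
    fix x y assume "x \<in> carrier (inverse_limit I R F \<pi>)" "y \<in> carrier (inverse_limit I R F \<pi>)"
    then show "x \<otimes>\<^bsub>product_group I F\<^esub> y \<in> carrier (inverse_limit I R F \<pi>)"
      using P.m_closed[of x y] group_hom.hom_mult[OF gh]
      by (auto simp: inverse_limit_def PiE_iff)
  next
    fix x assume x: "x \<in> carrier (inverse_limit I R F \<pi>)"
    then have xP: "x \<in> carrier (product_group I F)" by (auto simp: inverse_limit_def)
    have inv: "inv\<^bsub>product_group I F\<^esub> x = (\<lambda>i\<in>I. inv\<^bsub>F i\<^esub> x i)"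
      using xP gr by (intro inv_product_group) auto
    show "inv\<^bsub>product_group I F\<^esub> x \<in> carrier (inverse_limit I R F \<pi>)"
      using P.inv_closed[OF xP] x group_hom.hom_inv[OF gh] unfolding inverse_limit_def inv
      by (auto simp: PiE_iff)
  qed
qed

lemma group_inverse_limit:
  assumes gr: "\<And>i. i \<in> I \<Longrightarrow> group (F i)"
    and hm: "\<And>i j. \<lbrakk>i \<in> I; j \<in> I; R i j\<rbrakk> \<Longrightarrow> \<pi> i j \<in> hom (F j) (F i)"
  shows "group (inverse_limit I R F \<pi>)"
proof -
  have "group (product_group I F)"
    by (rule product_group) (use gr in auto)
  from subgroup.subgroup_is_group[OF subgroup_inverse_limit[OF gr hm] this]
  show ?thesis by (simp add: inverse_limit_def)
qed

text \<open>The carrier of the congruence mapping class group is a closure, so that a subgroup of the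
  structure with this carrier has inverses in the sense of that structure, which need not be
  those of the ambient group. An isomorphism with an inverse limit repairs this: the
  preimage of an inverse is an inverse.\<close>

lemma prosolvable_submonoid_is_subgroup:
  fixes K :: "('a, 'm) monoid_scheme"
  assumes K: "group K" and U: "U \<subseteq> carrier K" "\<one>\<^bsub>K\<^esub> \<in> U"
    and closed: "\<And>x y. x \<in> U \<Longrightarrow> y \<in> U \<Longrightarrow> x \<otimes>\<^bsub>K\<^esub> y \<in> U"
    and pro: "prosolvable (K\<lparr>carrier := U\<rparr>) T"
  shows "subgroup U K"
proof -
  interpret K: group K by fact
  obtain I R and F :: "'a set \<Rightarrow> 'a set monoid" and \<pi> \<phi> where sys: "inverse_system I R F \<pi>"
    and iso: "\<phi> \<in> iso (K\<lparr>carrier := U\<rparr>) (inverse_limit I R F \<pi>)"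
    using pro unfolding prosolvable_def by (elim exE conjE) (rule that)
  let ?L = "inverse_limit I R F \<pi>"
  interpret L: group ?L by (rule group_inverse_limit) (use inverse_systemD[OF sys] in blast)+
  have bij: "bij_betw \<phi> U (carrier ?L)"
    and mult: "\<And>x y. x \<in> U \<Longrightarrow> y \<in> U \<Longrightarrow> \<phi> (x \<otimes>\<^bsub>K\<^esub> y) = \<phi> x \<otimes>\<^bsub>?L\<^esub> \<phi> y"
    using iso by (auto simp: iso_def hom_def)
  have mem: "\<phi> x \<in> carrier ?L" if "x \<in> U" for x
    using bij that by (auto simp: bij_betw_def)
  have one: "\<phi> \<one>\<^bsub>K\<^esub> = \<one>\<^bsub>?L\<^esub>"
    using mult[OF U(2) U(2)] mem[OF U(2)] by (metis K.one_closed K.l_one L.r_cancel_one)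
  show ?thesis
  proof (rule K.subgroupI)
    show "U \<subseteq> carrier K" "U \<noteq> {}" using U by auto
    show "x \<otimes>\<^bsub>K\<^esub> y \<in> U" if "x \<in> U" "y \<in> U" for x y using closed that by blast
    fix x assume x: "x \<in> U"
    obtain y where y: "y \<in> U" "\<phi> y = inv\<^bsub>?L\<^esub> \<phi> x"
      using bij L.inv_closed[OF mem[OF x]] unfolding bij_betw_def by (metis imageE)
    have "\<phi> (x \<otimes>\<^bsub>K\<^esub> y) = \<phi> \<one>\<^bsub>K\<^esub>"
      using mult[OF x y(1)] y(2) one L.r_inv[OF mem[OF x]] by simp
    then have "x \<otimes>\<^bsub>K\<^esub> y = \<one>\<^bsub>K\<^esub>"
      using bij closed[OF x y(1)] U(2) by (auto simp: bij_betw_def inj_on_def)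
    then have "inv\<^bsub>K\<^esub> x = y"
      using x y U(1) by (metis K.inv_equality K.inv_inv subsetD)
    then show "inv\<^bsub>K\<^esub> x \<in> U" using y by simp
  qed
qed

text \<open>A basic neighbourhood of the identity in an inverse limit restricts finitely many
  coordinates, and all of these are determined by a single later one. So it contains the
  kernel of a projection.\<close>

lemma prosolvable_small_kernel:
  fixes G :: "('a, 'm) monoid_scheme"
  assumes G: "group G" and top: "topspace T = carrier G" and pro: "prosolvable G T"
    and W: "openin T W" "\<one>\<^bsub>G\<^esub> \<in> W"
  shows "\<exists>(F :: 'a set monoid) h. group F \<and> solvable F \<and> h \<in> hom G F \<and>
           (\<forall>x\<in>carrier G. h x = \<one>\<^bsub>F\<^esub> \<longrightarrow> x \<in> W)"
proof -
  interpret G: group G by fact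
  obtain I R and F :: "'a set \<Rightarrow> 'a set monoid" and \<pi> \<phi> where sys: "inverse_system I R F \<pi>"
    and sol: "\<forall>i\<in>I. finite (carrier (F i)) \<and> solvable (F i)"
    and iso: "\<phi> \<in> iso G (inverse_limit I R F \<pi>)"
    and homeo: "homeomorphic_map T (inverse_limit_topology I R F \<pi>) \<phi>"
    using pro unfolding prosolvable_def by (elim exE conjE) (rule that)
  let ?L = "inverse_limit I R F \<pi>"
  interpret L: group ?L by (rule group_inverse_limit) (use inverse_systemD[OF sys] in blast)+
  have gr: "group (F i)" if "i \<in> I" for i
    using inverse_systemD[OF sys] that by blast
  have bij: "bij_betw \<phi> (carrier G) (carrier ?L)" and hom: "\<phi> \<in> hom G ?L"
    using iso by (auto simp: iso_def)
  have Lsub: "carrier ?L \<subseteq> (\<Pi>\<^sub>E i\<in>I. carrier (F i))"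
    by (auto simp: inverse_limit_def)
  have phi1: "\<phi> \<one>\<^bsub>G\<^esub> = \<one>\<^bsub>?L\<^esub>"
    by (rule hom_one[OF hom G L.is_group])
  have one: "\<one>\<^bsub>?L\<^esub> = (\<lambda>i\<in>I. \<one>\<^bsub>F i\<^esub>)"
    by (simp add: inverse_limit_def)
  have "openin (inverse_limit_topology I R F \<pi>) (\<phi> ` W)"
    using homeo W(1) by (meson homeomorphic_imp_open_map open_map_def)
  then obtain O' where O': "openin (product_topology (\<lambda>i. discrete_topology (carrier (F i))) I) O'"
     and WO: "\<phi> ` W = O' \<inter> carrier ?L"
    unfolding inverse_limit_topology_def openin_subtopology by blast
  have one_O': "(\<lambda>i\<in>I. \<one>\<^bsub>F i\<^esub>) \<in> O'"
    using W(2) unfolding one[symmetric] phi1[symmetric] using WO by blast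
  then obtain X where X: "(\<lambda>i\<in>I. \<one>\<^bsub>F i\<^esub>) \<in> (\<Pi>\<^sub>E i\<in>I. X i)"
      "finite {i. X i \<noteq> carrier (F i)}" "(\<Pi>\<^sub>E i\<in>I. X i) \<subseteq> O'"
    using product_topology_open_contains_basis[OF O' one_O'] unfolding topspace_discrete_topology
    by (elim exE conjE) (rule that)
  obtain k where k: "k \<in> I" "\<forall>j\<in>{i\<in>I. X i \<noteq> carrier (F i)}. R j k"
    using inverse_system_bound[OF sys, of "{i\<in>I. X i \<noteq> carrier (F i)}"] X(2)
    by (metis (no_types, lifting) Collect_mono finite_subset mem_Collect_eq subsetI)
  have fk: "\<phi> x k \<in> carrier (F k)" if "x \<in> carrier G" for x
  proof -
    have "\<phi> x \<in> carrier ?L" using that bij by (auto simp: bij_betw_def)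
    then show ?thesis using Lsub k(1) by (auto simp: PiE_iff)
  qed
  have h: "(\<lambda>x. \<phi> x k) \<in> hom G (F k)"
  proof (rule homI)
    fix x y assume xy: "x \<in> carrier G" "y \<in> carrier G"
    then have "\<phi> (x \<otimes>\<^bsub>G\<^esub> y) = \<phi> x \<otimes>\<^bsub>?L\<^esub> \<phi> y" using hom by (simp add: hom_def)
    then show "\<phi> (x \<otimes>\<^bsub>G\<^esub> y) k = \<phi> x k \<otimes>\<^bsub>F k\<^esub> \<phi> y k"
      using k(1) by (simp add: inverse_limit_def)
  qed (use fk in auto)
  have "x \<in> W" if x: "x \<in> carrier G" "\<phi> x k = \<one>\<^bsub>F k\<^esub>" for x
  proof -
    have xL: "\<phi> x \<in> carrier ?L" using x bij by (auto simp: bij_betw_def)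
    have "\<phi> x i \<in> X i" if i: "i \<in> I" for i
    proof (cases "X i = carrier (F i)")
      case True
      then show ?thesis using xL Lsub i by (auto simp: PiE_iff)
    next
      case False
      then have R: "R i k" using k i by auto
      then have "\<phi> x i = \<pi> i k (\<phi> x k)"
        using xL i k(1) unfolding inverse_limit_def by auto
      also have "\<dots> = \<one>\<^bsub>F i\<^esub>"
      proof -
        have "\<pi> i k \<in> hom (F k) (F i)" using inverse_systemD(5)[OF sys] R i k(1) by blast
        then show ?thesis using x(2) gr i k(1) hom_one[of "\<pi> i k" "F k" "F i"] by simp
      qed
      finally show ?thesis using X(1) i by (auto simp: PiE_iff)
    qed
    then have "\<phi> x \<in> (\<Pi>\<^sub>E i\<in>I. X i)"
      using xL Lsub by (auto simp: PiE_iff)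
    then have "\<phi> x \<in> \<phi> ` W" using WO X(3) xL by blast
    moreover have "W \<subseteq> carrier G" using openin_subset[OF W(1)] top by simp
    ultimately show "x \<in> W" using bij x(1) by (auto simp: bij_betw_def inj_on_def)
  qed
  then show ?thesis using h sol k(1) gr by (intro exI[of _ "F k"] exI[of _ "\<lambda>x. \<phi> x k"]) auto
qed

section \<open>Matrices of determinant one modulo a prime\<close>

type_synonym mat2 = "int \<times> int \<times> int \<times> int"

fun mat2_mult :: "mat2 \<Rightarrow> mat2 \<Rightarrow> mat2" where
  "mat2_mult (a, b, c, d) (a', b', c', d') =
     (a * a' + b * c', a * b' + b * d', c * a' + d * c', c * b' + d * d')"

fun mat2_cong :: "int \<Rightarrow> mat2 \<Rightarrow> mat2 \<Rightarrow> bool" where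
  "mat2_cong p (a, b, c, d) (a', b', c', d') \<longleftrightarrow>
     [a = a'] (mod p) \<and> [b = b'] (mod p) \<and> [c = c'] (mod p) \<and> [d = d'] (mod p)"

text \<open>The relation \<open>\<rho> x M\<close> is to be read as: \<open>x\<close> acts on a module over \<open>\<int>/p\<close> through the matrix
  \<open>M\<close>, whose rows are \<open>(a, b)\<close> and \<open>(c, d)\<close>. It is a relation instead of a function since
  \<open>M\<close> only matters modulo \<open>p\<close>, and since not every element of the group has to act linearly.\<close>

locale mod_p_action = group A for A (structure) +
  fixes p :: int and \<rho> :: "'a \<Rightarrow> mat2 \<Rightarrow> bool"
  assumes \<rho>_mult: "\<lbrakk>x \<in> carrier A; y \<in> carrier A; \<rho> x M; \<rho> y N\<rbrakk> \<Longrightarrow> \<rho> (x \<otimes> y) (mat2_mult M N)"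
    and \<rho>_inv: "\<lbrakk>x \<in> carrier A; \<rho> x (a, b, c, d); [a * d - b * c = 1] (mod p)\<rbrakk> \<Longrightarrow> \<rho> (inv x) (d, - b, - c, a)"
    and \<rho>_cong: "\<lbrakk>x \<in> carrier A; \<rho> x M; mat2_cong p M N\<rbrakk> \<Longrightarrow> \<rho> x N"
begin

text \<open>For \<open>d = diag(2, 1/2)\<close> and the elementary matrix \<open>e(s)\<close> with entry \<open>s\<close>, the commutator of
  \<open>d\<close> and \<open>e(s)\<close> is \<open>e(4s) e(-s) = e(3s)\<close>. As \<open>2\<close> and \<open>3\<close> are invertible, \<open>d\<close> exists and
  \<open>3s\<close> takes every value.\<close>

lemma commutator_lifts:
  assumes L: "subgroup L A"
    and p: "coprime p 2" "coprime p 3"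
    and up: "\<And>t. \<exists>x\<in>L. \<rho> x (1, t, 0, 1)" and low: "\<And>t. \<exists>x\<in>L. \<rho> x (1, 0, t, 1)"
  shows "\<exists>x\<in>L. \<exists>y\<in>L. \<rho> (x \<otimes> y \<otimes> inv x \<otimes> inv y) (1, t, 0, 1)"
    and "\<exists>x\<in>L. \<exists>y\<in>L. \<rho> (x \<otimes> y \<otimes> inv x \<otimes> inv y) (1, 0, t, 1)"
proof -
  interpret L: subgroup L A by fact
  \<comment> \<open>The integers \<open>v\<close> and \<open>w\<close> represent \<open>1/2\<close> and \<open>1/3\<close>.\<close>
  obtain v where v: "[2 * v = 1] (mod p)"
    using p(1) cong_solve_coprime_int[of 2 p] by (auto simp: coprime_commute)
  obtain w where w: "[3 * w = 1] (mod p)"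
    using p(2) cong_solve_coprime_int[of 3 p] by (auto simp: coprime_commute)
  obtain i where i: "2 * v = 1 + p * i" using cong_sym[OF v] by (auto simp: cong_iff_lin mult.commute)
  obtain j where j: "3 * w = 1 + p * j" using cong_sym[OF w] by (auto simp: cong_iff_lin mult.commute)
  have mult': "\<rho> (x \<otimes> y) K" if "x \<in> L" "y \<in> L" "\<rho> x M" "\<rho> y N" "mat2_cong p (mat2_mult M N) K" for x y M N K
    by (rule \<rho>_cong[OF m_closed \<rho>_mult[OF _ _ that(3,4)] that(5)])
       (use that(1,2) L.mem_carrier in auto)
  \<comment> \<open>With upper and lower elementary matrices \<open>e\<close> and \<open>f\<close>, the products
    \<open>w(u) = e(u) f(-1/u) e(u)\<close> are antidiagonal, and \<open>w(2) w(-1) = diag(2, 1/2)\<close>.\<close>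
  obtain e1 e2 f1 f2 where
    e: "e1 \<in> L" "\<rho> e1 (1, 2, 0, 1)" "e2 \<in> L" "\<rho> e2 (1, 0, -v, 1)"
    and f: "f1 \<in> L" "\<rho> f1 (1, -1, 0, 1)" "f2 \<in> L" "\<rho> f2 (1, 0, 1, 1)"
    using up low by meson
  have w1: "\<rho> (e1 \<otimes> e2 \<otimes> e1) (0, 2, -v, 0)"
  proof (rule mult'[of _ _ "(1 - 2 * v, 2, -v, 1)" "(1, 2, 0, 1)"])
    show "\<rho> (e1 \<otimes> e2) (1 - 2 * v, 2, -v, 1)"
      by (rule mult'[of _ _ "(1, 2, 0, 1)" "(1, 0, -v, 1)"]) (use e in auto)
    show "mat2_cong p (mat2_mult (1 - 2 * v, 2, - v, 1) (1, 2, 0, 1)) (0, 2, - v, 0)"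
      using i by (auto simp: cong_iff_dvd_diff algebra_simps)
  qed (use e in auto)
  have w2: "\<rho> (f1 \<otimes> f2 \<otimes> f1) (0, -1, 1, 0)"
  proof (rule mult'[of _ _ "(0, -1, 1, 1)" "(1, -1, 0, 1)"])
    show "\<rho> (f1 \<otimes> f2) (0, -1, 1, 1)"
      by (rule mult'[of _ _ "(1, -1, 0, 1)" "(1, 0, 1, 1)"]) (use f in auto)
  qed (use f in auto)
  define dd where "dd = (e1 \<otimes> e2 \<otimes> e1) \<otimes> (f1 \<otimes> f2 \<otimes> f1)"
  have dL: "dd \<in> L" using e f by (auto simp: dd_def)
  have d: "\<rho> dd (2, 0, 0, v)"
    unfolding dd_def
    by (rule mult'[OF _ _ w1 w2]) (use e f in auto)
  have dc: "dd \<in> carrier A" using dL by (rule L.mem_carrier)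
  have det: "[2 * v - 0 * 0 = 1] (mod p)" using v by simp
  have d': "\<rho> (inv dd) (v, 0, 0, 2)"
    using \<rho>_inv[OF dc d det] by simp
  have invinv: "inv (inv dd) = dd" using dc by simp
  define s where "s = t * w"
  have s3: "3 * s = t + p * (t * j)" using j by (simp add: s_def algebra_simps)
  have s4: "4 * s = s + 3 * s" by simp
  obtain y where y: "y \<in> L" "\<rho> y (1, s, 0, 1)" using up by blast
  obtain z where z: "z \<in> L" "\<rho> z (1, 0, s, 1)" using low by blast
  have yi: "\<rho> (inv y) (1, -s, 0, 1)" using \<rho>_inv[of y 1 s 0 1] y L.mem_carrier by auto
  have zi: "\<rho> (inv z) (1, 0, -s, 1)" using \<rho>_inv[of z 1 0 s 1] z L.mem_carrier by auto
  have "\<rho> (dd \<otimes> y \<otimes> inv dd \<otimes> inv y) (1, t, 0, 1)"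
  proof (rule mult'[OF _ _ _ yi])
    show "\<rho> (dd \<otimes> y \<otimes> inv dd) (1, 4 * s, 0, 1)"
    proof (rule mult'[OF _ _ _ d'])
      show "\<rho> (dd \<otimes> y) (2, 2 * s, 0, v)"
        by (rule mult'[OF _ _ d y(2)]) (use y dL in auto)
    qed (use y dL v in \<open>auto simp: mult.commute\<close>)
  qed (use y dL s3 in \<open>auto simp: cong_iff_dvd_diff algebra_simps\<close>)
  then show "\<exists>x\<in>L. \<exists>y\<in>L. \<rho> (x \<otimes> y \<otimes> inv x \<otimes> inv y) (1, t, 0, 1)"
    using dL y by blast
  have "\<rho> (inv dd \<otimes> z \<otimes> inv (inv dd) \<otimes> inv z) (1, 0, t, 1)"
  proof (rule mult'[OF _ _ _ zi])
    show "\<rho> (inv dd \<otimes> z \<otimes> inv (inv dd)) (1, 0, 4 * s, 1)"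
      unfolding invinv
    proof (rule mult'[OF _ _ _ d])
      show "\<rho> (inv dd \<otimes> z) (v, 0, 2 * s, 2)"
        by (rule mult'[OF _ _ d' z(2)]) (use z dL in auto)
    qed (use z dL v in \<open>auto simp: mult.commute\<close>)
  qed (use z dL s3 in \<open>auto simp: cong_iff_dvd_diff algebra_simps\<close>)
  then show "\<exists>x\<in>L. \<exists>y\<in>L. \<rho> (x \<otimes> y \<otimes> inv x \<otimes> inv y) (1, 0, t, 1)"
    using dL z by blast
qed

text \<open>Commutators of elements that \<open>h\<close> maps into a term of the derived series are mapped into the
  next term. Since elementary matrices are commutators of elements that are themselves
  products of lifts of elementary matrices, they can be lifted to every level of the derived
  series, the last one being trivial.\<close>

lemma solvable_quotient_kernel_lift:
  assumes H: "subgroup H A" and F: "group F" "solvable F"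
    and h: "h \<in> hom (A\<lparr>carrier := H\<rparr>) F"
    and p: "coprime p 2" "coprime p 3"
    and up: "\<And>t. \<exists>x\<in>H. \<rho> x (1, t, 0, 1)" and low: "\<And>t. \<exists>x\<in>H. \<rho> x (1, 0, t, 1)"
  shows "\<exists>x\<in>H. h x = \<one>\<^bsub>F\<^esub> \<and> \<rho> x (1, t, 0, 1)"
proof -
  interpret F: group F by fact
  interpret H: subgroup H A by fact
  interpret HG: group "A\<lparr>carrier := H\<rparr>" by (rule H.subgroup_is_group) (rule is_group)
  interpret h: group_hom "A\<lparr>carrier := H\<rparr>" F h
    using h by unfold_locales
  define D where "D n = (derived F ^^ n) (carrier F)" for n
  have D: "subgroup (D n) F" for n
    unfolding D_def by (rule F.exp_of_derived_is_subgroup[OF F.subgroup_self])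
  have hinv: "h (inv x) = inv\<^bsub>F\<^esub> h x" if "x \<in> H" for x
    using h.hom_inv[of x] that m_inv_consistent[OF H that] by simp
  have hmult: "h (x \<otimes> y) = h x \<otimes>\<^bsub>F\<^esub> h y" if "x \<in> H" "y \<in> H" for x y
    using h.hom_mult[of x y] that by simp
  have hmem: "h x \<in> carrier F" if "x \<in> H" for x using h.hom_closed[of x] that by simp
  have claim: "(\<forall>t. \<exists>x\<in>H. h x \<in> D n \<and> \<rho> x (1, t, 0, 1)) \<and> (\<forall>t. \<exists>x\<in>H. h x \<in> D n \<and> \<rho> x (1, 0, t, 1))" for n
  proof (induction n)
    case 0
    then show ?case using up low hmem by (simp add: D_def)
  next
    case (Suc n)
    interpret Dn: subgroup "D n" F by (rule D)
    let ?L = "{x \<in> H. h x \<in> D n}"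
    have L: "subgroup ?L A"
    proof (rule subgroupI)
      show "?L \<noteq> {}" using Suc by blast
    qed (use hinv hmult H.mem_carrier in auto)
    have up': "\<exists>x\<in>?L. \<rho> x (1, t, 0, 1)" and low': "\<exists>x\<in>?L. \<rho> x (1, 0, t, 1)" for t
      using Suc by blast+
    have com: "x \<otimes> y \<otimes> inv x \<otimes> inv y \<in> H \<and> h (x \<otimes> y \<otimes> inv x \<otimes> inv y) \<in> D (Suc n)"
      if "x \<in> ?L" "y \<in> ?L" for x y
    proof -
      have "h (x \<otimes> y \<otimes> inv x \<otimes> inv y) = h x \<otimes>\<^bsub>F\<^esub> h y \<otimes>\<^bsub>F\<^esub> inv\<^bsub>F\<^esub> h x \<otimes>\<^bsub>F\<^esub> inv\<^bsub>F\<^esub> h y"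
        using that hmult hinv by auto
      also have "\<dots> \<in> derived F (D n)"
        unfolding derived_def by (rule generate.incl) (use that in auto)
      finally show ?thesis using that by (auto simp: D_def)
    qed
    show ?case
      using commutator_lifts[OF L p up' low'] com by meson
  qed
  obtain n where "D n = {\<one>\<^bsub>F\<^esub>}"
    using F(2) F.solvable_iff_trivial_derived_seq by (auto simp: D_def)
  then show ?thesis using claim[of n] by auto
qed

end

text \<open>Here \<open>K\<close> is the topological group in question and \<open>C\<close> the part of it that is shown not to be
  virtually prosolvable, while \<open>A\<close> is a group over \<open>K\<close> that acts modulo every prime. The two
  groups differ because an outer automorphism does not act on the completion, only the
  automorphisms that represent it do. The neighbourhoods \<open>W p\<close> detect the action: what lies
  over \<open>W p\<close> cannot act by the elementary matrix with entry \<open>1\<close>.\<close>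

lemma not_virtually_prosolvable_of_unipotents:
  fixes A :: "('a, 'm) monoid_scheme" and K :: "('k, 'n) monoid_scheme"
    and up low :: "int \<Rightarrow> 'a"
  assumes A: "group A" and K: "group K" and \<pi>: "\<pi> \<in> hom A K"
    and C: "C \<subseteq> carrier K" "topspace T = carrier K"
    and mem: "\<And>k. up k \<in> carrier A" "\<And>k. low k \<in> carrier A" "\<And>k. \<pi> (up k) \<in> C" "\<And>k. \<pi> (low k) \<in> C"
    and small: "\<And>V. openin T V \<Longrightarrow> \<one>\<^bsub>K\<^esub> \<in> V \<Longrightarrow>
        \<exists>m>0. \<forall>k. m dvd k \<longrightarrow> \<pi> (up k) \<in> V \<and> \<pi> (low k) \<in> V"
    and \<rho>: "\<And>p::int. p \<ge> 5 \<Longrightarrow> prime p \<Longrightarrow> mod_p_action A p (\<rho> p)"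
    and up: "\<And>p k. p \<ge> 5 \<Longrightarrow> prime p \<Longrightarrow> \<rho> p (up k) (1, k, 0, 1)"
    and low: "\<And>p k. p \<ge> 5 \<Longrightarrow> prime p \<Longrightarrow> \<rho> p (low k) (1, 0, k, 1)"
    and W: "\<And>p. p \<ge> 5 \<Longrightarrow> prime p \<Longrightarrow> openin T (W p) \<and> \<one>\<^bsub>K\<^esub> \<in> W p"
    and W_trivial: "\<And>p x. p \<ge> 5 \<Longrightarrow> prime p \<Longrightarrow> x \<in> carrier A \<Longrightarrow> \<pi> x \<in> W p \<Longrightarrow> \<not> \<rho> p x (1, 1, 0, 1)"
  shows "\<not> virtually_prosolvable (K\<lparr>carrier := C\<rparr>) (subtopology T C)"
proof
  assume "virtually_prosolvable (K\<lparr>carrier := C\<rparr>) (subtopology T C)"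
  then obtain U where U: "subgroup U (K\<lparr>carrier := C\<rparr>)" "openin (subtopology T C) U"
    and pro: "prosolvable (K\<lparr>carrier := U\<rparr>) (subtopology (subtopology T C) U)"
    unfolding virtually_prosolvable_def by auto
  interpret K: group K by fact
  interpret A: group A by fact
  interpret \<pi>: group_hom A K \<pi> by unfold_locales (rule \<pi>)
  have UC: "U \<subseteq> C" using subgroup.subset[OF U(1)] by simp
  have top: "subtopology (subtopology T C) U = subtopology T U"
    using UC by (simp add: subtopology_subtopology Int_absorb1)
  have sub: "subgroup U K"
    by (rule prosolvable_submonoid_is_subgroup[OF K _ _ _ pro])
       (use UC C subgroup.one_closed[OF U(1)] subgroup.m_closed[OF U(1)] in auto)
  have KU: "group (K\<lparr>carrier := U\<rparr>)" using sub K by (rule subgroup.subgroup_is_group)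
  obtain V where V: "openin T V" "U = V \<inter> C" using U(2) by (auto simp: openin_subtopology)
  have "\<one>\<^bsub>K\<^esub> \<in> V" using V subgroup.one_closed[OF sub] by auto
  then obtain m where m: "m > 0" "\<And>k. m dvd k \<Longrightarrow> \<pi> (up k) \<in> V \<and> \<pi> (low k) \<in> V"
    using small[OF V(1)] by blast
  \<comment> \<open>The prime has to be large for \<open>m\<close> to be invertible: then the multiples of \<open>m\<close>
    represent all residues.\<close>
  obtain q :: nat where q: "prime q" "q > nat m + 5" using bigger_prime by blast
  define p where "p = int q"
  have p: "p \<ge> 5" "prime p" "p > m" using q m(1) by (auto simp: p_def)
  interpret mod_p_action A p "\<rho> p" using \<rho>[OF p(1,2)] .
  have cop: "coprime p n" if "0 < n" "n < p" for n
    using p(2) that by (metis prime_imp_coprime zdvd_not_zless)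
  obtain m' where m': "[m * m' = 1] (mod p)"
    using cong_solve_coprime_int[of m p] cop[OF m(1) p(3)] by (auto simp: coprime_commute)
  let ?H = "{x \<in> carrier A. \<pi> x \<in> U}"
  have H: "subgroup ?H A"
  proof (rule A.subgroupI)
    show "?H \<noteq> {}" using A.one_closed \<pi>.hom_one subgroup.one_closed[OF sub] by force
  qed (auto intro: subgroup.m_closed[OF sub] subgroup.m_inv_closed[OF sub])
  have topU: "topspace (subtopology (subtopology T C) U) = carrier (K\<lparr>carrier := U\<rparr>)"
    using UC C by (auto simp: top)
  have "openin (subtopology (subtopology T C) U) (W p \<inter> U)" "\<one>\<^bsub>K\<lparr>carrier := U\<rparr>\<^esub> \<in> W p \<inter> U"
    using W[OF p(1,2)] subgroup.one_closed[OF sub] unfolding top openin_subtopology by auto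
  from prosolvable_small_kernel[OF KU topU pro this]
  obtain F :: "'k set monoid" and h where F: "group F" "solvable F"
    and h: "h \<in> hom (K\<lparr>carrier := U\<rparr>) F" "\<And>x. x \<in> U \<Longrightarrow> h x = \<one>\<^bsub>F\<^esub> \<Longrightarrow> x \<in> W p"
    by auto
  have hp: "h \<circ> \<pi> \<in> hom (A\<lparr>carrier := ?H\<rparr>) F"
    using h(1) by (auto simp: hom_def)
  have cong: "[m * (m' * t) = t] (mod p)" for t
    using cong_mult[OF m' cong_refl[of t]] by (simp add: mult.assoc)
  have U': "up (m * (m' * t)) \<in> ?H" "low (m * (m' * t)) \<in> ?H" for t
    using m(2)[of "m * (m' * t)"] V(2) mem by auto
  have "\<exists>x\<in>?H. (h \<circ> \<pi>) x = \<one>\<^bsub>F\<^esub> \<and> \<rho> p x (1, 1, 0, 1)"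
  proof (rule solvable_quotient_kernel_lift[OF H F hp])
    show "coprime p 2" "coprime p 3" using p(1) by (simp_all only: cop)
    show "\<exists>x\<in>?H. \<rho> p x (1, t, 0, 1)" for t
      by (rule bexI[OF _ U'(1)[of t]], rule \<rho>_cong[OF _ up[OF p(1,2)]]) (use mem cong in auto)
    show "\<exists>x\<in>?H. \<rho> p x (1, 0, t, 1)" for t
      by (rule bexI[OF _ U'(2)[of t]], rule \<rho>_cong[OF _ low[OF p(1,2)]]) (use mem cong in auto)
  qed
  then show False using h(2) W_trivial[OF p(1,2)] by auto
qed

section \<open>The prosolvable completion\<close>

locale discrete_group = group G for G :: "'a monoid" (structure)
begin

abbreviation "kernels \<equiv> solvable_quotient_kernels G"
abbreviation "Ghat \<equiv> prosolvable_completion G"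
abbreviation "That \<equiv> prosolvable_completion_topology G"

lemma kernels_normal: "N \<in> kernels \<Longrightarrow> N \<lhd> G"
  by (simp add: solvable_quotient_kernels_def)

lemma kernels_subgroup: "N \<in> kernels \<Longrightarrow> subgroup N G"
  using kernels_normal by (rule normal_imp_subgroup)

lemma kernels_subset: "N \<in> kernels \<Longrightarrow> N \<subseteq> carrier G"
  using kernels_subgroup by (rule subgroup.subset)

lemma group_Mod: "N \<lhd> G \<Longrightarrow> group (G Mod N)"
  by (rule normal.factorgroup_is_group)

lemma carrier_Mod: "carrier (G Mod N) = rcosets N"
  by (simp add: FactGroup_def)

lemma mult_Mod: "C \<otimes>\<^bsub>G Mod N\<^esub> D = C <#> D"
  by (simp add: FactGroup_def)

lemma one_Mod: "\<one>\<^bsub>G Mod N\<^esub> = N"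
  by (simp add: FactGroup_def)

lemma coset_eq_member:
  assumes "subgroup N G" "C \<in> rcosets N" "g \<in> C"
  shows "g \<in> carrier G" "C = N #> g"
proof -
  obtain a where a: "a \<in> carrier G" "C = N #> a" using assms(2) by (auto simp: RCOSETS_def)
  show "C = N #> g" using repr_independence[of g N a] a assms by simp
  show "g \<in> carrier G" using assms rcosets_part_G[OF assms(1)] by auto
qed

lemma coset_nonempty:
  assumes "subgroup N G" "C \<in> rcosets N"
  obtains g where "g \<in> C" "g \<in> carrier G" "C = N #> g"
proof -
  obtain a where a: "a \<in> carrier G" "C = N #> a" using assms(2) by (auto simp: RCOSETS_def)
  then show ?thesis using that[of a] rcos_self[OF a(1) assms(1)] by simp
qed

lemma mult_larger_coset:
  assumes M: "subgroup M G" and N: "subgroup N G" and NM: "N \<subseteq> M" and g: "g \<in> carrier G"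
  shows "M <#> (N #> g) = M #> g"
proof -
  have "M <#> N = M"
  proof
    show "M <#> N \<subseteq> M" using NM subgroup.m_closed[OF M] by (auto simp: set_mult_def)
    show "M \<subseteq> M <#> N"
    proof
      fix m assume m: "m \<in> M"
      have "m = m \<otimes> \<one>" using m subgroup.subset[OF M] by auto
      then show "m \<in> M <#> N" using m subgroup.one_closed[OF N] unfolding set_mult_def by blast
    qed
  qed
  then show ?thesis
    using setmult_rcos_assoc[of M N g] M N g by (simp add: subgroup.subset)
qed

lemma mult_larger_coset_hom:
  assumes M: "M \<lhd> G" and N: "N \<lhd> G" and NM: "N \<subseteq> M"
  shows "(\<lambda>C. M <#> C) \<in> hom (G Mod N) (G Mod M)"
proof (rule homI)
  note s = normal_imp_subgroup[OF M] normal_imp_subgroup[OF N]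
  fix C assume "C \<in> carrier (G Mod N)"
  then obtain g where g: "g \<in> carrier G" "C = N #> g" using coset_nonempty[OF s(2)] carrier_Mod by metis
  then show "M <#> C \<in> carrier (G Mod M)"
    using mult_larger_coset[OF s NM] rcosetsI[OF subgroup.subset[OF s(1)]] by (simp add: carrier_Mod)
  fix D assume "D \<in> carrier (G Mod N)"
  then obtain h where h: "h \<in> carrier G" "D = N #> h" using coset_nonempty[OF s(2)] carrier_Mod by metis
  show "M <#> (C \<otimes>\<^bsub>G Mod N\<^esub> D) = (M <#> C) \<otimes>\<^bsub>G Mod M\<^esub> (M <#> D)"
    unfolding mult_Mod g(2) h(2) using g(1) h(1)
    by (simp add: normal.rcos_sum[OF N] normal.rcos_sum[OF M] mult_larger_coset[OF s NM])
qed

lemma carrier_Ghat: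
  "x \<in> carrier Ghat \<longleftrightarrow> x \<in> extensional kernels \<and> (\<forall>N\<in>kernels. x N \<in> rcosets N) \<and>
     (\<forall>M\<in>kernels. \<forall>N\<in>kernels. N \<subseteq> M \<longrightarrow> M <#> x N = x M)"
  by (auto simp: prosolvable_completion_def inverse_limit_def PiE_iff carrier_Mod)

lemma mult_Ghat: "x \<otimes>\<^bsub>Ghat\<^esub> y = (\<lambda>N\<in>kernels. x N <#> y N)"
  by (simp add: prosolvable_completion_def inverse_limit_def product_group_def mult_Mod)

lemma one_Ghat: "\<one>\<^bsub>Ghat\<^esub> = (\<lambda>N\<in>kernels. N)"
  by (simp add: prosolvable_completion_def inverse_limit_def product_group_def one_Mod)

lemma group_Ghat: "group Ghat"
  unfolding prosolvable_completion_def
proof (rule group_inverse_limit)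
  fix M N assume "M \<in> kernels" "N \<in> kernels" "N \<subseteq> M"
  then show "(\<lambda>C. M <#> C) \<in> hom (G Mod N) (G Mod M)"
    by (intro mult_larger_coset_hom kernels_normal)
qed (simp add: group_Mod kernels_normal)

sublocale Ghat: group Ghat by (rule group_Ghat)

lemma Ghat_ext:
  assumes "x \<in> carrier Ghat" "y \<in> carrier Ghat" "\<And>N. N \<in> kernels \<Longrightarrow> x N = y N"
  shows "x = y"
  using assms by (auto simp: carrier_Ghat intro: extensionalityI)

lemma projection_hom:
  assumes "N \<in> kernels" shows "(\<lambda>x. x N) \<in> hom Ghat (G Mod N)"
  using assms by (auto simp: hom_def carrier_Ghat mult_Ghat mult_Mod carrier_Mod)

lemma coset_mem:
  assumes "x \<in> carrier Ghat" "N \<in> kernels" "g \<in> x N"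
  shows "g \<in> carrier G" "x N = N #> g"
  using coset_eq_member[OF kernels_subgroup[OF assms(2)] _ assms(3)] assms by (auto simp: carrier_Ghat)

lemma coset_ex:
  assumes "x \<in> carrier Ghat" "N \<in> kernels"
  obtains g where "g \<in> x N" "g \<in> carrier G" "x N = N #> g"
  using coset_nonempty[OF kernels_subgroup[OF assms(2)], of "x N"] assms by (auto simp: carrier_Ghat)

lemma mult_component:
  assumes "x \<in> carrier Ghat" "y \<in> carrier Ghat" "N \<in> kernels" "g \<in> x N" "h \<in> y N"
  shows "(x \<otimes>\<^bsub>Ghat\<^esub> y) N = N #> (g \<otimes> h)"
  using assms coset_mem[of x N g] coset_mem[of y N h] normal.rcos_sum[OF kernels_normal[OF assms(3)]]
  by (simp add: mult_Ghat)

lemma inv_component: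
  assumes x: "x \<in> carrier Ghat" and N: "N \<in> kernels" and g: "g \<in> x N"
  shows "(inv\<^bsub>Ghat\<^esub> x) N = N #> inv g"
proof -
  interpret N: normal N G by (rule kernels_normal[OF N])
  interpret h: group_hom Ghat "G Mod N" "\<lambda>x. x N"
    using projection_hom[OF N] N.factorgroup_is_group
    by (simp add: group_hom_def group_hom_axioms_def group_Ghat)
  have "(inv\<^bsub>Ghat\<^esub> x) N = inv\<^bsub>G Mod N\<^esub> (x N)" using x by simp
  also have "\<dots> = set_inv (x N)"
    by (rule N.inv_FactGroup) (use x in auto)
  also have "\<dots> = N #> inv g"
    using coset_mem[OF x N g] N.rcos_inv by simp
  finally show ?thesis .
qed

text \<open>The canonical map from the group to its completion.\<close>

definition diagonal :: "'a \<Rightarrow> 'a set \<Rightarrow> 'a set" where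
  "diagonal g = (\<lambda>N\<in>kernels. N #> g)"

lemma diagonal_closed: "g \<in> carrier G \<Longrightarrow> diagonal g \<in> carrier Ghat"
  by (auto simp: diagonal_def carrier_Ghat rcosetsI kernels_subset mult_larger_coset kernels_subgroup)

lemma topspace_That: "topspace That = carrier Ghat"
proof -
  have "carrier Ghat \<subseteq> (\<Pi>\<^sub>E N\<in>kernels. carrier (G Mod N))"
    by (auto simp: prosolvable_completion_def inverse_limit_def)
  then show ?thesis
    by (simp add: prosolvable_completion_topology_def inverse_limit_topology_def
        prosolvable_completion_def Int_absorb1)
qed

lemma continuous_into_That:
  assumes f: "f \<in> topspace T \<rightarrow> carrier Ghat"
    and c: "\<And>N. N \<in> kernels \<Longrightarrow> continuous_map T (discrete_topology (rcosets N)) (\<lambda>x. f x N)"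
  shows "continuous_map T That f"
proof -
  have "continuous_map T (product_topology (\<lambda>N. discrete_topology (carrier (G Mod N))) kernels) f"
    unfolding continuous_map_componentwise using f c by (auto simp: carrier_Ghat carrier_Mod)
  then show ?thesis
    using f by (simp add: prosolvable_completion_topology_def inverse_limit_topology_def
        prosolvable_completion_def continuous_map_in_subtopology)
qed

lemma continuous_component:
  assumes N: "N \<in> kernels" and h: "\<And>C. C \<in> rcosets N \<Longrightarrow> h C \<in> S"
  shows "continuous_map That (discrete_topology S) (\<lambda>x. h (x N))"
proof -
  have "continuous_map That (discrete_topology (rcosets N)) (\<lambda>x. x N)"
    unfolding prosolvable_completion_topology_def inverse_limit_topology_def
    by (rule continuous_map_from_subtopology)
       (use continuous_map_product_projection[OF N, of "\<lambda>N. discrete_topology (carrier (G Mod N))"]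
        in \<open>simp add: carrier_Mod\<close>)
  moreover have "continuous_map (discrete_topology (rcosets N)) (discrete_topology S) h"
    using h by (auto simp: continuous_map_from_discrete_topology)
  ultimately show ?thesis
    using continuous_map_compose[of That _ "\<lambda>x. x N" _ h] by (simp add: o_def)
qed

lemma open_component:
  assumes N: "N \<in> kernels"
  shows "openin That {x \<in> carrier Ghat. x N \<in> S}"
proof -
  have "continuous_map That (discrete_topology (rcosets N)) (\<lambda>x. x N)"
    using continuous_component[OF N, of "\<lambda>C. C"] by simp
  then have "openin That {x \<in> topspace That. x N \<in> S \<inter> rcosets N}"
    by (rule openin_continuous_map_preimage) simp
  moreover have "{x \<in> topspace That. x N \<in> S \<inter> rcosets N} = {x \<in> carrier Ghat. x N \<in> S}"
    using N by (auto simp: topspace_That carrier_Ghat)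
  ultimately show ?thesis by simp
qed

text \<open>A basic neighbourhood of the identity in the product restricts only finitely many
  components.\<close>

lemma open_contains_component_kernel:
  assumes U: "openin That U" "\<one>\<^bsub>Ghat\<^esub> \<in> U"
  shows "\<exists>J. finite J \<and> J \<subseteq> kernels \<and> (\<forall>x\<in>carrier Ghat. (\<forall>N\<in>J. x N = N) \<longrightarrow> x \<in> U)"
proof -
  obtain O' where O': "openin (product_topology (\<lambda>N. discrete_topology (carrier (G Mod N))) kernels) O'"
     and UO: "U = O' \<inter> carrier Ghat"
    using U(1) unfolding prosolvable_completion_topology_def prosolvable_completion_def
      inverse_limit_topology_def openin_subtopology by blast
  have "\<one>\<^bsub>Ghat\<^esub> \<in> O'" using UO U by blast
  from product_topology_open_contains_basis[OF O' this]
  obtain X where X: "\<one>\<^bsub>Ghat\<^esub> \<in> (\<Pi>\<^sub>E i\<in>kernels. X i)"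
      "finite {N. X N \<noteq> carrier (G Mod N)}" "(\<Pi>\<^sub>E i\<in>kernels. X i) \<subseteq> O'"
    unfolding topspace_discrete_topology by (elim exE conjE) (rule that)
  let ?J = "{N \<in> kernels. X N \<noteq> carrier (G Mod N)}"
  have "x \<in> U" if x: "x \<in> carrier Ghat" "\<forall>N\<in>?J. x N = N" for x
  proof -
    have "x N \<in> X N" if N: "N \<in> kernels" for N
    proof (cases "X N = carrier (G Mod N)")
      case True
      then show ?thesis using x N by (auto simp: carrier_Ghat carrier_Mod)
    next
      case False
      then have "x N = \<one>\<^bsub>Ghat\<^esub> N" using x N by (simp add: one_Ghat)
      then show ?thesis using X(1) N by (auto simp: PiE_iff)
    qed
    then have "x \<in> (\<Pi>\<^sub>E i\<in>kernels. X i)" using x by (auto simp: PiE_iff carrier_Ghat)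
    then show ?thesis using X(3) UO x by blast
  qed
  moreover have "finite ?J" using X(2) by (rule rev_finite_subset) auto
  ultimately show ?thesis by (intro exI[of _ ?J]) auto
qed

definition pullback :: "('a \<Rightarrow> 'a) \<Rightarrow> 'a set \<Rightarrow> 'a set" where
  "pullback \<theta> N = {a \<in> carrier G. \<theta> a \<in> N}"

lemma image_coset_pullback:
  assumes \<theta>: "\<theta> \<in> iso G G" and N: "N \<subseteq> carrier G" and a: "a \<in> carrier G"
  shows "\<theta> ` (pullback \<theta> N #> a) = N #> \<theta> a"
proof
  have mult: "\<theta> (x \<otimes> y) = \<theta> x \<otimes> \<theta> y" if "x \<in> carrier G" "y \<in> carrier G" for x y
    using \<theta> that by (auto simp: iso_def hom_def)
  show "\<theta> ` (pullback \<theta> N #> a) \<subseteq> N #> \<theta> a" using a mult by (auto simp: r_coset_def pullback_def)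
  show "N #> \<theta> a \<subseteq> \<theta> ` (pullback \<theta> N #> a)"
  proof
    fix y assume "y \<in> N #> \<theta> a"
    then obtain n where n: "n \<in> N" "y = n \<otimes> \<theta> a" by (auto simp: r_coset_def)
    have "n \<in> \<theta> ` carrier G" using n(1) N \<theta> by (auto simp: iso_def bij_betw_def)
    then obtain m where m: "m \<in> carrier G" "n = \<theta> m" by blast
    then have "y = \<theta> (m \<otimes> a)" "m \<otimes> a \<in> pullback \<theta> N #> a"
      using n a mult by (auto simp: r_coset_def pullback_def)
    then show "y \<in> \<theta> ` (pullback \<theta> N #> a)" by blast
  qed
qed

lemma pullback_normal:
  assumes \<theta>: "\<theta> \<in> iso G G" and N: "N \<lhd> G"
  shows "pullback \<theta> N \<lhd> G"
proof -
  interpret N: normal N G by (rule N)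
  interpret \<theta>: group_hom G G \<theta> using \<theta> by unfold_locales (simp add: iso_def)
  show ?thesis
    unfolding normal_inv_iff
  proof (intro conjI ballI)
    show "subgroup (pullback \<theta> N) G"
      by (rule subgroupI) (use N.one_closed \<theta>.hom_one in \<open>auto simp: pullback_def\<close>)
    fix x h assume "x \<in> carrier G" "h \<in> pullback \<theta> N"
    then show "x \<otimes> h \<otimes> inv x \<in> pullback \<theta> N" by (auto simp: pullback_def intro: N.inv_op_closed2)
  qed
qed

text \<open>The quotients by \<open>N\<close> and by its preimage are isomorphic, so that one of them is finite and
  solvable if the other is.\<close>

lemma pullback_kernel:
  assumes \<theta>: "\<theta> \<in> iso G G" and N: "N \<in> kernels"
  shows "pullback \<theta> N \<in> kernels"
proof -
  note nN = kernels_normal[OF N]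
  note nM = pullback_normal[OF \<theta> nN]
  note im = image_coset_pullback[OF \<theta> kernels_subset[OF N]]
  have th: "\<theta> a \<in> carrier G" if "a \<in> carrier G" for a using \<theta> that by (auto simp: iso_def hom_def)
  have mult: "\<theta> (x \<otimes> y) = \<theta> x \<otimes> \<theta> y" if "x \<in> carrier G" "y \<in> carrier G" for x y
    using \<theta> that by (auto simp: iso_def hom_def)
  have inj: "inj_on \<theta> (carrier G)" using \<theta> by (simp add: iso_def bij_betw_def)
  have hom: "(\<lambda>C. \<theta> ` C) \<in> hom (G Mod pullback \<theta> N) (G Mod N)"
  proof (rule homI)
    fix C assume "C \<in> carrier (G Mod pullback \<theta> N)"
    then obtain a where a: "a \<in> carrier G" "C = pullback \<theta> N #> a" by (auto simp: carrier_Mod RCOSETS_def)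
    then show "\<theta> ` C \<in> carrier (G Mod N)"
      unfolding a(2) im[OF a(1)] carrier_Mod by (intro rcosetsI kernels_subset N th)
    fix D assume "D \<in> carrier (G Mod pullback \<theta> N)"
    then obtain b where b: "b \<in> carrier G" "D = pullback \<theta> N #> b" by (auto simp: carrier_Mod RCOSETS_def)
    show "\<theta> ` (C \<otimes>\<^bsub>G Mod pullback \<theta> N\<^esub> D) = \<theta> ` C \<otimes>\<^bsub>G Mod N\<^esub> \<theta> ` D"
      unfolding mult_Mod a(2) b(2) normal.rcos_sum[OF nM a(1) b(1)] im[OF a(1)] im[OF b(1)]
        im[OF m_closed[OF a(1) b(1)]] mult[OF a(1) b(1)] normal.rcos_sum[OF nN th[OF a(1)] th[OF b(1)]] ..
  qed
  have inj': "inj_on (\<lambda>C. \<theta> ` C) (carrier (G Mod pullback \<theta> N))"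
  proof (rule inj_onI)
    fix C D assume "C \<in> carrier (G Mod pullback \<theta> N)" "D \<in> carrier (G Mod pullback \<theta> N)" "\<theta> ` C = \<theta> ` D"
    moreover have "carrier (G Mod pullback \<theta> N) \<subseteq> Pow (carrier G)"
      using rcosets_subset_PowG[OF normal_imp_subgroup[OF nM]] by (simp add: carrier_Mod)
    ultimately show "C = D" using inj_on_image_eq_iff[OF inj, of C D] by blast
  qed
  have "finite (carrier (G Mod N))" using N by (simp add: solvable_quotient_kernels_def)
  then have "finite (carrier (G Mod pullback \<theta> N))"
    by (rule inj_on_finite[OF inj' image_subsetI, rotated]) (rule hom_carrier[OF hom, THEN subsetD], rule imageI)
  moreover have "solvable (G Mod pullback \<theta> N)"
  proof (rule group_hom.inj_hom_imp_solvable[OF _ inj'])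
    show "group_hom (G Mod pullback \<theta> N) (G Mod N) (\<lambda>C. \<theta> ` C)"
      using hom group_Mod[OF nM] group_Mod[OF nN]
      by (simp add: group_hom_def group_hom_axioms_def)
    show "solvable (G Mod N)" using N by (simp add: solvable_quotient_kernels_def)
  qed
  ultimately show ?thesis using nM by (simp add: solvable_quotient_kernels_def)
qed

lemma completion_map_apply:
  "x \<in> carrier Ghat \<Longrightarrow> N \<in> kernels \<Longrightarrow> completion_map G \<theta> x N = \<theta> ` x (pullback \<theta> N)"
  by (simp add: completion_map_def pullback_def)

lemma completion_map_component:
  assumes "\<theta> \<in> iso G G" "x \<in> carrier Ghat" "N \<in> kernels" "g \<in> x (pullback \<theta> N)"
  shows "completion_map G \<theta> x N = N #> \<theta> g"
  using coset_mem[OF assms(2) pullback_kernel[OF assms(1,3)] assms(4)]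
    image_coset_pullback[OF assms(1) kernels_subset[OF assms(3)]] completion_map_apply[OF assms(2,3)] by simp

lemma completion_map_closed:
  assumes \<theta>: "\<theta> \<in> iso G G" and x: "x \<in> carrier Ghat"
  shows "completion_map G \<theta> x \<in> carrier Ghat"
  unfolding carrier_Ghat
proof (intro conjI ballI impI)
  have th: "\<theta> a \<in> carrier G" if "a \<in> carrier G" for a using \<theta> that by (auto simp: iso_def hom_def)
  show "completion_map G \<theta> x \<in> extensional kernels" using x by (simp add: completion_map_def)
  show "completion_map G \<theta> x N \<in> rcosets N" if N: "N \<in> kernels" for N
  proof -
    obtain g where g: "g \<in> x (pullback \<theta> N)" "g \<in> carrier G"
      using coset_ex[OF x pullback_kernel[OF \<theta> N]] by blast
    show ?thesis using completion_map_component[OF \<theta> x N g(1)] g th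
      by (simp add: rcosetsI kernels_subset N)
  qed
  fix M N assume M: "M \<in> kernels" and N: "N \<in> kernels" and NM: "N \<subseteq> M"
  let ?M = "pullback \<theta> M" and ?N = "pullback \<theta> N"
  have NM': "?N \<subseteq> ?M" using NM by (auto simp: pullback_def)
  obtain g where g: "g \<in> x ?N" "g \<in> carrier G" "x ?N = ?N #> g"
    using coset_ex[OF x pullback_kernel[OF \<theta> N]] by blast
  have "x ?M = ?M <#> x ?N"
    using x pullback_kernel[OF \<theta> M] pullback_kernel[OF \<theta> N] NM'
    unfolding carrier_Ghat by metis
  also have "\<dots> = ?M #> g"
    unfolding g(3)
    by (intro mult_larger_coset kernels_subgroup pullback_kernel[OF \<theta>] M N NM' g(2))
  finally have "g \<in> x ?M"
    using rcos_self[OF g(2) kernels_subgroup[OF pullback_kernel[OF \<theta> M]]] by simp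
  then show "M <#> completion_map G \<theta> x N = completion_map G \<theta> x M"
    using completion_map_component[OF \<theta> x M] completion_map_component[OF \<theta> x N g(1)]
      mult_larger_coset[OF kernels_subgroup[OF M] kernels_subgroup[OF N] NM th[OF g(2)]] by simp
qed

lemma completion_map_hom:
  assumes \<theta>: "\<theta> \<in> iso G G"
  shows "completion_map G \<theta> \<in> hom Ghat Ghat"
proof (rule homI)
  fix x y assume x: "x \<in> carrier Ghat" and y: "y \<in> carrier Ghat"
  have hm: "\<theta> (a \<otimes> b) = \<theta> a \<otimes> \<theta> b" "\<theta> a \<in> carrier G" if "a \<in> carrier G" "b \<in> carrier G" for a b
    using \<theta> that by (auto simp: iso_def hom_def)
  show "completion_map G \<theta> (x \<otimes>\<^bsub>Ghat\<^esub> y) = completion_map G \<theta> x \<otimes>\<^bsub>Ghat\<^esub> completion_map G \<theta> y"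
  proof (rule Ghat_ext)
    fix N assume N: "N \<in> kernels"
    let ?N = "pullback \<theta> N"
    note N' = pullback_kernel[OF \<theta> N]
    obtain g where g: "g \<in> x ?N" "g \<in> carrier G" using coset_ex[OF x N'] by metis
    obtain h where h: "h \<in> y ?N" "h \<in> carrier G" using coset_ex[OF y N'] by metis
    have gh: "g \<otimes> h \<in> (x \<otimes>\<^bsub>Ghat\<^esub> y) ?N"
      using mult_component[OF x y N' g(1) h(1)] rcos_self[OF _ kernels_subgroup[OF N']] g h by simp
    have self: "\<theta> g \<in> completion_map G \<theta> x N" "\<theta> h \<in> completion_map G \<theta> y N"
      using completion_map_component[OF \<theta> x N g(1)] completion_map_component[OF \<theta> y N h(1)]
        rcos_self[OF _ kernels_subgroup[OF N]] hm g h by auto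
    show "completion_map G \<theta> (x \<otimes>\<^bsub>Ghat\<^esub> y) N = (completion_map G \<theta> x \<otimes>\<^bsub>Ghat\<^esub> completion_map G \<theta> y) N"
      using completion_map_component[OF \<theta> Ghat.m_closed[OF x y] N gh] x y hm g h
        mult_component[OF completion_map_closed[OF \<theta> x] completion_map_closed[OF \<theta> y] N self] by simp
  qed (use x y completion_map_closed[OF \<theta>] in auto)
qed (rule completion_map_closed[OF \<theta>])

lemma completion_map_compose:
  assumes "\<theta> \<in> iso G G" "\<eta> \<in> iso G G" "x \<in> carrier Ghat"
  shows "completion_map G \<theta> (completion_map G \<eta> x) = completion_map G (\<lambda>a. \<theta> (\<eta> a)) x"
proof (rule Ghat_ext)
  have c: "(\<lambda>a. \<theta> (\<eta> a)) \<in> iso G G"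
    using iso_set_trans[OF assms(2,1)] by (simp add: comp_def)
  note cl = completion_map_closed[OF assms(2,3)]
  show "completion_map G \<theta> (completion_map G \<eta> x) \<in> carrier Ghat"
    "completion_map G (\<lambda>a. \<theta> (\<eta> a)) x \<in> carrier Ghat"
    using completion_map_closed[OF assms(1) cl] completion_map_closed[OF c assms(3)] .
  fix N assume N: "N \<in> kernels"
  have "pullback \<eta> (pullback \<theta> N) = pullback (\<lambda>a. \<theta> (\<eta> a)) N"
    using assms(2) by (auto simp: iso_def hom_def pullback_def)
  then show "completion_map G \<theta> (completion_map G \<eta> x) N = completion_map G (\<lambda>a. \<theta> (\<eta> a)) x N"
    using completion_map_apply[OF cl N] completion_map_apply[OF assms(3) N]
      completion_map_apply[OF assms(3) pullback_kernel[OF assms(1) N]] by (simp add: image_image)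
qed

lemma completion_map_cong:
  assumes "\<And>a. a \<in> carrier G \<Longrightarrow> \<theta> a = \<eta> a" "\<theta> \<in> iso G G"
  shows "completion_map G \<theta> = completion_map G \<eta>"
proof (intro ext)
  fix x N
  have e: "pullback \<theta> N = pullback \<eta> N" for N using assms(1) by (auto simp: pullback_def)
  show "completion_map G \<theta> x N = completion_map G \<eta> x N"
  proof (cases "x \<in> carrier Ghat \<and> N \<in> kernels")
    case True
    then have "a \<in> carrier G" if "a \<in> x (pullback \<theta> N)" for a
      using coset_mem(1) pullback_kernel[OF assms(2)] that by blast
    then have "\<theta> ` x (pullback \<theta> N) = \<eta> ` x (pullback \<theta> N)"
      using assms(1) by (intro image_cong) auto
    then show ?thesis using True e by (simp add: completion_map_apply)
  qed (auto simp: completion_map_def)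
qed

lemma completion_map_id:
  assumes "x \<in> carrier Ghat"
  shows "completion_map G (\<lambda>a. a) x = x"
proof -
  have "pullback (\<lambda>a. a) N = N" if "N \<in> kernels" for N using kernels_subset[OF that] by (auto simp: pullback_def)
  then have "completion_map G (\<lambda>a. a) x N = x N" if "N \<in> kernels" for N
    using completion_map_apply[OF assms that] that by simp
  moreover have "(\<lambda>a. a) \<in> iso G G" by (auto simp: iso_def hom_def bij_betw_def)
  ultimately show ?thesis using completion_map_closed assms by (intro Ghat_ext)
qed

lemma completion_map_continuous:
  assumes \<theta>: "\<theta> \<in> iso G G"
  shows "continuous_map That That (completion_map G \<theta>)"
proof (rule continuous_into_That)
  show "completion_map G \<theta> \<in> topspace That \<rightarrow> carrier Ghat"
    using completion_map_closed[OF \<theta>] by (auto simp: topspace_That)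
  fix N assume N: "N \<in> kernels"
  have im: "\<theta> ` C \<in> rcosets N" if "C \<in> rcosets pullback \<theta> N" for C
  proof -
    obtain a where a: "a \<in> carrier G" "C = pullback \<theta> N #> a"
      using \<open>C \<in> _\<close> by (auto simp: RCOSETS_def)
    moreover have "\<theta> a \<in> carrier G" using \<theta> a by (auto simp: iso_def hom_def)
    ultimately show ?thesis using image_coset_pullback[OF \<theta> kernels_subset[OF N] a(1)] by (simp add: rcosetsI kernels_subset N)
  qed
  have "continuous_map That (discrete_topology (rcosets N)) (\<lambda>x. \<theta> ` x (pullback \<theta> N))"
    by (rule continuous_component[OF pullback_kernel[OF \<theta> N] im])
  then show "continuous_map That (discrete_topology (rcosets N)) (\<lambda>x. completion_map G \<theta> x N)"
    by (rule continuous_map_eq) (simp add: topspace_That completion_map_apply N)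
qed

end

section \<open>Automorphisms of topological groups\<close>

text \<open>The continuity of the conjugations makes the inner automorphisms homeomorphisms, so that
  they form a normal subgroup of the group of topological automorphisms.\<close>

locale conj_continuous_group = group H for H :: "'b monoid" (structure) +
  fixes T :: "'b topology"
  assumes topspace_eq: "topspace T = carrier H"
    and conj_continuous: "a \<in> carrier H \<Longrightarrow> continuous_map T T (\<lambda>x. a \<otimes> x \<otimes> inv a)"
begin

abbreviation "AutH \<equiv> Aut_group H T"

lemma Aut_iff:
  "\<phi> \<in> carrier AutH \<longleftrightarrow> \<phi> \<in> hom H H \<and> \<phi> \<in> Bij (carrier H) \<and> homeomorphic_map T T \<phi>"
  by (auto simp: Aut_group_def AutoGroup_def auto_def)

lemma Aut_apply [simp]: "\<phi> \<in> carrier AutH \<Longrightarrow> x \<in> carrier H \<Longrightarrow> \<phi> x \<in> carrier H"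
  by (auto simp: Aut_iff hom_def)

lemma Aut_ext:
  assumes "\<phi> \<in> carrier AutH" "\<psi> \<in> carrier AutH" "\<And>x. x \<in> carrier H \<Longrightarrow> \<phi> x = \<psi> x"
  shows "\<phi> = \<psi>"
proof (rule extensionalityI)
  show "\<phi> \<in> extensional (carrier H)" "\<psi> \<in> extensional (carrier H)"
    using assms(1,2) by (simp_all add: Aut_iff Bij_def)
qed (rule assms(3))

lemma Aut_mult_eq:
  "\<phi> \<in> carrier AutH \<Longrightarrow> \<psi> \<in> carrier AutH \<Longrightarrow> \<phi> \<otimes>\<^bsub>AutH\<^esub> \<psi> = compose (carrier H) \<phi> \<psi>"
  by (simp add: Aut_iff) (simp add: Aut_group_def AutoGroup_def BijGroup_def)

lemma Aut_mult_apply [simp]: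
  "\<phi> \<in> carrier AutH \<Longrightarrow> \<psi> \<in> carrier AutH \<Longrightarrow> x \<in> carrier H \<Longrightarrow> (\<phi> \<otimes>\<^bsub>AutH\<^esub> \<psi>) x = \<phi> (\<psi> x)"
  by (simp add: Aut_mult_eq compose_def)

lemma Aut_one: "\<one>\<^bsub>AutH\<^esub> = (\<lambda>x\<in>carrier H. x)"
  by (simp add: Aut_group_def AutoGroup_def BijGroup_def)

lemma group_Aut: "group AutH"
proof -
  interpret A: group "AutoGroup H" by (rule AutoGroup)
  have carr: "carrier AutH \<subseteq> carrier (AutoGroup H)" by (auto simp: Aut_group_def)
  have "subgroup (carrier AutH) (AutoGroup H)"
  proof (rule A.subgroupI)
    have "homeomorphic_map T T (\<lambda>x\<in>carrier H. x)"
      by (rule homeomorphic_map_eq[OF homeomorphic_map_id[THEN iffD2, OF refl]])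
         (simp add: topspace_eq)
    moreover have "(\<lambda>x\<in>carrier H. x) \<in> carrier (AutoGroup H)"
      using id_in_auto by (simp add: AutoGroup_def)
    ultimately show "carrier AutH \<noteq> {}" by (auto simp: Aut_group_def)
  next
    fix \<phi> \<psi> assume m: "\<phi> \<in> carrier AutH" "\<psi> \<in> carrier AutH"
    have e: "\<phi> \<otimes>\<^bsub>AutoGroup H\<^esub> \<psi> = compose (carrier H) \<phi> \<psi>"
      using Aut_mult_eq[OF m] by (simp add: Aut_group_def)
    have "homeomorphic_map T T (\<phi> \<circ> \<psi>)"
      using m by (auto simp: Aut_iff intro: homeomorphic_map_compose)
    then have "homeomorphic_map T T (\<phi> \<otimes>\<^bsub>AutoGroup H\<^esub> \<psi>)"
      unfolding e by (rule homeomorphic_map_eq) (simp add: topspace_eq compose_def)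
    moreover have "\<phi> \<otimes>\<^bsub>AutoGroup H\<^esub> \<psi> \<in> carrier (AutoGroup H)"
      using m carr by (intro A.m_closed) auto
    ultimately show "\<phi> \<otimes>\<^bsub>AutoGroup H\<^esub> \<psi> \<in> carrier AutH" by (simp add: Aut_group_def)
  next
    fix \<phi> assume m: "\<phi> \<in> carrier AutH"
    define \<psi> where "\<psi> = inv\<^bsub>AutoGroup H\<^esub> \<phi>"
    have mA: "\<phi> \<in> carrier (AutoGroup H)" using m carr by blast
    have \<psi>: "\<psi> \<in> carrier (AutoGroup H)" unfolding \<psi>_def by (rule A.inv_closed[OF mA])
    have B: "\<phi> \<in> Bij (carrier H)" "\<psi> \<in> Bij (carrier H)"
      using mA \<psi> by (auto simp: AutoGroup_def auto_def)
    have c: "compose (carrier H) \<psi> \<phi> = (\<lambda>x\<in>carrier H. x)"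
      using A.l_inv[OF mA] B by (simp add: \<psi>_def AutoGroup_def BijGroup_def)
    obtain \<eta> where \<eta>: "homeomorphic_maps T T \<phi> \<eta>"
      using m by (auto simp: Aut_iff homeomorphic_map_maps)
    have "\<psi> y = \<eta> y" if y: "y \<in> carrier H" for y
    proof -
      have "\<eta> y \<in> carrier H" "\<phi> (\<eta> y) = y"
        using \<eta> y topspace_eq by (auto simp: homeomorphic_maps_def continuous_map_def)
      then show ?thesis using fun_cong[OF c, of "\<eta> y"] by (simp add: compose_def)
    qed
    moreover have "homeomorphic_map T T \<eta>"
      using \<eta> homeomorphic_maps_sym homeomorphic_map_maps by blast
    ultimately have "homeomorphic_map T T \<psi>"
      using homeomorphic_map_eq[of T T \<eta> \<psi>] topspace_eq by simp
    then show "inv\<^bsub>AutoGroup H\<^esub> \<phi> \<in> carrier AutH"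
      using \<psi> by (simp add: Aut_group_def \<psi>_def)
  qed (rule carr)
  from subgroup.subgroup_is_group[OF this A.is_group] show ?thesis
    by (simp add: Aut_group_def)
qed

sublocale Aut: group AutH by (rule group_Aut)

lemma Aut_inv_apply:
  assumes "\<phi> \<in> carrier AutH" "x \<in> carrier H"
  shows "\<phi> ((inv\<^bsub>AutH\<^esub> \<phi>) x) = x"
proof -
  have "\<phi> ((inv\<^bsub>AutH\<^esub> \<phi>) x) = (\<phi> \<otimes>\<^bsub>AutH\<^esub> inv\<^bsub>AutH\<^esub> \<phi>) x"
    by (rule Aut_mult_apply[symmetric]) (use assms in auto)
  also have "\<dots> = x" unfolding Aut.r_inv[OF assms(1)] Aut_one using assms by simp
  finally show "\<phi> ((inv\<^bsub>AutH\<^esub> \<phi>) x) = x" .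
qed

lemma cancel_inv:
  "a \<in> carrier H \<Longrightarrow> x \<in> carrier H \<Longrightarrow> a \<otimes> (inv a \<otimes> x) = x"
  "a \<in> carrier H \<Longrightarrow> x \<in> carrier H \<Longrightarrow> inv a \<otimes> (a \<otimes> x) = x"
  by (simp_all flip: m_assoc)

definition conjugation :: "'b \<Rightarrow> 'b \<Rightarrow> 'b" where
  "conjugation a = (\<lambda>x\<in>carrier H. a \<otimes> x \<otimes> inv a)"

lemma Inn_eq: "Inn H = conjugation ` carrier H"
  by (auto simp: Inn_def conjugation_def)

lemma conjugation_Aut:
  assumes a: "a \<in> carrier H" shows "conjugation a \<in> carrier AutH"
proof -
  have inv: "inv a \<otimes> (a \<otimes> x \<otimes> inv a) \<otimes> inv (inv a) = x" "a \<otimes> (inv a \<otimes> x \<otimes> inv (inv a)) \<otimes> inv a = x"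
    if "x \<in> carrier H" for x
    using a that by (simp_all add: m_assoc cancel_inv)
  have "homeomorphic_maps T T (\<lambda>x. a \<otimes> x \<otimes> inv a) (\<lambda>x. inv a \<otimes> x \<otimes> inv (inv a))"
    unfolding homeomorphic_maps_def
    using conj_continuous[OF a] conj_continuous[OF inv_closed[OF a]] inv by (simp add: topspace_eq)
  then have "homeomorphic_map T T (\<lambda>x. a \<otimes> x \<otimes> inv a)" using homeomorphic_map_maps by blast
  then have "homeomorphic_map T T (conjugation a)"
    by (rule homeomorphic_map_eq) (simp add: topspace_eq conjugation_def)
  moreover have "bij_betw (conjugation a) (carrier H) (carrier H)"
    by (rule bij_betw_byWitness[where f' = "\<lambda>x. inv a \<otimes> x \<otimes> inv (inv a)"])
       (use a inv in \<open>auto simp: conjugation_def\<close>)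
  moreover have "conjugation a \<in> hom H H"
  proof (rule homI)
    fix x y assume xy: "x \<in> carrier H" "y \<in> carrier H"
    have "a \<otimes> (x \<otimes> y) \<otimes> inv a = a \<otimes> x \<otimes> (inv a \<otimes> a) \<otimes> y \<otimes> inv a" using a xy by (simp add: m_assoc)
    also have "\<dots> = a \<otimes> x \<otimes> inv a \<otimes> (a \<otimes> y \<otimes> inv a)" using a xy by (simp only: m_assoc m_closed inv_closed)
    finally show "conjugation a (x \<otimes> y) = conjugation a x \<otimes> conjugation a y"
      using xy by (simp add: conjugation_def)
  qed (use a in \<open>auto simp: conjugation_def\<close>)
  ultimately show ?thesis by (simp add: Aut_iff Bij_def conjugation_def)
qed

lemma Inn_normal: "Inn H \<lhd> AutH"
  unfolding Aut.normal_inv_iff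
proof (intro conjI ballI)
  show "subgroup (Inn H) AutH"
  proof (rule Aut.subgroupI)
    show "Inn H \<subseteq> carrier AutH" using conjugation_Aut by (auto simp: Inn_eq)
    show "Inn H \<noteq> {}" by (auto simp: Inn_eq)
    show "\<phi> \<otimes>\<^bsub>AutH\<^esub> \<psi> \<in> Inn H" if in_Inn: "\<phi> \<in> Inn H" "\<psi> \<in> Inn H" for \<phi> \<psi>
    proof -
      obtain a b where ab: "a \<in> carrier H" "b \<in> carrier H" "\<phi> = conjugation a" "\<psi> = conjugation b"
        using in_Inn unfolding Inn_eq by blast
      have "\<phi> \<otimes>\<^bsub>AutH\<^esub> \<psi> = conjugation (a \<otimes> b)"
      proof (rule Aut_ext)
        fix x assume x: "x \<in> carrier H"
        show "(\<phi> \<otimes>\<^bsub>AutH\<^esub> \<psi>) x = conjugation (a \<otimes> b) x"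
          unfolding ab(3,4) Aut_mult_apply[OF conjugation_Aut[OF ab(1)] conjugation_Aut[OF ab(2)] x]
          using ab x by (simp add: conjugation_def inv_mult_group m_assoc)
      qed (use ab conjugation_Aut in auto)
      then show ?thesis using ab by (auto simp: Inn_eq)
    qed
    show "inv\<^bsub>AutH\<^esub> \<phi> \<in> Inn H" if in_Inn: "\<phi> \<in> Inn H" for \<phi>
    proof -
      obtain a where a: "a \<in> carrier H" "\<phi> = conjugation a" using in_Inn unfolding Inn_eq by blast
      have "conjugation (inv a) \<otimes>\<^bsub>AutH\<^esub> \<phi> = \<one>\<^bsub>AutH\<^esub>"
      proof (rule Aut_ext)
        fix x assume x: "x \<in> carrier H"
        show "(conjugation (inv a) \<otimes>\<^bsub>AutH\<^esub> \<phi>) x = \<one>\<^bsub>AutH\<^esub> x"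
          unfolding a(2) Aut_mult_apply[OF conjugation_Aut[OF inv_closed[OF a(1)]] conjugation_Aut[OF a(1)] x]
          using a x by (simp add: conjugation_def Aut_one m_assoc cancel_inv)
      qed (use a conjugation_Aut in auto)
      then have "inv\<^bsub>AutH\<^esub> \<phi> = conjugation (inv a)"
        using a conjugation_Aut by (intro Aut.inv_equality) auto
      then show ?thesis using a by (auto simp: Inn_eq)
    qed
  qed
  fix \<phi> h assume \<phi>: "\<phi> \<in> carrier AutH" and "h \<in> Inn H"
  then obtain a where a: "a \<in> carrier H" "h = conjugation a" by (auto simp: Inn_eq)
  have hm: "\<phi> \<in> hom H H" using \<phi> by (simp add: Aut_iff)
  interpret \<phi>: group_hom H H \<phi> by unfold_locales (rule hm)
  have "\<phi> \<otimes>\<^bsub>AutH\<^esub> h \<otimes>\<^bsub>AutH\<^esub> inv\<^bsub>AutH\<^esub> \<phi> = conjugation (\<phi> a)"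
  proof (rule Aut_ext)
    fix x assume x: "x \<in> carrier H"
    let ?y = "(inv\<^bsub>AutH\<^esub> \<phi>) x"
    have y: "?y \<in> carrier H" "\<phi> ?y = x" using \<phi> x Aut_inv_apply by auto
    have "(\<phi> \<otimes>\<^bsub>AutH\<^esub> h \<otimes>\<^bsub>AutH\<^esub> inv\<^bsub>AutH\<^esub> \<phi>) x = \<phi> (h ?y)"
      using \<phi> a conjugation_Aut x y by simp
    also have "\<dots> = \<phi> a \<otimes> x \<otimes> inv (\<phi> a)"
      using a y by (simp add: conjugation_def)
    finally show "(\<phi> \<otimes>\<^bsub>AutH\<^esub> h \<otimes>\<^bsub>AutH\<^esub> inv\<^bsub>AutH\<^esub> \<phi>) x = conjugation (\<phi> a) x"
      using x by (simp add: conjugation_def)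
  qed (use \<phi> a conjugation_Aut in auto)
  then show "\<phi> \<otimes>\<^bsub>AutH\<^esub> h \<otimes>\<^bsub>AutH\<^esub> inv\<^bsub>AutH\<^esub> \<phi> \<in> Inn H"
    using \<phi> a by (auto simp: Inn_eq)
qed

abbreviation "to_Out \<phi> \<equiv> Inn H #>\<^bsub>AutH\<^esub> \<phi>"

lemma group_Out: "group (Out_group H T)"
  unfolding Out_group_def by (rule normal.factorgroup_is_group[OF Inn_normal])

lemma to_Out_hom: "(\<lambda>\<phi>. to_Out \<phi>) \<in> hom AutH (Out_group H T)"
  unfolding Out_group_def by (rule normal.r_coset_hom_Mod[OF Inn_normal])

lemma to_Out_eqD:
  assumes "\<phi> \<in> carrier AutH" "\<psi> \<in> carrier AutH" "to_Out \<phi> = to_Out \<psi>"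
  obtains a where "a \<in> carrier H" "\<phi> = conjugation a \<otimes>\<^bsub>AutH\<^esub> \<psi>"
proof -
  have "\<phi> \<in> to_Out \<psi>"
    using Aut.rcos_self[OF assms(1) normal_imp_subgroup[OF Inn_normal]] assms(3) by simp
  then show ?thesis using that by (auto simp: r_coset_def Inn_eq)
qed

lemma to_Out_conjugation:
  assumes "a \<in> carrier H" "\<psi> \<in> carrier AutH"
  shows "to_Out (conjugation a \<otimes>\<^bsub>AutH\<^esub> \<psi>) = to_Out \<psi>"
proof -
  have "conjugation a \<otimes>\<^bsub>AutH\<^esub> \<psi> \<in> to_Out \<psi>"
    using assms by (auto simp: r_coset_def Inn_eq)
  from Aut.repr_independence[OF this assms(2) normal_imp_subgroup[OF Inn_normal]] show ?thesis by simp
qed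

definition Aut_nbhd :: "('b \<Rightarrow> 'b) \<Rightarrow> 'b set \<Rightarrow> ('b \<Rightarrow> 'b) set" where
  "Aut_nbhd \<phi> U = {\<psi> \<in> carrier AutH. \<forall>x\<in>carrier H. \<psi> x \<in> \<phi> x <# U}"

lemma Aut_topology_eq:
  "Aut_topology H T = topology_generated_by {Aut_nbhd \<phi> U | \<phi> U. \<phi> \<in> carrier AutH \<and> U \<lhd> H \<and> openin T U}"
  by (simp add: Aut_topology_def Aut_nbhd_def)

lemma open_Aut_nbhd:
  "\<phi> \<in> carrier AutH \<Longrightarrow> U \<lhd> H \<Longrightarrow> openin T U \<Longrightarrow> openin (Aut_topology H T) (Aut_nbhd \<phi> U)"
  unfolding Aut_topology_eq by (rule topology_generated_by_Basis) blast

lemma Aut_nbhd_self: "\<phi> \<in> carrier AutH \<Longrightarrow> U \<lhd> H \<Longrightarrow> \<phi> \<in> Aut_nbhd \<phi> U"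
  using subgroup.one_closed[OF normal_imp_subgroup, of U H] by (force simp: Aut_nbhd_def l_coset_def)

lemma topspace_Aut: "topspace (Aut_topology H T) = carrier AutH"
proof
  show "topspace (Aut_topology H T) \<subseteq> carrier AutH"
    unfolding Aut_topology_eq topology_generated_by_topspace by (auto simp: Aut_nbhd_def)
  show "carrier AutH \<subseteq> topspace (Aut_topology H T)"
  proof
    fix \<phi> assume "\<phi> \<in> carrier AutH"
    moreover have "openin T (carrier H)" using topspace_eq openin_topspace by metis
    moreover have "carrier H \<lhd> H" by (rule normal_self)
    ultimately show "\<phi> \<in> topspace (Aut_topology H T)"
      using open_Aut_nbhd Aut_nbhd_self openin_subset by (metis subsetD)
  qed
qed

lemma topspace_Out: "topspace (Out_topology H T) = carrier (Out_group H T)"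
proof -
  have "topspace (Out_topology H T) = (\<lambda>\<phi>. to_Out \<phi>) ` carrier AutH"
    unfolding Out_topology_def
    using quotient_imp_surjective_map[OF quotient_map_quotient_topology[of "Aut_topology H T" "\<lambda>\<phi>. to_Out \<phi>"]]
    by (simp add: topspace_Aut)
  then show ?thesis by (auto simp: Out_group_def FactGroup_def RCOSETS_def)
qed

lemma openin_Out:
  "openin (Out_topology H T) V \<longleftrightarrow>
     V \<subseteq> carrier (Out_group H T) \<and> openin (Aut_topology H T) {\<phi> \<in> carrier AutH. to_Out \<phi> \<in> V}"
  unfolding Out_topology_def openin_quotient_topology topspace_Aut
  by (auto simp: Out_group_def FactGroup_def RCOSETS_def)

text \<open>The neighbourhoods of the identity arise from basic open sets by finite intersections and
  unions, and a basic open set around some automorphism that contains the identity is also a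
  basic open set around the identity.\<close>

lemma Aut_neighbourhood_induct:
  assumes V: "openin (Aut_topology H T) V" "\<one>\<^bsub>AutH\<^esub> \<in> V"
    and basic: "\<And>U. U \<lhd> H \<Longrightarrow> openin T U \<Longrightarrow> P (Aut_nbhd \<one>\<^bsub>AutH\<^esub> U)"
    and inter: "\<And>A B. P A \<Longrightarrow> P B \<Longrightarrow> P (A \<inter> B)"
    and mono: "\<And>A B. P A \<Longrightarrow> A \<subseteq> B \<Longrightarrow> P B"
  shows "P V"
proof -
  have "generate_topology_on {Aut_nbhd \<phi> U | \<phi> U. \<phi> \<in> carrier AutH \<and> U \<lhd> H \<and> openin T U} V"
    using V(1) unfolding Aut_topology_eq openin_topology_generated_by_iff .
  then show ?thesis using V(2)
  proof (induction V)
    case (UN K)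
    then obtain k where "k \<in> K" "\<one>\<^bsub>AutH\<^esub> \<in> k" by blast
    then show ?case using UN(2)[of k] mono[of k "\<Union>K"] by blast
  next
    case (Basis s)
    then obtain \<phi> U where s: "s = Aut_nbhd \<phi> U" "\<phi> \<in> carrier AutH" "U \<lhd> H" "openin T U" by blast
    interpret U: normal U H by (rule s(3))
    have eq: "\<phi> x <# U = x <# U" if x: "x \<in> carrier H" for x
    proof -
      have "x \<in> \<phi> x <# U" using Basis(2) x by (auto simp: s(1) Aut_nbhd_def Aut_one)
      then show ?thesis using l_repr_independence[of x "\<phi> x" U] s(2) x U.subgroup_axioms by simp
    qed
    have "Aut_nbhd \<phi> U = Aut_nbhd \<one>\<^bsub>AutH\<^esub> U"
      by (auto simp: Aut_nbhd_def eq Aut_one)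
    then show ?case using basic[OF s(3,4)] s(1) by simp
  qed (use inter in auto)
qed

end

section \<open>Automorphisms of the completion induced from the discrete group\<close>

context discrete_group
begin

lemma conj_continuous_Ghat:
  assumes a: "a \<in> carrier Ghat"
  shows "continuous_map That That (\<lambda>x. a \<otimes>\<^bsub>Ghat\<^esub> x \<otimes>\<^bsub>Ghat\<^esub> inv\<^bsub>Ghat\<^esub> a)"
proof (rule continuous_into_That)
  show "(\<lambda>x. a \<otimes>\<^bsub>Ghat\<^esub> x \<otimes>\<^bsub>Ghat\<^esub> inv\<^bsub>Ghat\<^esub> a) \<in> topspace That \<rightarrow> carrier Ghat"
    using a by (auto simp: topspace_That)
  fix N assume N: "N \<in> kernels"
  interpret N: normal N G by (rule kernels_normal[OF N])
  have r: "a N \<in> rcosets N" "(inv\<^bsub>Ghat\<^esub> a) N \<in> rcosets N"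
    using a Ghat.inv_closed[OF a] N by (auto simp: carrier_Ghat)
  have "continuous_map That (discrete_topology (rcosets N)) (\<lambda>x. a N <#> x N <#> (inv\<^bsub>Ghat\<^esub> a) N)"
    using r by (intro continuous_component N N.setmult_closed)
  then show "continuous_map That (discrete_topology (rcosets N))
      (\<lambda>x. (a \<otimes>\<^bsub>Ghat\<^esub> x \<otimes>\<^bsub>Ghat\<^esub> inv\<^bsub>Ghat\<^esub> a) N)"
    by (rule continuous_map_eq) (simp add: mult_Ghat N)
qed

end

sublocale discrete_group \<subseteq> Top: conj_continuous_group Ghat That
  by unfold_locales (rule topspace_That, rule conj_continuous_Ghat)

context discrete_group
begin

lemma completion_map_Aut:
  assumes \<theta>: "\<theta> \<in> iso G G"
  shows "completion_map G \<theta> \<in> carrier Top.AutH"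
proof -
  let ?\<eta> = "inv_into (carrier G) \<theta>"
  have \<eta>: "?\<eta> \<in> iso G G" using iso_set_sym[OF \<theta>] .
  have bij: "bij_betw \<theta> (carrier G) (carrier G)" using \<theta> by (simp add: iso_def)
  have idiso: "(\<lambda>a. a) \<in> iso G G" by (auto simp: iso_def hom_def bij_betw_def)
  have 1: "completion_map G ?\<eta> (completion_map G \<theta> x) = x" if x: "x \<in> carrier Ghat" for x
  proof -
    have "completion_map G (\<lambda>a. a) = completion_map G (\<lambda>a. ?\<eta> (\<theta> a))"
      by (rule completion_map_cong[OF _ idiso]) (use bij in \<open>simp add: bij_betw_def\<close>)
    then show ?thesis using completion_map_compose[OF \<eta> \<theta> x] completion_map_id[OF x] by simp
  qed
  have 2: "completion_map G \<theta> (completion_map G ?\<eta> x) = x" if x: "x \<in> carrier Ghat" for x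
  proof -
    have "completion_map G (\<lambda>a. a) = completion_map G (\<lambda>a. \<theta> (?\<eta> a))"
      by (rule completion_map_cong[OF _ idiso]) (use bij in \<open>simp add: bij_betw_def f_inv_into_f\<close>)
    then show ?thesis using completion_map_compose[OF \<theta> \<eta> x] completion_map_id[OF x] by simp
  qed
  have "homeomorphic_maps That That (completion_map G \<theta>) (completion_map G ?\<eta>)"
    unfolding homeomorphic_maps_def
    using completion_map_continuous[OF \<theta>] completion_map_continuous[OF \<eta>] 1 2
    by (simp add: topspace_That)
  then have "homeomorphic_map That That (completion_map G \<theta>)" using homeomorphic_map_maps by blast
  moreover have "bij_betw (completion_map G \<theta>) (carrier Ghat) (carrier Ghat)"
    by (rule bij_betw_byWitness[where f' = "completion_map G ?\<eta>"])
       (use 1 2 completion_map_closed[OF \<theta>] completion_map_closed[OF \<eta>] in auto)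
  ultimately show ?thesis
    unfolding Top.Aut_iff Bij_def using completion_map_hom[OF \<theta>] by (simp add: completion_map_def)
qed

lemma completion_map_mult:
  assumes "\<theta> \<in> iso G G" "\<eta> \<in> iso G G"
  shows "completion_map G \<theta> \<otimes>\<^bsub>Top.AutH\<^esub> completion_map G \<eta> = completion_map G (\<lambda>a. \<theta> (\<eta> a))"
proof (rule Top.Aut_ext)
  have "(\<lambda>a. \<theta> (\<eta> a)) \<in> iso G G" using iso_set_trans[OF assms(2,1)] by (simp add: comp_def)
  then show "completion_map G (\<lambda>a. \<theta> (\<eta> a)) \<in> carrier Top.AutH" by (rule completion_map_Aut)
qed (use assms completion_map_Aut completion_map_compose in auto)

lemma conj_iso:
  assumes "g \<in> carrier G" shows "(\<lambda>x. g \<otimes> x \<otimes> inv g) \<in> iso G G"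
proof -
  have c: "g \<otimes> (inv g \<otimes> x) = x" "inv g \<otimes> (g \<otimes> x) = x" if "x \<in> carrier G" for x
    using assms that by (simp_all flip: m_assoc)
  have "bij_betw (\<lambda>x. g \<otimes> x \<otimes> inv g) (carrier G) (carrier G)"
    by (rule bij_betw_byWitness[where f' = "\<lambda>x. inv g \<otimes> x \<otimes> g"])
       (use assms c in \<open>auto simp: m_assoc\<close>)
  then show ?thesis using assms c by (auto simp: iso_def hom_def m_assoc)
qed

text \<open>Conjugation by \<open>g\<close> preserves every normal subgroup and induces on each quotient the
  conjugation by the coset of \<open>g\<close>.\<close>

lemma completion_map_conj:
  assumes g: "g \<in> carrier G"
  shows "completion_map G (\<lambda>x. g \<otimes> x \<otimes> inv g) = Top.conjugation (diagonal g)"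
proof (rule Top.Aut_ext)
  note th = conj_iso[OF g]
  show "completion_map G (\<lambda>x. g \<otimes> x \<otimes> inv g) \<in> carrier Top.AutH" using th by (rule completion_map_Aut)
  show "Top.conjugation (diagonal g) \<in> carrier Top.AutH" by (intro Top.conjugation_Aut diagonal_closed g)
  fix x assume x: "x \<in> carrier Ghat"
  have "completion_map G (\<lambda>x. g \<otimes> x \<otimes> inv g) x = diagonal g \<otimes>\<^bsub>Ghat\<^esub> x \<otimes>\<^bsub>Ghat\<^esub> inv\<^bsub>Ghat\<^esub> diagonal g"
  proof (rule Ghat_ext)
    show "completion_map G (\<lambda>x. g \<otimes> x \<otimes> inv g) x \<in> carrier Ghat" by (rule completion_map_closed[OF th x])
    show "diagonal g \<otimes>\<^bsub>Ghat\<^esub> x \<otimes>\<^bsub>Ghat\<^esub> inv\<^bsub>Ghat\<^esub> diagonal g \<in> carrier Ghat"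
      using x diagonal_closed[OF g] by simp
    fix N assume N: "N \<in> kernels"
    interpret N: normal N G by (rule kernels_normal[OF N])
    note self = rcos_self[OF _ kernels_subgroup[OF N]]
    have pre: "pullback (\<lambda>x. g \<otimes> x \<otimes> inv g) N = N"
    proof -
      have "a \<in> N" if a: "a \<in> carrier G" "g \<otimes> a \<otimes> inv g \<in> N" for a
      proof -
        have "inv g \<otimes> (g \<otimes> a \<otimes> inv g) \<otimes> g \<in> N" using N.inv_op_closed1[OF g a(2)] .
        moreover have "inv g \<otimes> (g \<otimes> a \<otimes> inv g) \<otimes> g = (inv g \<otimes> g) \<otimes> a \<otimes> (inv g \<otimes> g)"
          using g a(1) by (simp only: m_assoc m_closed inv_closed)
        ultimately show ?thesis using g a(1) by simp
      qed
      then have "pullback (\<lambda>x. g \<otimes> x \<otimes> inv g) N \<subseteq> N" unfolding pullback_def by blast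
      moreover have "N \<subseteq> pullback (\<lambda>x. g \<otimes> x \<otimes> inv g) N"
        unfolding pullback_def using N.inv_op_closed2[OF g] kernels_subset[OF N] by blast
      ultimately show ?thesis by (rule equalityI)
    qed
    obtain h where h: "h \<in> x N" "h \<in> carrier G" using coset_ex[OF x N] by metis
    have d: "g \<in> diagonal g N" using self[OF g] N by (simp add: diagonal_def)
    have di: "inv g \<in> (inv\<^bsub>Ghat\<^esub> diagonal g) N"
      using inv_component[OF diagonal_closed[OF g] N d] self[of "inv g"] g by simp
    have "g \<otimes> h \<in> (diagonal g \<otimes>\<^bsub>Ghat\<^esub> x) N"
      using mult_component[OF diagonal_closed[OF g] x N d h(1)] self[of "g \<otimes> h"] g h by simp
    from mult_component[OF Ghat.m_closed[OF diagonal_closed[OF g] x]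
        Ghat.inv_closed[OF diagonal_closed[OF g]] N this di]
    have "(diagonal g \<otimes>\<^bsub>Ghat\<^esub> x \<otimes>\<^bsub>Ghat\<^esub> inv\<^bsub>Ghat\<^esub> diagonal g) N = N #> (g \<otimes> h \<otimes> inv g)" .
    then show "completion_map G (\<lambda>x. g \<otimes> x \<otimes> inv g) x N =
        (diagonal g \<otimes>\<^bsub>Ghat\<^esub> x \<otimes>\<^bsub>Ghat\<^esub> inv\<^bsub>Ghat\<^esub> diagonal g) N"
      using completion_map_component[OF th x N, unfolded pre, OF h(1)] by simp
  qed
  then show "completion_map G (\<lambda>x. g \<otimes> x \<otimes> inv g) x = Top.conjugation (diagonal g) x"
    using x by (simp add: Top.conjugation_def)
qed

text \<open>The outer automorphism of a mapping class depends neither on the path that joins the base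
  point to its image nor on the choice of a homeomorphism in the class, because either
  change amounts to a conjugation.\<close>

lemma to_Out_completion_conj:
  assumes \<theta>: "\<theta> \<in> iso G G" and g: "g \<in> carrier G"
  shows "Top.to_Out (completion_map G (\<lambda>a. g \<otimes> \<theta> a \<otimes> inv g)) = Top.to_Out (completion_map G \<theta>)"
proof -
  have "completion_map G (\<lambda>a. g \<otimes> \<theta> a \<otimes> inv g) = Top.conjugation (diagonal g) \<otimes>\<^bsub>Top.AutH\<^esub> completion_map G \<theta>"
    using completion_map_mult[OF conj_iso[OF g] \<theta>] by (simp add: completion_map_conj[OF g])
  then show ?thesis
    using Top.to_Out_conjugation[OF diagonal_closed[OF g] completion_map_Aut[OF \<theta>]] by simp
qed

lemma completion_map_trivial_component:
  assumes \<theta>: "\<theta> \<in> iso G G" and N: "N \<in> kernels"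
    and triv: "\<And>g. g \<in> carrier G \<Longrightarrow> \<theta> g \<in> N #> g" and x: "x \<in> carrier Ghat"
  shows "completion_map G \<theta> x N = x N"
proof -
  note sN = kernels_subgroup[OF N]
  have eq: "N #> \<theta> g = N #> g" if "g \<in> carrier G" for g
    using repr_independence[OF triv[OF that] that sN] by simp
  have "pullback \<theta> N = N"
  proof -
    have "a \<in> N \<longleftrightarrow> \<theta> a \<in> N" if a: "a \<in> carrier G" for a
    proof -
      have "\<theta> a \<in> carrier G" using \<theta> a by (auto simp: iso_def hom_def)
      then show ?thesis using eq[OF a] coset_join1[of N] coset_join2[of _ N] a sN by metis
    qed
    then show ?thesis using kernels_subset[OF N] by (auto simp: pullback_def)
  qed
  moreover obtain g where g: "g \<in> x N" "g \<in> carrier G" "x N = N #> g" using coset_ex[OF x N] by metis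
  ultimately show ?thesis
    using completion_map_component[OF \<theta> x N] eq[OF g(2)] by simp
qed

end

section \<open>Unipotent families of automorphisms\<close>

text \<open>This is what the Dehn twists along two curves that meet once provide: \<open>c1\<close> and \<open>c2\<close> count
  crossings with the two curves, \<open>low k\<close> and \<open>up k\<close> are the automorphisms induced by
  \<open>k\<close>-fold twists. The last two assumptions express that the twists of large divisibility
  are invisible in a given finite quotient.\<close>

locale unipotent_twists = discrete_group G for G :: "'a monoid" (structure) +
  fixes c1 c2 :: "'a \<Rightarrow> int" and low up :: "int \<Rightarrow> 'a \<Rightarrow> 'a"
  assumes c1_mult: "\<lbrakk>g \<in> carrier G; h \<in> carrier G\<rbrakk> \<Longrightarrow> c1 (g \<otimes> h) = c1 g + c1 h"
    and c2_mult: "\<lbrakk>g \<in> carrier G; h \<in> carrier G\<rbrakk> \<Longrightarrow> c2 (g \<otimes> h) = c2 g + c2 h"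
    and c2_unit: "\<exists>g\<in>carrier G. \<bar>c2 g\<bar> = 1"
    and low_iso: "low k \<in> iso G G" and up_iso: "up k \<in> iso G G"
    and low_c1: "g \<in> carrier G \<Longrightarrow> c1 (low k g) = c1 g"
    and low_c2: "g \<in> carrier G \<Longrightarrow> c2 (low k g) = c2 g + k * c1 g"
    and up_c1: "g \<in> carrier G \<Longrightarrow> c1 (up k g) = c1 g + k * c2 g"
    and up_c2: "g \<in> carrier G \<Longrightarrow> c2 (up k g) = c2 g"
    and low_trivial: "\<lbrakk>N \<in> solvable_quotient_kernels G; int (card (rcosets N)) dvd k; g \<in> carrier G\<rbrakk>
                        \<Longrightarrow> low k g \<in> N #> g"
    and up_trivial: "\<lbrakk>N \<in> solvable_quotient_kernels G; int (card (rcosets N)) dvd k; g \<in> carrier G\<rbrakk>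
                        \<Longrightarrow> up k g \<in> N #> g"
begin

definition mod_kernel :: "int \<Rightarrow> 'a set" where
  "mod_kernel p = {g \<in> carrier G. p dvd c1 g \<and> p dvd c2 g}"

lemma c_one: "c1 \<one> = 0" "c2 \<one> = 0"
  using c1_mult[of \<one> \<one>] c2_mult[of \<one> \<one>] by simp_all

lemma c_inv: "g \<in> carrier G \<Longrightarrow> c1 (inv g) = - c1 g" "g \<in> carrier G \<Longrightarrow> c2 (inv g) = - c2 g"
  using c1_mult[of g "inv g"] c2_mult[of g "inv g"] c_one by simp_all

lemma coset_eqI:
  assumes "subgroup N G" "a \<in> carrier G" "b \<in> carrier G" "a \<otimes> inv b \<in> N"
  shows "N #> a = N #> b"
proof -
  have "a = (a \<otimes> inv b) \<otimes> b" using assms by (simp add: m_assoc)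
  then have "a \<in> N #> b" using assms(4) unfolding r_coset_def by blast
  then show ?thesis using repr_independence[of a N b] assms by simp
qed

lemma mod_kernel_normal: "mod_kernel p \<lhd> G"
  unfolding normal_inv_iff
proof (intro conjI ballI)
  show "subgroup (mod_kernel p) G"
  proof (rule subgroupI)
    have "\<one> \<in> mod_kernel p" by (simp add: mod_kernel_def c_one)
    then show "mod_kernel p \<noteq> {}" by blast
  qed (auto simp: mod_kernel_def c1_mult c2_mult c_inv)
qed (auto simp: mod_kernel_def c1_mult c2_mult c_inv)

lemma mod_kernel_coset_eq:
  assumes "a \<in> carrier G" "b \<in> carrier G" "p dvd c1 a - c1 b" "p dvd c2 a - c2 b"
  shows "mod_kernel p #> a = mod_kernel p #> b"
proof (rule coset_eqI[OF normal_imp_subgroup[OF mod_kernel_normal] assms(1,2)])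
  show "a \<otimes> inv b \<in> mod_kernel p"
    using assms by (simp add: mod_kernel_def c1_mult c2_mult c_inv)
qed

lemma mod_kernel_coset:
  assumes "g \<in> carrier G" "h \<in> mod_kernel p #> g"
  shows "[c1 h = c1 g] (mod p)" "[c2 h = c2 g] (mod p)"
  using assms by (auto simp: r_coset_def mod_kernel_def c1_mult c2_mult cong_iff_dvd_diff)

text \<open>The quotient embeds into \<open>(\<int>/p)\<^sup>2\<close> through \<open>c1\<close> and \<open>c2\<close>, so it is finite and abelian.\<close>

lemma mod_kernel_kernel:
  assumes p: "p > 0" shows "mod_kernel p \<in> kernels"
proof -
  let ?N = "mod_kernel p"
  interpret N: normal ?N G by (rule mod_kernel_normal)
  have sN: "subgroup ?N G" by (rule N.subgroup_axioms)
  interpret Q: group "G Mod ?N" by (rule N.factorgroup_is_group)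
  have "comm_group (G Mod ?N)"
  proof (rule Q.group_comm_groupI)
    fix C D assume "C \<in> carrier (G Mod ?N)" "D \<in> carrier (G Mod ?N)"
    then obtain a b where ab: "a \<in> carrier G" "C = ?N #> a" "b \<in> carrier G" "D = ?N #> b"
      by (auto simp: carrier_Mod RCOSETS_def)
    have "?N #> (a \<otimes> b) = ?N #> (b \<otimes> a)"
      by (rule mod_kernel_coset_eq) (use ab in \<open>simp_all add: c1_mult c2_mult\<close>)
    then show "C \<otimes>\<^bsub>G Mod ?N\<^esub> D = D \<otimes>\<^bsub>G Mod ?N\<^esub> C"
      using ab by (simp add: mult_Mod N.rcos_sum)
  qed
  then interpret Q: comm_group "G Mod ?N" .
  have "(derived (G Mod ?N) ^^ 1) (carrier (G Mod ?N)) = {\<one>\<^bsub>G Mod ?N\<^esub>}"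
    using Q.derived_eq_singleton[of "carrier (G Mod ?N)"] by simp
  then have sol: "solvable (G Mod ?N)" using Q.solvable_iff_trivial_derived_seq by blast
  let ?r = "\<lambda>C. SOME g. g \<in> C"
  have r: "?r C \<in> C" if C: "C \<in> rcosets ?N" for C
  proof -
    obtain g where "g \<in> C" using coset_nonempty[OF sN C] by metis
    then show ?thesis by (rule someI)
  qed
  let ?f = "\<lambda>C. (c1 (?r C) mod p, c2 (?r C) mod p)"
  have "inj_on ?f (rcosets ?N)"
  proof (rule inj_onI)
    fix C D assume C: "C \<in> rcosets ?N" and D: "D \<in> rcosets ?N" and e: "?f C = ?f D"
    note rC = coset_eq_member[OF sN C r[OF C]] and rD = coset_eq_member[OF sN D r[OF D]]
    have "c1 (?r C) mod p = c1 (?r D) mod p" "c2 (?r C) mod p = c2 (?r D) mod p" using e by simp_all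
    then have "?N #> ?r C = ?N #> ?r D"
      by (intro mod_kernel_coset_eq rC(1) rD(1)) (simp_all only: mod_eq_dvd_iff)
    then show "C = D" using rC(2) rD(2) by simp
  qed
  moreover have "?f ` (rcosets ?N) \<subseteq> {0..<p} \<times> {0..<p}" using p by auto
  ultimately have "finite (rcosets ?N)" by (rule inj_on_finite) auto
  then show ?thesis using sol mod_kernel_normal by (simp add: solvable_quotient_kernels_def carrier_Mod)
qed

text \<open>Modulo \<open>p\<close> the functions \<open>c1\<close> and \<open>c2\<close> are constant on the cosets of \<open>mod_kernel p\<close>, so they
  are coordinates on the component of the completion at \<open>mod_kernel p\<close>. The relation says
  that \<open>\<phi>\<close> changes these coordinates by the matrix.\<close>

fun acts :: "int \<Rightarrow> (('a set \<Rightarrow> 'a set) \<Rightarrow> ('a set \<Rightarrow> 'a set)) \<Rightarrow> mat2 \<Rightarrow> bool" where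
  "acts p \<phi> (a, b, c, d) \<longleftrightarrow> (\<forall>x\<in>carrier Ghat. \<forall>g\<in>x (mod_kernel p). \<forall>g'\<in>\<phi> x (mod_kernel p).
     [c1 g' = a * c1 g + b * c2 g] (mod p) \<and> [c2 g' = c * c1 g + d * c2 g] (mod p))"

lemma mod_p_action_acts:
  assumes p: "p > 0" shows "mod_p_action Top.AutH p (acts p)"
proof
  note N = mod_kernel_kernel[OF p]
  let ?N = "mod_kernel p"
  show "acts p (\<phi> \<otimes>\<^bsub>Top.AutH\<^esub> \<psi>) (mat2_mult M M')"
    if m: "\<phi> \<in> carrier Top.AutH" "\<psi> \<in> carrier Top.AutH" "acts p \<phi> M" "acts p \<psi> M'" for \<phi> \<psi> M M'
  proof -
    obtain a b c d where M: "M = (a, b, c, d)" by (cases M)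
    obtain a' b' c' d' where M': "M' = (a', b', c', d')" by (cases M')
    show ?thesis
      unfolding M M' mat2_mult.simps acts.simps
    proof (intro ballI)
      fix x g g'' assume x: "x \<in> carrier Ghat" and g: "g \<in> x ?N"
        and g'': "g'' \<in> (\<phi> \<otimes>\<^bsub>Top.AutH\<^esub> \<psi>) x ?N"
      have g''2: "g'' \<in> \<phi> (\<psi> x) ?N" using g'' m x by simp
      have \<psi>x: "\<psi> x \<in> carrier Ghat" using m x by simp
      obtain g' where g': "g' \<in> \<psi> x ?N" using coset_ex[OF \<psi>x N] by metis
      have 1: "[c1 g' = a' * c1 g + b' * c2 g] (mod p)" "[c2 g' = c' * c1 g + d' * c2 g] (mod p)"
        using m(4) x g g' by (auto simp: M')
      have 2: "[c1 g'' = a * c1 g' + b * c2 g'] (mod p)" "[c2 g'' = c * c1 g' + d * c2 g'] (mod p)"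
        using m(3) \<psi>x g' g''2 by (auto simp: M)
      have "[c1 g'' = a * (a' * c1 g + b' * c2 g) + b * (c' * c1 g + d' * c2 g)] (mod p)"
        by (rule cong_trans[OF 2(1)]) (intro cong_add cong_mult cong_refl 1)
      moreover have "[c2 g'' = c * (a' * c1 g + b' * c2 g) + d * (c' * c1 g + d' * c2 g)] (mod p)"
        by (rule cong_trans[OF 2(2)]) (intro cong_add cong_mult cong_refl 1)
      ultimately show "[c1 g'' = (a * a' + b * c') * c1 g + (a * b' + b * d') * c2 g] (mod p) \<and>
           [c2 g'' = (c * a' + d * c') * c1 g + (c * b' + d * d') * c2 g] (mod p)"
        by (simp add: algebra_simps)
    qed
  qed
  show "acts p (inv\<^bsub>Top.AutH\<^esub> \<phi>) (d, - b, - c, a)"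
    if m: "\<phi> \<in> carrier Top.AutH" "acts p \<phi> (a, b, c, d)" "[a * d - b * c = 1] (mod p)" for \<phi> a b c d
    unfolding acts.simps
  proof (intro ballI)
    fix x g g' assume x: "x \<in> carrier Ghat" and g: "g \<in> x ?N" and g': "g' \<in> (inv\<^bsub>Top.AutH\<^esub> \<phi>) x ?N"
    have y: "(inv\<^bsub>Top.AutH\<^esub> \<phi>) x \<in> carrier Ghat" using m x by simp
    have g2: "g \<in> \<phi> ((inv\<^bsub>Top.AutH\<^esub> \<phi>) x) ?N" using g Top.Aut_inv_apply[OF m(1) x] by simp
    have 1: "[c1 g = a * c1 g' + b * c2 g'] (mod p)" "[c2 g = c * c1 g' + d * c2 g'] (mod p)"
      using m(2) y g' g2 by auto
    have "[d * c1 g + - b * c2 g = d * (a * c1 g' + b * c2 g') + - b * (c * c1 g' + d * c2 g')] (mod p)"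
      by (intro cong_add cong_mult cong_refl 1)
    also have "d * (a * c1 g' + b * c2 g') + - b * (c * c1 g' + d * c2 g') = (a * d - b * c) * c1 g'"
      by (simp add: algebra_simps)
    also have "[\<dots> = 1 * c1 g'] (mod p)" by (intro cong_mult cong_refl m(3))
    finally have A: "[c1 g' = d * c1 g + - b * c2 g] (mod p)" by (simp add: cong_sym)
    have "[- c * c1 g + a * c2 g = - c * (a * c1 g' + b * c2 g') + a * (c * c1 g' + d * c2 g')] (mod p)"
      by (intro cong_add cong_mult cong_refl 1)
    also have "- c * (a * c1 g' + b * c2 g') + a * (c * c1 g' + d * c2 g') = (a * d - b * c) * c2 g'"
      by (simp add: algebra_simps)
    also have "[\<dots> = 1 * c2 g'] (mod p)" by (intro cong_mult cong_refl m(3))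
    finally have B: "[c2 g' = - c * c1 g + a * c2 g] (mod p)" by (simp add: cong_sym)
    show "[c1 g' = d * c1 g + - b * c2 g] (mod p) \<and> [c2 g' = - c * c1 g + a * c2 g] (mod p)"
      using A B by simp
  qed
  show "acts p \<phi> M'" if m: "\<phi> \<in> carrier Top.AutH" "acts p \<phi> M" "mat2_cong p M M'" for \<phi> M M'
  proof -
    obtain a b c d where M: "M = (a, b, c, d)" by (cases M)
    obtain a' b' c' d' where M': "M' = (a', b', c', d')" by (cases M')
    have e: "[a * u + b * v = a' * u + b' * v] (mod p)" "[c * u + d * v = c' * u + d' * v] (mod p)" for u v
      using m(3) by (auto simp: M M' intro!: cong_add cong_mult)
    show ?thesis using m(2) e unfolding M M' acts.simps by (blast intro: cong_trans)
  qed
qed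

lemma completion_map_acts:
  assumes p: "p > 0" and \<theta>: "\<theta> \<in> iso G G" and det: "[a * d - b * c = 1] (mod p)"
    and c1: "\<And>g. g \<in> carrier G \<Longrightarrow> c1 (\<theta> g) = a * c1 g + b * c2 g"
    and c2: "\<And>g. g \<in> carrier G \<Longrightarrow> c2 (\<theta> g) = c * c1 g + d * c2 g"
  shows "acts p (completion_map G \<theta>) (a, b, c, d)"
  unfolding acts.simps
proof (intro ballI)
  let ?N = "mod_kernel p"
  note N = mod_kernel_kernel[OF p]
  have th: "\<theta> g \<in> carrier G" if "g \<in> carrier G" for g using \<theta> that by (auto simp: iso_def hom_def)
  have pre: "pullback \<theta> ?N = ?N"
  proof -
    have "p dvd c1 g \<and> p dvd c2 g" if g: "g \<in> carrier G" "p dvd c1 (\<theta> g)" "p dvd c2 (\<theta> g)" for g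
    proof -
      have "d * c1 (\<theta> g) - b * c2 (\<theta> g) = (a * d - b * c) * c1 g"
        using g(1) by (simp add: c1 c2 algebra_simps)
      then have 1: "p dvd (a * d - b * c) * c1 g" using g(2,3) by (metis dvd_diff dvd_mult)
      have "a * c2 (\<theta> g) - c * c1 (\<theta> g) = (a * d - b * c) * c2 g"
        using g(1) by (simp add: c1 c2 algebra_simps)
      then have 2: "p dvd (a * d - b * c) * c2 g" using g(2,3) by (metis dvd_diff dvd_mult)
      have "[(a * d - b * c) * u = 1 * u] (mod p)" for u using det by (intro cong_mult cong_refl)
      then show ?thesis using 1 2 by (metis cong_dvd_iff mult_1)
    qed
    then have "pullback \<theta> ?N \<subseteq> ?N" by (simp add: pullback_def mod_kernel_def subset_iff)
    moreover have "?N \<subseteq> pullback \<theta> ?N" by (simp add: pullback_def mod_kernel_def subset_iff th c1 c2)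
    ultimately show ?thesis by (rule equalityI)
  qed
  fix x g g' assume x: "x \<in> carrier Ghat" and g: "g \<in> x ?N" and g': "g' \<in> completion_map G \<theta> x ?N"
  have gG: "g \<in> carrier G" using coset_mem(1)[OF x N g] .
  have "g' \<in> ?N #> \<theta> g"
    using completion_map_component[OF \<theta> x N, unfolded pre, OF g] g' by simp
  from mod_kernel_coset[OF th[OF gG] this]
  show "[c1 g' = a * c1 g + b * c2 g] (mod p) \<and> [c2 g' = c * c1 g + d * c2 g] (mod p)"
    using c1 c2 gG by simp
qed

text \<open>A basic neighbourhood of the identity restricts the action on finitely many finite quotients
  only. A number that is divisible by the orders of all of them is large enough.\<close>

lemma twists_small:
  assumes "openin (Aut_topology Ghat That) V" "\<one>\<^bsub>Top.AutH\<^esub> \<in> V"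
  shows "\<exists>m>0. \<forall>k. m dvd k \<longrightarrow> completion_map G (up k) \<in> V \<and> completion_map G (low k) \<in> V"
proof (rule Top.Aut_neighbourhood_induct[OF assms, where P = "\<lambda>V. \<exists>m>0. \<forall>k. m dvd k \<longrightarrow>
    completion_map G (up k) \<in> V \<and> completion_map G (low k) \<in> V"])
  fix U assume U: "U \<lhd> Ghat" "openin That U"
  interpret U: normal U Ghat by (rule U(1))
  obtain J where J: "finite J" "J \<subseteq> kernels" "\<And>x. x \<in> carrier Ghat \<Longrightarrow> (\<forall>N\<in>J. x N = N) \<Longrightarrow> x \<in> U"
    using open_contains_component_kernel[OF U(2) U.one_closed] by auto
  define m where "m = (\<Prod>N\<in>J. int (card (rcosets N)))"
  have "card (rcosets N) > 0" if "N \<in> J" for N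
  proof -
    have N: "N \<in> kernels" using that J by blast
    have "finite (rcosets N)" using N by (simp add: solvable_quotient_kernels_def carrier_Mod)
    moreover have "N #> \<one> \<in> rcosets N" by (intro rcosetsI kernels_subset N one_closed)
    ultimately show ?thesis using card_gt_0_iff by blast
  qed
  then have m: "m > 0" unfolding m_def by (intro prod_pos) auto
  have nb: "completion_map G \<theta> \<in> Top.Aut_nbhd \<one>\<^bsub>Top.AutH\<^esub> U"
    if \<theta>: "\<theta> \<in> iso G G" and triv: "\<And>N g. N \<in> J \<Longrightarrow> g \<in> carrier G \<Longrightarrow> \<theta> g \<in> N #> g" for \<theta>
    unfolding Top.Aut_nbhd_def
  proof (intro CollectI conjI ballI)
    show "completion_map G \<theta> \<in> carrier Top.AutH" by (rule completion_map_Aut[OF \<theta>])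
    fix x assume x: "x \<in> carrier Ghat"
    let ?y = "completion_map G \<theta> x"
    have y: "?y \<in> carrier Ghat" by (rule completion_map_closed[OF \<theta> x])
    have "(inv\<^bsub>Ghat\<^esub> x \<otimes>\<^bsub>Ghat\<^esub> ?y) N = N" if N: "N \<in> J" for N
    proof -
      have N': "N \<in> kernels" using N J by blast
      have "(inv\<^bsub>Ghat\<^esub> x \<otimes>\<^bsub>Ghat\<^esub> ?y) N = (inv\<^bsub>Ghat\<^esub> x \<otimes>\<^bsub>Ghat\<^esub> x) N"
        using completion_map_trivial_component[OF \<theta> N' triv[OF N] x] N' by (simp add: mult_Ghat)
      then show ?thesis using x N' by (simp add: one_Ghat)
    qed
    then have "inv\<^bsub>Ghat\<^esub> x \<otimes>\<^bsub>Ghat\<^esub> ?y \<in> U" using J(3) x y by simp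
    moreover have "?y = x \<otimes>\<^bsub>Ghat\<^esub> (inv\<^bsub>Ghat\<^esub> x \<otimes>\<^bsub>Ghat\<^esub> ?y)"
      using x y by (simp add: Top.cancel_inv)
    ultimately show "?y \<in> \<one>\<^bsub>Top.AutH\<^esub> x <#\<^bsub>Ghat\<^esub> U"
      using x unfolding Top.Aut_one l_coset_def by auto
  qed
  have dv: "int (card (rcosets N)) dvd k" if "N \<in> J" "m dvd k" for N k
    using dvd_prodI[OF J(1) that(1), of "\<lambda>N. int (card (rcosets N))"] that(2) unfolding m_def by (rule dvd_trans)
  show "\<exists>m>0. \<forall>k. m dvd k \<longrightarrow> completion_map G (up k) \<in> Top.Aut_nbhd \<one>\<^bsub>Top.AutH\<^esub> U \<and>
      completion_map G (low k) \<in> Top.Aut_nbhd \<one>\<^bsub>Top.AutH\<^esub> U"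
    using m J(2) dv by (intro exI[of _ m]) (auto intro!: nb up_iso low_iso up_trivial low_trivial)
next
  fix A B
  assume "\<exists>m>0. \<forall>k. m dvd k \<longrightarrow> completion_map G (up k) \<in> A \<and> completion_map G (low k) \<in> A"
    "\<exists>m>0. \<forall>k. m dvd k \<longrightarrow> completion_map G (up k) \<in> B \<and> completion_map G (low k) \<in> B"
  then obtain m n :: int where mn: "m > 0" "n > 0"
    and A: "\<And>k. m dvd k \<Longrightarrow> completion_map G (up k) \<in> A \<and> completion_map G (low k) \<in> A"
    and B: "\<And>k. n dvd k \<Longrightarrow> completion_map G (up k) \<in> B \<and> completion_map G (low k) \<in> B" by blast
  have "m dvd k" "n dvd k" if "m * n dvd k" for k using that by (auto dest: dvd_mult_left dvd_mult_right)
  then show "\<exists>m>0. \<forall>k. m dvd k \<longrightarrow> completion_map G (up k) \<in> A \<inter> B \<and> completion_map G (low k) \<in> A \<inter> B"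
    using mn A B by (intro exI[of _ "m * n"]) simp
next
  fix A B
  assume "\<exists>m>0. \<forall>k. m dvd k \<longrightarrow> completion_map G (up k) \<in> A \<and> completion_map G (low k) \<in> A" "A \<subseteq> B"
  then show "\<exists>m>0. \<forall>k. m dvd k \<longrightarrow> completion_map G (up k) \<in> B \<and> completion_map G (low k) \<in> B"
    by blast
qed

definition trivial_mod :: "int \<Rightarrow> (('a set \<Rightarrow> 'a set) \<Rightarrow> ('a set \<Rightarrow> 'a set)) set" where
  "trivial_mod p = {\<phi> \<in> carrier Top.AutH. \<forall>x\<in>carrier Ghat. \<phi> x (mod_kernel p) = x (mod_kernel p)}"

lemma trivial_mod_open:
  assumes p: "p > 0" shows "openin (Aut_topology Ghat That) (trivial_mod p)"
proof (subst openin_subopen, intro ballI)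
  note N = mod_kernel_kernel[OF p]
  interpret N: normal "mod_kernel p" G by (rule mod_kernel_normal)
  let ?U = "{x \<in> carrier Ghat. x (mod_kernel p) = mod_kernel p}"
  have oU: "openin That ?U" using open_component[OF N, of "{mod_kernel p}"] by simp
  have hom: "group_hom Ghat (G Mod mod_kernel p) (\<lambda>x. x (mod_kernel p))"
    using projection_hom[OF N] N.factorgroup_is_group group_Ghat
    by (simp add: group_hom_def group_hom_axioms_def)
  have nU: "?U \<lhd> Ghat"
    using group_hom.normal_kernel[OF hom] by (simp add: kernel_def one_Mod)
  fix \<phi> assume \<phi>: "\<phi> \<in> trivial_mod p"
  have \<phi>A: "\<phi> \<in> carrier Top.AutH" using \<phi> by (simp add: trivial_mod_def)
  have "Top.Aut_nbhd \<phi> ?U \<subseteq> trivial_mod p"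
  proof
    fix \<psi> assume \<psi>: "\<psi> \<in> Top.Aut_nbhd \<phi> ?U"
    then have \<psi>A: "\<psi> \<in> carrier Top.AutH" by (simp add: Top.Aut_nbhd_def)
    have "\<psi> x (mod_kernel p) = x (mod_kernel p)" if x: "x \<in> carrier Ghat" for x
    proof -
      obtain v where v: "v \<in> ?U" "\<psi> x = \<phi> x \<otimes>\<^bsub>Ghat\<^esub> v"
        using \<psi> x by (auto simp: Top.Aut_nbhd_def l_coset_def)
      have "\<phi> x \<in> carrier Ghat" using \<phi>A x by simp
      then have "\<psi> x (mod_kernel p) = \<phi> x (mod_kernel p) \<otimes>\<^bsub>G Mod mod_kernel p\<^esub> v (mod_kernel p)"
        using v group_hom.hom_mult[OF hom, of "\<phi> x" v] by simp
      also have "\<dots> = \<phi> x (mod_kernel p)"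
        using v(1) \<open>\<phi> x \<in> carrier Ghat\<close> monoid.r_one[OF group.is_monoid[OF N.factorgroup_is_group]]
          group_hom.hom_closed[OF hom] by (simp add: one_Mod)
      finally show ?thesis using \<phi> x by (simp add: trivial_mod_def)
    qed
    then show "\<psi> \<in> trivial_mod p" using \<psi>A by (simp add: trivial_mod_def)
  qed
  then show "\<exists>S. openin (Aut_topology Ghat That) S \<and> \<phi> \<in> S \<and> S \<subseteq> trivial_mod p"
    using Top.open_Aut_nbhd[OF \<phi>A nU oU] Top.Aut_nbhd_self[OF \<phi>A nU] by blast
qed

text \<open>Inner automorphisms act trivially on an abelian quotient. Hence \<open>trivial_mod p\<close> is a union
  of fibres of the projection to \<open>Out\<close>, so that its image there is open and still detects
  the action modulo \<open>p\<close>.\<close>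

lemma trivial_mod_conjugation:
  assumes p: "p > 0" and a: "a \<in> carrier Ghat" and \<phi>: "\<phi> \<in> trivial_mod p"
  shows "Top.conjugation a \<otimes>\<^bsub>Top.AutH\<^esub> \<phi> \<in> trivial_mod p"
proof -
  note N = mod_kernel_kernel[OF p]
  note sN = kernels_subgroup[OF N]
  have \<phi>A: "\<phi> \<in> carrier Top.AutH" using \<phi> by (simp add: trivial_mod_def)
  have "(Top.conjugation a \<otimes>\<^bsub>Top.AutH\<^esub> \<phi>) x (mod_kernel p) = x (mod_kernel p)" if x: "x \<in> carrier Ghat" for x
  proof -
    have y: "\<phi> x \<in> carrier Ghat" using \<phi>A x by simp
    obtain h where h: "h \<in> \<phi> x (mod_kernel p)" "h \<in> carrier G" "\<phi> x (mod_kernel p) = mod_kernel p #> h"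
      using coset_ex[OF y N] by metis
    obtain g where g: "g \<in> a (mod_kernel p)" "g \<in> carrier G" using coset_ex[OF a N] by metis
    have ah: "g \<otimes> h \<in> (a \<otimes>\<^bsub>Ghat\<^esub> \<phi> x) (mod_kernel p)"
      using mult_component[OF a y N g(1) h(1)] rcos_self[OF _ sN] g h by simp
    have ai: "inv g \<in> (inv\<^bsub>Ghat\<^esub> a) (mod_kernel p)"
      using inv_component[OF a N g(1)] rcos_self[OF _ sN] g by simp
    have "(a \<otimes>\<^bsub>Ghat\<^esub> \<phi> x \<otimes>\<^bsub>Ghat\<^esub> inv\<^bsub>Ghat\<^esub> a) (mod_kernel p) = mod_kernel p #> (g \<otimes> h \<otimes> inv g)"
      by (rule mult_component[OF Ghat.m_closed[OF a y] Ghat.inv_closed[OF a] N ah ai])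
    also have "\<dots> = mod_kernel p #> h"
      by (rule mod_kernel_coset_eq) (use g h in \<open>simp_all add: c1_mult c2_mult c_inv\<close>)
    finally have "(a \<otimes>\<^bsub>Ghat\<^esub> \<phi> x \<otimes>\<^bsub>Ghat\<^esub> inv\<^bsub>Ghat\<^esub> a) (mod_kernel p) = \<phi> x (mod_kernel p)" using h(3) by simp
    then show ?thesis
      using \<phi> x y a Top.conjugation_Aut[OF a] \<phi>A by (simp add: Top.conjugation_def trivial_mod_def)
  qed
  then show ?thesis using Top.conjugation_Aut[OF a] \<phi>A by (simp add: trivial_mod_def)
qed

lemma one_trivial_mod: "\<one>\<^bsub>Top.AutH\<^esub> \<in> trivial_mod p"
  using Top.Aut.one_closed by (simp add: trivial_mod_def Top.Aut_one)

lemma trivial_mod_not_acts: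
  assumes p: "p > 1" and \<phi>: "\<phi> \<in> trivial_mod p"
  shows "\<not> acts p \<phi> (1, 1, 0, 1)"
proof
  assume ac: "acts p \<phi> (1, 1, 0, 1)"
  have N: "mod_kernel p \<in> kernels" using mod_kernel_kernel p by simp
  obtain g where g: "g \<in> carrier G" "\<bar>c2 g\<bar> = 1" using c2_unit by blast
  have x: "diagonal g \<in> carrier Ghat" by (rule diagonal_closed[OF g(1)])
  have gx: "g \<in> diagonal g (mod_kernel p)" using rcos_self[OF g(1) kernels_subgroup[OF N]] N by (simp add: diagonal_def)
  then have "g \<in> \<phi> (diagonal g) (mod_kernel p)" using \<phi> x by (simp add: trivial_mod_def)
  then have "[c1 g = 1 * c1 g + 1 * c2 g] (mod p)" using ac x gx unfolding acts.simps by blast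
  then have "p dvd \<bar>c2 g\<bar>" by (simp add: cong_iff_dvd_diff)
  then show False using g(2) p by simp
qed

lemma low_acts: "p > 0 \<Longrightarrow> acts p (completion_map G (low k)) (1, 0, k, 1)"
  by (rule completion_map_acts) (auto simp: low_iso low_c1 low_c2)

lemma up_acts: "p > 0 \<Longrightarrow> acts p (completion_map G (up k)) (1, k, 0, 1)"
  by (rule completion_map_acts) (auto simp: up_iso up_c1 up_c2)

theorem not_virtually_prosolvable_Aut:
  "\<not> virtually_prosolvable Top.AutH (Aut_topology Ghat That)"
proof -
  have "\<not> virtually_prosolvable (Top.AutH\<lparr>carrier := carrier Top.AutH\<rparr>)
      (subtopology (Aut_topology Ghat That) (carrier Top.AutH))"
  proof (rule not_virtually_prosolvable_of_unipotents[where \<pi> = "\<lambda>\<phi>. \<phi>" and A = Top.AutH and W = trivial_mod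
        and \<rho> = acts and up = "\<lambda>k. completion_map G (up k)" and low = "\<lambda>k. completion_map G (low k)"])
    show "(\<lambda>\<phi>. \<phi>) \<in> hom Top.AutH Top.AutH" by (auto simp: hom_def)
    show "openin (Aut_topology Ghat That) (trivial_mod p) \<and> \<one>\<^bsub>Top.AutH\<^esub> \<in> trivial_mod p" if "5 \<le> p" for p
      using trivial_mod_open one_trivial_mod that by auto
    show "mod_p_action Top.AutH p (acts p)" if "5 \<le> p" for p using mod_p_action_acts that by auto
    show "\<not> acts p x (1, 1, 0, 1)" if "5 \<le> p" "x \<in> trivial_mod p" for p x
      using trivial_mod_not_acts that by auto
  qed (use Top.group_Aut Top.topspace_Aut twists_small up_acts low_acts
       in \<open>auto intro: completion_map_Aut up_iso low_iso\<close>)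
  moreover have "subtopology (Aut_topology Ghat That) (carrier Top.AutH) = Aut_topology Ghat That"
    using Top.topspace_Aut subtopology_topspace by metis
  ultimately show ?thesis by simp
qed

text \<open>The set \<open>C\<close> is the congruence mapping class group in one application and all of \<open>Out\<close> in the
  other.\<close>

theorem not_virtually_prosolvable_Out:
  assumes C: "C \<subseteq> carrier (Out_group Ghat That)"
    and mem: "\<And>k. Top.to_Out (completion_map G (up k)) \<in> C" "\<And>k. Top.to_Out (completion_map G (low k)) \<in> C"
  shows "\<not> virtually_prosolvable ((Out_group Ghat That)\<lparr>carrier := C\<rparr>) (subtopology (Out_topology Ghat That) C)"
proof (rule not_virtually_prosolvable_of_unipotents[where \<pi> = "\<lambda>\<phi>. Top.to_Out \<phi>" and A = Top.AutH
      and W = "\<lambda>p. (\<lambda>\<phi>. Top.to_Out \<phi>) ` trivial_mod p"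
      and \<rho> = acts and up = "\<lambda>k. completion_map G (up k)" and low = "\<lambda>k. completion_map G (low k)"])
  have one: "\<one>\<^bsub>Out_group Ghat That\<^esub> = Top.to_Out \<one>\<^bsub>Top.AutH\<^esub>"
    using hom_one[OF Top.to_Out_hom Top.group_Aut Top.group_Out] by simp
  have sat: "\<phi> \<in> trivial_mod p" if "5 \<le> p" and \<phi>: "\<phi> \<in> carrier Top.AutH"
    and im: "Top.to_Out \<phi> \<in> (\<lambda>\<phi>. Top.to_Out \<phi>) ` trivial_mod p" for p \<phi>
  proof -
    obtain \<psi> where \<psi>: "\<psi> \<in> trivial_mod p" "Top.to_Out \<phi> = Top.to_Out \<psi>" using im by blast
    then have "\<psi> \<in> carrier Top.AutH" by (simp add: trivial_mod_def)
    then obtain a where "a \<in> carrier Ghat" "\<phi> = Top.conjugation a \<otimes>\<^bsub>Top.AutH\<^esub> \<psi>"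
      using Top.to_Out_eqD[OF \<phi> _ \<psi>(2)] by metis
    then show ?thesis using trivial_mod_conjugation \<psi>(1) \<open>5 \<le> p\<close> by simp
  qed
  show "openin (Out_topology Ghat That) ((\<lambda>\<phi>. Top.to_Out \<phi>) ` trivial_mod p) \<and>
      \<one>\<^bsub>Out_group Ghat That\<^esub> \<in> (\<lambda>\<phi>. Top.to_Out \<phi>) ` trivial_mod p" if p: "5 \<le> p" for p
  proof -
    have tA: "trivial_mod p \<subseteq> carrier Top.AutH" by (auto simp: trivial_mod_def)
    have "{\<phi> \<in> carrier Top.AutH. Top.to_Out \<phi> \<in> (\<lambda>\<phi>. Top.to_Out \<phi>) ` trivial_mod p} = trivial_mod p"
      using sat[OF p] tA by blast
    moreover have "(\<lambda>\<phi>. Top.to_Out \<phi>) ` trivial_mod p \<subseteq> carrier (Out_group Ghat That)"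
      using hom_carrier[OF Top.to_Out_hom] tA by blast
    ultimately show ?thesis
      unfolding Top.openin_Out one using trivial_mod_open[of p] one_trivial_mod p by auto
  qed
  show "mod_p_action Top.AutH p (acts p)" if "5 \<le> p" for p using mod_p_action_acts that by auto
  show "\<not> acts p x (1, 1, 0, 1)" if "5 \<le> p" "x \<in> carrier Top.AutH" "Top.to_Out x \<in> (\<lambda>\<phi>. Top.to_Out \<phi>) ` trivial_mod p" for p x
    using trivial_mod_not_acts sat that by auto
  show "\<exists>m>0. \<forall>k. m dvd k \<longrightarrow> Top.to_Out (completion_map G (up k)) \<in> V \<and> Top.to_Out (completion_map G (low k)) \<in> V"
    if V: "openin (Out_topology Ghat That) V" "\<one>\<^bsub>Out_group Ghat That\<^esub> \<in> V" for V
  proof -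
    have "openin (Aut_topology Ghat That) {\<phi> \<in> carrier Top.AutH. Top.to_Out \<phi> \<in> V}"
      using V(1) by (simp add: Top.openin_Out)
    from twists_small[OF this] show ?thesis using V(2) by (auto simp: one)
  qed
qed (use Top.group_Aut Top.group_Out Top.to_Out_hom Top.topspace_Out C mem up_acts low_acts
       in \<open>auto intro: completion_map_Aut up_iso low_iso\<close>)

end

section \<open>Paths up to homotopy\<close>

lemma homotopic_paths_image_convex:
  fixes C :: "'c::real_normed_vector set" and h :: "'c \<Rightarrow> 'a::topological_space"
  assumes C: "convex C" and h: "continuous_on C h" "h \<in> C \<rightarrow> S"
    and p: "path p" "path_image p \<subseteq> C" and q: "path q" "path_image q \<subseteq> C"
    and ends: "pathstart q = pathstart p" "pathfinish q = pathfinish p"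
  shows "homotopic_paths S (h \<circ> p) (h \<circ> q)"
proof -
  have "homotopic_paths C p q"
  proof (rule homotopic_paths_linear)
    fix t :: real assume "t \<in> {0..1}"
    then have "p t \<in> C" "q t \<in> C" using p(2) q(2) by (auto simp: path_image_def)
    then show "closed_segment (p t) (q t) \<subseteq> C" using C by (simp add: closed_segment_subset)
  qed (use p q ends in auto)
  then show ?thesis by (rule homotopic_paths_continuous_image[OF _ h])
qed

text \<open>The parameter interval is convex. The unit and inverse laws for the composition of paths are
  instances, as both sides are reparametrizations of the same path; their constant paths
  keep the base point in the form in which it occurs in the fundamental group.\<close>

lemma homotopic_paths_reparametrized:
  fixes p :: "real \<Rightarrow> 'a::topological_space"
  assumes p: "path p" "path_image p \<subseteq> S"
    and r: "path r" "path_image r \<subseteq> {0..1}" and s: "path s" "path_image s \<subseteq> {0..1}"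
    and ends: "pathstart s = pathstart r" "pathfinish s = pathfinish r"
  shows "homotopic_paths S (p \<circ> r) (p \<circ> s)"
  by (rule homotopic_paths_image_convex[of "{0..1}"]) (use assms in \<open>auto simp: path_def path_image_def\<close>)

lemma homotopic_paths_rid_const:
  fixes p :: "real \<Rightarrow> 'a::topological_space"
  assumes p: "path p" "path_image p \<subseteq> S"
  shows "homotopic_paths S (p +++ (\<lambda>_. pathfinish p)) p"
proof -
  have "homotopic_paths S (p \<circ> (linepath 0 1 +++ linepath 1 1)) (p \<circ> linepath 0 1)"
    by (rule homotopic_paths_reparametrized[OF p])
       (auto simp: path_image_join closed_segment_eq_real_ivl)
  moreover have "p \<circ> (linepath 0 1 +++ linepath 1 1) = p +++ (\<lambda>_. pathfinish p)"
    by (auto simp: fun_eq_iff joinpaths_def linepath_def pathfinish_def)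
  moreover have "p \<circ> linepath 0 1 = p" by (auto simp: fun_eq_iff linepath_def)
  ultimately show ?thesis by simp
qed

lemma homotopic_paths_lid_const:
  fixes p :: "real \<Rightarrow> 'a::topological_space"
  assumes p: "path p" "path_image p \<subseteq> S"
  shows "homotopic_paths S ((\<lambda>_. pathstart p) +++ p) p"
proof -
  have "homotopic_paths S (p \<circ> (linepath 0 0 +++ linepath 0 1)) (p \<circ> linepath 0 1)"
    by (rule homotopic_paths_reparametrized[OF p])
       (auto simp: path_image_join closed_segment_eq_real_ivl)
  moreover have "p \<circ> (linepath 0 0 +++ linepath 0 1) = (\<lambda>_. pathstart p) +++ p"
    by (auto simp: fun_eq_iff joinpaths_def linepath_def pathstart_def)
  moreover have "p \<circ> linepath 0 1 = p" by (auto simp: fun_eq_iff linepath_def)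
  ultimately show ?thesis by simp
qed

lemma homotopic_paths_rinv_const:
  fixes p :: "real \<Rightarrow> 'a::topological_space"
  assumes p: "path p" "path_image p \<subseteq> S"
  shows "homotopic_paths S (p +++ reversepath p) (\<lambda>_. pathstart p)"
proof -
  have "homotopic_paths S (p \<circ> (linepath 0 1 +++ linepath 1 0)) (p \<circ> linepath 0 0)"
    by (rule homotopic_paths_reparametrized[OF p])
       (auto simp: path_image_join closed_segment_eq_real_ivl)
  moreover have "p \<circ> (linepath 0 1 +++ linepath 1 0) = p +++ reversepath p"
    by (auto simp: fun_eq_iff joinpaths_def linepath_def reversepath_def)
  moreover have "p \<circ> linepath 0 0 = (\<lambda>_. pathstart p)" by (auto simp: fun_eq_iff linepath_def pathstart_def)
  ultimately show ?thesis by simp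
qed

lemma homotopic_paths_linv_const:
  fixes p :: "real \<Rightarrow> 'a::topological_space"
  assumes p: "path p" "path_image p \<subseteq> S"
  shows "homotopic_paths S (reversepath p +++ p) (\<lambda>_. pathfinish p)"
  using homotopic_paths_rinv_const[of "reversepath p" S] p by simp

definition path_in :: "'a::topological_space set \<Rightarrow> (real \<Rightarrow> 'a) \<Rightarrow> 'a \<Rightarrow> 'a \<Rightarrow> bool" where
  "path_in S p u v \<longleftrightarrow> path p \<and> path_image p \<subseteq> S \<and> pathstart p = u \<and> pathfinish p = v"

lemma path_in_join: "path_in S p u v \<Longrightarrow> path_in S q v w \<Longrightarrow> path_in S (p +++ q) u w"
  by (auto simp: path_in_def path_join_imp path_image_join)

lemma path_in_reverse: "path_in S p u v \<Longrightarrow> path_in S (reversepath p) v u"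
  by (auto simp: path_in_def)

lemma path_in_const: "u \<in> S \<Longrightarrow> path_in S (\<lambda>_. u) u u"
  by (auto simp: path_in_def path_def path_image_def pathstart_def pathfinish_def)

lemma path_in_compose:
  assumes "path_in S p u v" "continuous_on S f" "f \<in> S \<rightarrow> S'"
  shows "path_in S' (f \<circ> p) (f u) (f v)"
proof -
  have "path (f \<circ> p)" using assms by (auto simp: path_in_def intro: path_continuous_image continuous_on_subset)
  moreover have "path_image (f \<circ> p) \<subseteq> S'" using assms by (auto simp: path_in_def path_image_def)
  ultimately show ?thesis using assms by (auto simp: path_in_def pathstart_compose pathfinish_compose)
qed

lemma path_in_subset: "path_in S p u v \<Longrightarrow> S \<subseteq> S' \<Longrightarrow> path_in S' p u v"
  by (auto simp: path_in_def)

lemma path_in_mem: "path_in S p u v \<Longrightarrow> u \<in> S \<and> v \<in> S"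
  by (auto simp: path_in_def intro: pathstart_in_path_image pathfinish_in_path_image)

lemma homotopic_assoc:
  assumes "path_in S p u v" "path_in S q v w" "path_in S r w z"
  shows "homotopic_paths S (p +++ (q +++ r)) ((p +++ q) +++ r)"
  using assms by (intro homotopic_paths_assoc) (auto simp: path_in_def)

lemma homotopic_join_left:
  assumes "homotopic_paths S p p'" "path_in S p u v" "path_in S q v w"
  shows "homotopic_paths S (p +++ q) (p' +++ q)"
  using assms by (intro homotopic_paths_join) (auto simp: path_in_def)

lemma homotopic_join_right:
  assumes "homotopic_paths S q q'" "path_in S p u v" "path_in S q v w"
  shows "homotopic_paths S (p +++ q) (p +++ q')"
  using assms by (intro homotopic_paths_join) (auto simp: path_in_def)

lemma homotopic_cancel_left:
  assumes p: "path_in S p v u" and q: "path_in S q u w"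
  shows "homotopic_paths S (reversepath p +++ (p +++ q)) q"
proof -
  note r = path_in_reverse[OF p]
  have "homotopic_paths S (reversepath p +++ (p +++ q)) ((reversepath p +++ p) +++ q)"
    by (rule homotopic_assoc[OF r p q])
  also have "homotopic_paths S \<dots> ((\<lambda>_. u) +++ q)"
    by (rule homotopic_join_left[OF _ path_in_join[OF r p] q])
       (use homotopic_paths_linv_const[of p S] p in \<open>auto simp: path_in_def\<close>)
  also have "homotopic_paths S \<dots> q"
    using homotopic_paths_lid_const[of q S] q by (auto simp: path_in_def)
  finally show ?thesis .
qed

text \<open>The two ways around a square are homotopic in it. This is how a homotopy is used below: it
  compares the paths of two maps through the tracks of the end points.\<close>

lemma homotopic_paths_square:
  fixes h :: "real \<times> real \<Rightarrow> 'a::topological_space"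
  assumes h: "continuous_on ({0..1} \<times> {0..1}) h" "h \<in> {0..1} \<times> {0..1} \<rightarrow> S"
  shows "homotopic_paths S ((\<lambda>t. h (0, t)) +++ (\<lambda>s. h (s, 1))) ((\<lambda>s. h (s, 0)) +++ (\<lambda>t. h (1, t)))"
proof -
  let ?C = "{0..1::real} \<times> {0..1::real}"
  have edges: "path_in ?C (\<lambda>t. (0, t)) (0, 0) (0, 1)" "path_in ?C (\<lambda>s. (s, 1)) (0, 1) (1, 1)"
    "path_in ?C (\<lambda>s. (s, 0)) (0, 0) (1, 0)" "path_in ?C (\<lambda>t. (1, t)) (1, 0) (1, 1)"
    by (auto simp: path_in_def path_def path_image_def pathstart_def pathfinish_def intro!: continuous_intros)
  have "homotopic_paths S (h \<circ> ((\<lambda>t. (0, t)) +++ (\<lambda>s. (s, 1)))) (h \<circ> ((\<lambda>s. (s, 0)) +++ (\<lambda>t. (1, t))))"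
    by (rule homotopic_paths_image_convex[OF _ h])
       (use path_in_join[OF edges(1,2)] path_in_join[OF edges(3,4)]
        in \<open>auto intro!: convex_Times simp: path_in_def\<close>)
  from this[unfolded path_compose_join] show ?thesis unfolding o_def .
qed

lemma path_class_eqI: "homotopic_paths S p q \<Longrightarrow> path_class S p = path_class S q"
  by (auto simp: path_class_def intro: homotopic_paths_trans homotopic_paths_sym)

lemma path_class_self: "path_in S p u v \<Longrightarrow> p \<in> path_class S p"
  by (simp add: path_class_def path_in_def)

section \<open>The fundamental group\<close>

lemma carrier_fundamental_group:
  "carrier (fundamental_group S x) = {path_class S p | p. path_in S p x x}"
  by (simp add: fundamental_group_def path_in_def)

lemma path_class_closed: "path_in S p x x \<Longrightarrow> path_class S p \<in> carrier (fundamental_group S x)"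
  by (auto simp: carrier_fundamental_group)

lemma mult_path_class:
  assumes "path_in S p x x" "path_in S q x x"
  shows "path_class S p \<otimes>\<^bsub>fundamental_group S x\<^esub> path_class S q = path_class S (p +++ q)"
proof -
  have "path_class S (p' +++ q') = path_class S (p +++ q)" if "p' \<in> path_class S p" "q' \<in> path_class S q" for p' q'
  proof -
    have h: "homotopic_paths S p p'" "homotopic_paths S q q'" using that by (auto simp: path_class_def)
    have "homotopic_paths S (p +++ q) (p' +++ q')"
      by (rule homotopic_paths_join[OF h]) (use assms in \<open>auto simp: path_in_def\<close>)
    then show ?thesis using path_class_eqI by metis
  qed
  then have "(\<Union>p'\<in>path_class S p. \<Union>q'\<in>path_class S q. path_class S (p' +++ q')) =
      (\<Union>p'\<in>path_class S p. \<Union>q'\<in>path_class S q. path_class S (p +++ q))"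
    by (intro SUP_cong refl)
  moreover have "p \<in> path_class S p" "q \<in> path_class S q" using assms path_class_self by blast+
  ultimately show ?thesis by (auto simp: fundamental_group_def)
qed

lemma one_fundamental_group: "\<one>\<^bsub>fundamental_group S x\<^esub> = path_class S (\<lambda>_. x)"
  by (simp add: fundamental_group_def)

lemma group_fundamental_group:
  assumes x: "x \<in> S" shows "group (fundamental_group S x)"
proof (rule groupI)
  note c = path_in_const[OF x]
  show "\<one>\<^bsub>fundamental_group S x\<^esub> \<in> carrier (fundamental_group S x)"
    unfolding one_fundamental_group by (rule path_class_closed[OF c])
  fix A assume "A \<in> carrier (fundamental_group S x)"
  then obtain p where p: "path_in S p x x" "A = path_class S p" by (auto simp: carrier_fundamental_group)
  have l: "homotopic_paths S ((\<lambda>_. x) +++ p) p"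
    using homotopic_paths_lid_const[of p S] p(1) by (auto simp: path_in_def)
  show "\<one>\<^bsub>fundamental_group S x\<^esub> \<otimes>\<^bsub>fundamental_group S x\<^esub> A = A"
    using mult_path_class[OF c p(1)] path_class_eqI[OF l] by (simp add: p(2) one_fundamental_group)
  have i: "homotopic_paths S (reversepath p +++ p) (\<lambda>_. x)"
    using homotopic_paths_linv_const[of p S] p(1) by (auto simp: path_in_def)
  have "path_class S (reversepath p) \<otimes>\<^bsub>fundamental_group S x\<^esub> A = \<one>\<^bsub>fundamental_group S x\<^esub>"
    using mult_path_class[OF path_in_reverse[OF p(1)] p(1)] path_class_eqI[OF i]
    by (simp add: p(2) one_fundamental_group)
  then show "\<exists>B\<in>carrier (fundamental_group S x). B \<otimes>\<^bsub>fundamental_group S x\<^esub> A = \<one>\<^bsub>fundamental_group S x\<^esub>"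
    using path_class_closed[OF path_in_reverse[OF p(1)]] by blast
  fix B assume "B \<in> carrier (fundamental_group S x)"
  then obtain q where q: "path_in S q x x" "B = path_class S q" by (auto simp: carrier_fundamental_group)
  show "A \<otimes>\<^bsub>fundamental_group S x\<^esub> B \<in> carrier (fundamental_group S x)"
    using path_class_closed[OF path_in_join[OF p(1) q(1)]] mult_path_class[OF p(1) q(1)] p(2) q(2) by simp
  fix C assume "C \<in> carrier (fundamental_group S x)"
  then obtain r where r: "path_in S r x x" "C = path_class S r" by (auto simp: carrier_fundamental_group)
  have "path_class S ((p +++ q) +++ r) = path_class S (p +++ (q +++ r))"
    by (rule path_class_eqI[OF homotopic_assoc[OF p(1) q(1) r(1)], symmetric])
  then show "A \<otimes>\<^bsub>fundamental_group S x\<^esub> B \<otimes>\<^bsub>fundamental_group S x\<^esub> C =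
      A \<otimes>\<^bsub>fundamental_group S x\<^esub> (B \<otimes>\<^bsub>fundamental_group S x\<^esub> C)"
    using mult_path_class p q r path_in_join[OF p(1) q(1)] path_in_join[OF q(1) r(1)] by metis
qed

lemma pi1_map_path_class:
  assumes f: "continuous_on S f" "f \<in> S \<rightarrow> S" and c: "path_in S c x (f x)" and p: "path_in S p x x"
  shows "pi1_map S c f (path_class S p) = path_class S (c +++ (f \<circ> p) +++ reversepath c)"
proof -
  note fp = path_in_compose[OF p f]
  have "path_class S (c +++ (f \<circ> p') +++ reversepath c) = path_class S (c +++ (f \<circ> p) +++ reversepath c)"
    if "p' \<in> path_class S p" for p'
  proof -
    have h: "homotopic_paths S (f \<circ> p) (f \<circ> p')"
      using that by (auto simp: path_class_def intro: homotopic_paths_continuous_image[OF _ f])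
    have "homotopic_paths S (c +++ (f \<circ> p) +++ reversepath c) (c +++ (f \<circ> p') +++ reversepath c)"
      by (rule homotopic_join_right[OF homotopic_join_left[OF h fp path_in_reverse[OF c]] c
            path_in_join[OF fp path_in_reverse[OF c]]])
    then show ?thesis by (rule path_class_eqI[symmetric])
  qed
  then have "pi1_map S c f (path_class S p) =
      (\<Union>p'\<in>path_class S p. path_class S (c +++ (f \<circ> p) +++ reversepath c))"
    unfolding pi1_map_def by (intro SUP_cong refl)
  then show ?thesis using path_class_self[OF p] by auto
qed

section \<open>Homotopy invariant multiplicative functions on paths\<close>

text \<open>A functor from the fundamental groupoid of \<open>S\<close> to a group. Admitting all paths, and not only
  the loops at the base point, makes it possible to cut a loop into pieces and to argue
  locally on \<open>S\<close>.\<close>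

locale path_functor = Q: group Q for S :: "'a::topological_space set" and Q :: "('q, 'm) monoid_scheme" (structure) +
  fixes \<Phi> :: "(real \<Rightarrow> 'a) \<Rightarrow> 'q"
  assumes closed: "path_in S p u v \<Longrightarrow> \<Phi> p \<in> carrier Q"
    and homotopic: "homotopic_paths S p q \<Longrightarrow> \<Phi> p = \<Phi> q"
    and join: "path_in S p u v \<Longrightarrow> path_in S q v w \<Longrightarrow> \<Phi> (p +++ q) = \<Phi> p \<otimes> \<Phi> q"
begin

lemma const:
  assumes "u \<in> S" shows "\<Phi> (\<lambda>_. u) = \<one>"
proof -
  note c = path_in_const[OF assms]
  have "(\<lambda>_. u) +++ (\<lambda>_. u) = (\<lambda>_. u)" by (auto simp: joinpaths_def)
  then have "\<Phi> (\<lambda>_. u) \<otimes> \<Phi> (\<lambda>_. u) = \<Phi> (\<lambda>_. u)" using join[OF c c] by simp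
  then show ?thesis using closed[OF c] Q.r_cancel_one by blast
qed

lemma reverse:
  assumes "path_in S p u v" shows "\<Phi> (reversepath p) = inv (\<Phi> p)"
proof -
  have "\<Phi> (reversepath p) \<otimes> \<Phi> p = \<Phi> (\<lambda>_. v)"
    using join[OF path_in_reverse[OF assms] assms] homotopic[OF homotopic_paths_linv_const[of p S]] assms
    by (simp add: path_in_def)
  also have "\<dots> = \<one>" using const path_in_mem[OF assms] by blast
  finally show ?thesis using Q.inv_equality closed[OF assms] closed[OF path_in_reverse[OF assms]] by simp
qed

end

lemma path_in_segment:
  assumes "path_in S p u v" "a \<in> {0..1}" "b \<in> {0..1}" "p ` closed_segment a b \<subseteq> V"
  shows "path_in V (p \<circ> linepath a b) (p a) (p b)"
proof -
  have sub: "closed_segment a b \<subseteq> {0..1}" using assms(2,3) by (intro closed_segment_subset) auto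
  have "path (p \<circ> linepath a b)"
    using assms(1) sub by (intro path_continuous_image) (auto simp: path_in_def path_def intro: continuous_on_subset)
  then show ?thesis using assms(4)
    by (simp add: path_in_def path_image_compose pathstart_compose pathfinish_compose)
qed

lemma homotopic_segments:
  fixes a b c :: real
  assumes "path_in S p u v" "a \<in> {0..1}" "b \<in> {0..1}" "c \<in> {0..1}"
  shows "homotopic_paths S ((p \<circ> linepath a b) +++ (p \<circ> linepath b c)) (p \<circ> linepath a c)"
proof -
  have sub: "closed_segment s t \<subseteq> {0..1}" if "s \<in> {0..1}" "t \<in> {0..1}" for s t :: real
    using that by (intro closed_segment_subset) auto
  have "homotopic_paths S (p \<circ> (linepath a b +++ linepath b c)) (p \<circ> linepath a c)"
    by (rule homotopic_paths_reparametrized)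
       (use assms sub in \<open>auto simp: path_in_def path_image_join\<close>)
  then show ?thesis by (simp add: path_compose_join)
qed

text \<open>By compactness of the interval a path is a product of small paths, so that a path functor is
  determined by its values on small paths.\<close>

lemma path_functor_unique:
  assumes \<Phi>: "path_functor S Q \<Phi>" and \<Psi>: "path_functor S Q \<Psi>"
    and local: "\<And>y. y \<in> S \<Longrightarrow> \<exists>V. openin (top_of_set S) V \<and> y \<in> V \<and> (\<forall>p u v. path_in V p u v \<longrightarrow> \<Phi> p = \<Psi> p)"
    and p: "path_in S p u v"
  shows "\<Phi> p = \<Psi> p"
proof -
  interpret \<Phi>: path_functor S Q \<Phi> by fact
  interpret \<Psi>: path_functor S Q \<Psi> by fact
  have cont: "continuous_on {0..1} p" and im: "p \<in> {0..1} \<rightarrow> S"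
    using p by (auto simp: path_in_def path_def path_image_def)
  have seg: "path_in S (p \<circ> linepath a b) (p a) (p b)" if "a \<in> {0..1}" "b \<in> {0..1}" for a b
  proof (rule path_in_segment[OF p that])
    have "closed_segment a b \<subseteq> {0..1}" using that by (intro closed_segment_subset) auto
    then show "p ` closed_segment a b \<subseteq> S" using im by auto
  qed
  let ?P = "\<lambda>t. \<Phi> (p \<circ> linepath 0 t) = \<Psi> (p \<circ> linepath 0 t)"
  have "?P 1"
  proof (rule connected_induction_simple[of "{0..1::real}" 0 1 ?P])
    have s0: "p \<circ> linepath 0 0 = (\<lambda>_. p 0)" by (simp add: linepath_def fun_eq_iff)
    have "p 0 \<in> S" using im by auto
    then show "?P 0" using \<Phi>.const \<Psi>.const by (simp add: s0)
  next
    fix a :: real assume a: "a \<in> {0..1}"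
    then have "p a \<in> S" using im by auto
    then obtain V where V: "openin (top_of_set S) V" "p a \<in> V"
      and eq: "\<And>q u v. path_in V q u v \<Longrightarrow> \<Phi> q = \<Psi> q" using local by meson
    have "openin (top_of_set {0..1}) ({0..1} \<inter> p -` V)"
      using continuous_openin_preimage[OF cont im V(1)] .
    then obtain \<epsilon> where \<epsilon>: "\<epsilon> > 0" "ball a \<epsilon> \<inter> {0..1} \<subseteq> {0..1} \<inter> p -` V"
      using a V(2) unfolding openin_contains_ball by blast
    have step: "?P y" if x: "x \<in> ball a \<epsilon> \<inter> {0..1}" and y: "y \<in> ball a \<epsilon> \<inter> {0..1}" and Px: "?P x" for x y
    proof -
      have "closed_segment x y \<subseteq> ball a \<epsilon> \<inter> {0..1}"
        using x y by (intro closed_segment_subset convex_Int convex_ball) auto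
      then have V': "path_in V (p \<circ> linepath x y) (p x) (p y)"
        using \<epsilon>(2) x y by (intro path_in_segment[OF p]) auto
      have h: "homotopic_paths S ((p \<circ> linepath 0 x) +++ (p \<circ> linepath x y)) (p \<circ> linepath 0 y)"
        by (rule homotopic_segments[OF p]) (use x y in auto)
      have "\<Phi> (p \<circ> linepath 0 y) = \<Phi> (p \<circ> linepath 0 x) \<otimes>\<^bsub>Q\<^esub> \<Phi> (p \<circ> linepath x y)"
        using \<Phi>.homotopic[OF h] \<Phi>.join[OF seg seg, of 0 x y] x y by simp
      also have "\<dots> = \<Psi> (p \<circ> linepath 0 x) \<otimes>\<^bsub>Q\<^esub> \<Psi> (p \<circ> linepath x y)"
        using Px eq[OF V'] by simp
      also have "\<dots> = \<Psi> (p \<circ> linepath 0 y)"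
        using \<Psi>.homotopic[OF h] \<Psi>.join[OF seg seg, of 0 x y] x y by simp
      finally show ?thesis .
    qed
    show "\<exists>T. openin (top_of_set {0..1}) T \<and> a \<in> T \<and> (\<forall>x\<in>T. \<forall>y\<in>T. ?P x \<longrightarrow> ?P y)"
    proof (intro exI conjI ballI impI)
      show "openin (top_of_set {0..1}) (ball a \<epsilon> \<inter> {0..1})" by (metis Int_commute open_ball openin_open_Int)
      show "a \<in> ball a \<epsilon> \<inter> {0..1}" using a \<epsilon>(1) by simp
    qed (rule step)
  qed auto
  moreover have "p \<circ> linepath 0 1 = p" by (simp add: linepath_def fun_eq_iff)
  ultimately show ?thesis by simp
qed

text \<open>Paths from the base point to all the points turn every path into a loop; the auxiliary paths
  cancel in a product.\<close>

lemma path_functor_based_loops: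
  assumes x: "x \<in> S" and k: "\<And>z. z \<in> S \<Longrightarrow> path_in S (k z) x z"
  shows "path_functor S (fundamental_group S x)
           (\<lambda>p. path_class S ((k (pathstart p) +++ p) +++ reversepath (k (pathfinish p))))"
    (is "path_functor _ _ ?\<Phi>")
proof -
  interpret group "fundamental_group S x" by (rule group_fundamental_group[OF x])
  have in_loop: "path_in S ((k u +++ p) +++ reversepath (k v)) x x" if "path_in S p u v" for p u v
    using that k path_in_mem[OF that] by (intro path_in_join path_in_reverse) auto
  show ?thesis
  proof unfold_locales
    show "?\<Phi> p \<in> carrier (fundamental_group S x)" if "path_in S p u v" for p u v
      using path_class_closed[OF in_loop[OF that]] that by (simp add: path_in_def)
    show "?\<Phi> p = ?\<Phi> q" if h: "homotopic_paths S p q" for p q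
    proof -
      let ?u = "pathstart p" and ?v = "pathfinish p"
      have p: "path_in S p ?u ?v"
        using homotopic_paths_imp_path[OF h] homotopic_paths_imp_subset[OF h] by (simp add: path_in_def)
      have e: "pathstart q = ?u" "pathfinish q = ?v"
        using homotopic_paths_imp_pathstart[OF h] homotopic_paths_imp_pathfinish[OF h] by simp_all
      have uv: "?u \<in> S" "?v \<in> S" using path_in_mem[OF p] by simp_all
      have "homotopic_paths S ((k ?u +++ p) +++ reversepath (k ?v)) ((k ?u +++ q) +++ reversepath (k ?v))"
        by (rule homotopic_join_left[OF homotopic_join_right[OF h k[OF uv(1)] p]
              path_in_join[OF k[OF uv(1)] p] path_in_reverse[OF k[OF uv(2)]]])
      then show ?thesis using path_class_eqI e by simp
    qed
    show "?\<Phi> (p +++ q) = ?\<Phi> p \<otimes>\<^bsub>fundamental_group S x\<^esub> ?\<Phi> q" if p: "path_in S p u v" and q: "path_in S q v w" for p q u v w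
    proof -
      have S: "u \<in> S" "v \<in> S" "w \<in> S" using path_in_mem[OF p] path_in_mem[OF q] by auto
      note ku = k[OF S(1)] and kv = k[OF S(2)] and kw = k[OF S(3)]
      note rv = path_in_reverse[OF kv] and rw = path_in_reverse[OF kw]
      let ?A = "k u +++ p" and ?B = "q +++ reversepath (k w)"
      note A = path_in_join[OF ku p] and B = path_in_join[OF q rw]
      have "homotopic_paths S ((?A +++ reversepath (k v)) +++ ((k v +++ q) +++ reversepath (k w)))
          ((?A +++ reversepath (k v)) +++ (k v +++ ?B))"
        by (rule homotopic_join_right[OF homotopic_paths_sym[OF homotopic_assoc[OF kv q rw]] path_in_join[OF A rv]
              path_in_join[OF path_in_join[OF kv q] rw]])
      also have "homotopic_paths S \<dots> (?A +++ (reversepath (k v) +++ (k v +++ ?B)))"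
        by (rule homotopic_paths_sym[OF homotopic_assoc[OF A rv path_in_join[OF kv B]]])
      also have "homotopic_paths S \<dots> (?A +++ ?B)"
        by (rule homotopic_join_right[OF homotopic_cancel_left[OF kv B] A
              path_in_join[OF rv path_in_join[OF kv B]]])
      also have "homotopic_paths S \<dots> ((?A +++ q) +++ reversepath (k w))"
        by (rule homotopic_assoc[OF A q rw])
      also have "homotopic_paths S \<dots> ((k u +++ (p +++ q)) +++ reversepath (k w))"
        by (rule homotopic_join_left[OF homotopic_paths_sym[OF homotopic_assoc[OF ku p q]]
              path_in_join[OF A q] rw])
      finally have h: "homotopic_paths S ((?A +++ reversepath (k v)) +++ ((k v +++ q) +++ reversepath (k w)))
          ((k u +++ (p +++ q)) +++ reversepath (k w))" .
      have ends: "pathstart p = u" "pathfinish p = v" "pathstart q = v" "pathfinish q = w"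
        using p q by (auto simp: path_in_def)
      show ?thesis
        using mult_path_class[OF in_loop[OF p] in_loop[OF q]] path_class_eqI[OF h] by (simp add: ends)
    qed
  qed
qed

lemma path_functor_compose:
  assumes "path_functor S Q \<Phi>" and h: "h \<in> hom Q R" and R: "group R"
  shows "path_functor S R (\<lambda>p. h (\<Phi> p))"
proof -
  interpret \<Phi>: path_functor S Q \<Phi> by fact
  interpret R: group R by fact
  show ?thesis
    by unfold_locales (use h \<Phi>.closed \<Phi>.homotopic \<Phi>.join in \<open>auto simp: hom_def Pi_iff; metis\<close>)+
qed

section \<open>Winding of a path along a map to the circle\<close>

definition circle_lift :: "('a \<Rightarrow> complex) \<Rightarrow> (real \<Rightarrow> 'a) \<Rightarrow> (real \<Rightarrow> real) \<Rightarrow> bool" where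
  "circle_lift e p L \<longleftrightarrow> continuous_on {0..1} L \<and> (\<forall>t\<in>{0..1}. e (p t) = cis (2 * pi * L t))"

text \<open>The winding is measured in full turns and makes sense for paths that are not closed.\<close>

definition winding :: "('a \<Rightarrow> complex) \<Rightarrow> (real \<Rightarrow> 'a) \<Rightarrow> real" where
  "winding e p = (THE r. \<exists>L. circle_lift e p L \<and> r = L 1 - L 0)"

lemma cis_2pi_eq_iff: "cis (2 * pi * a) = cis (2 * pi * b) \<longleftrightarrow> a - b \<in> \<int>"
proof -
  have "cis (2 * pi * a) = cis (2 * pi * b) \<longleftrightarrow> (\<exists>n::int. 2 * pi * a = 2 * pi * b + 2 * pi * of_int n)"
    using sin_cos_eq_iff[of "2 * pi * a" "2 * pi * b"] by (auto simp: complex_eq_iff)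
  also have "\<dots> \<longleftrightarrow> (\<exists>n::int. a = b + of_int n)" by (simp flip: distrib_left)
  finally show ?thesis by (auto simp: Ints_def algebra_simps)
qed

lemma integer_valued_constant:
  fixes f :: "'c::topological_space \<Rightarrow> real"
  assumes "connected C" "continuous_on C f" "\<And>t. t \<in> C \<Longrightarrow> f t \<in> \<int>" "a \<in> C" "b \<in> C"
  shows "f a = f b"
proof -
  have "f constant_on C"
  proof (rule continuous_discrete_range_constant[OF assms(1,2)])
    fix t assume t: "t \<in> C"
    have "1 \<le> norm (f y - f t)" if "y \<in> C" "f y \<noteq> f t" for y
    proof -
      have "f y - f t \<in> \<int>" "f y - f t \<noteq> 0" using assms(3) t that by auto
      then show ?thesis by (metis Ints_nonzero_abs_ge1 real_norm_def)
    qed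
    then show "\<exists>e>0. \<forall>y. y \<in> C \<and> f y \<noteq> f t \<longrightarrow> e \<le> norm (f y - f t)"
      by (intro exI[of _ 1]) auto
  qed
  then show ?thesis using assms(4,5) by (auto simp: constant_on_def)
qed

lemma circle_valued_lift:
  fixes C :: "'c::real_normed_vector set"
  assumes "convex C" "continuous_on C e" "\<And>z. z \<in> C \<Longrightarrow> cmod (e z) = 1"
  obtains L where "continuous_on C L" "\<And>z. z \<in> C \<Longrightarrow> e z = cis (2 * pi * L z)"
proof -
  obtain g where g: "continuous_on C g" "\<And>z. z \<in> C \<Longrightarrow> e z = exp (g z)"
    by (rule continuous_logarithm_on_contractible[OF assms(2) convex_imp_contractible[OF assms(1)]])
       (use assms(3) in force)+
  have "e z = cis (2 * pi * (Im (g z) / (2 * pi)))" if z: "z \<in> C" for z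
  proof -
    have "exp (Re (g z)) = 1" using assms(3)[OF z] g(2)[OF z] by simp
    then have "g z = \<i> * Im (g z)" by (simp add: complex_eq_iff)
    then show ?thesis using g(2)[OF z] by (simp add: cis_conv_exp)
  qed
  moreover have "continuous_on C (\<lambda>z. Im (g z) / (2 * pi))" by (intro continuous_intros g) auto
  ultimately show ?thesis using that by blast
qed

text \<open>Two lifts differ by a continuous function with integral values, hence by a constant.\<close>

lemma winding_eq:
  assumes "circle_lift e p L" shows "winding e p = L 1 - L 0"
proof -
  have "M 1 - M 0 = L 1 - L 0" if M: "circle_lift e p M" for M
  proof -
    have "M 0 - L 0 = M 1 - L 1"
    proof (rule integer_valued_constant[of "{0..1::real}" "\<lambda>t. M t - L t" 0 1])
      show "continuous_on {0..1} (\<lambda>t. M t - L t)"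
        using assms M by (intro continuous_intros) (auto simp: circle_lift_def)
      show "M t - L t \<in> \<int>" if "t \<in> {0..1}" for t
        using assms M that cis_2pi_eq_iff[of "M t" "L t"] by (auto simp: circle_lift_def)
    qed auto
    then show ?thesis by simp
  qed
  then show ?thesis unfolding winding_def using assms by (intro the_equality) blast+
qed

lemma circle_lift_exists:
  assumes e: "continuous_on S e" "\<And>y. y \<in> S \<Longrightarrow> cmod (e y) = 1" and p: "path_in S p u v"
  obtains L where "circle_lift e p L"
proof -
  have "continuous_on {0..1} (e \<circ> p)"
    using p e(1) by (intro continuous_on_compose) (auto simp: path_in_def path_def path_image_def intro: continuous_on_subset)
  then obtain L where "continuous_on {0..1} L" "\<And>t. t \<in> {0..1} \<Longrightarrow> (e \<circ> p) t = cis (2 * pi * L t)"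
    by (rule circle_valued_lift[of "{0..1::real}", rotated])
       (use p e(2) in \<open>force simp: path_in_def path_image_def\<close>)+
  then show ?thesis using that[of L] by (auto simp: circle_lift_def)
qed

text \<open>A homotopy is lifted on the whole square. The lift is constant along the two edges on which
  the end points of the paths stay fixed, because there it differs from a constant by
  integers.\<close>

lemma winding_homotopic:
  assumes e: "continuous_on S e" "\<And>y. y \<in> S \<Longrightarrow> cmod (e y) = 1" and h: "homotopic_paths S p q"
  shows "winding e p = winding e q"
proof -
  obtain H :: "real \<times> real \<Rightarrow> 'a"
    where H: "continuous_on ({0..1} \<times> {0..1}) H" "H \<in> {0..1} \<times> {0..1} \<rightarrow> S"
    and H0: "\<And>t. t \<in> {0..1} \<Longrightarrow> H (0, t) = p t" and H1: "\<And>t. t \<in> {0..1} \<Longrightarrow> H (1, t) = q t"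
    and ends: "\<And>s. s \<in> {0..1} \<Longrightarrow> H (s, 0) = p 0 \<and> H (s, 1) = p 1"
    using h unfolding homotopic_paths pathstart_def pathfinish_def o_def by metis
  have "continuous_on ({0..1} \<times> {0..1}) (e \<circ> H)"
    using H e(1) by (intro continuous_on_compose) (auto intro: continuous_on_subset)
  then obtain L :: "real \<times> real \<Rightarrow> real" where L: "continuous_on ({0..1} \<times> {0..1}) L"
    and Le: "\<And>z. z \<in> {0..1::real} \<times> {0..1::real} \<Longrightarrow> (e \<circ> H) z = cis (2 * pi * L z)"
    by (rule circle_valued_lift[of "{0..1::real} \<times> {0..1::real}", rotated])
       (use H e(2) in \<open>auto intro!: convex_Times\<close>)
  have slice: "continuous_on {0..1} (\<lambda>t. L (s, t))" "continuous_on {0..1} (\<lambda>t. L (t, s))" if "s \<in> {0..1}" for s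
    using that by (auto intro!: continuous_on_compose2[OF L] continuous_intros)
  have edge: "L (0, b) = L (1, b)" if b: "b \<in> {0, 1}" for b
  proof -
    have "L (0, b) - L (0, b) = L (1, b) - L (0, b)"
    proof (rule integer_valued_constant[of "{0..1::real}" "\<lambda>s. L (s, b) - L (0, b)" 0 1])
      show "continuous_on {0..1} (\<lambda>s. L (s, b) - L (0, b))"
        using slice(2)[of b] b by (auto intro!: continuous_intros)
      show "L (s, b) - L (0, b) \<in> \<int>" if s: "s \<in> {0..1}" for s
        using Le[of "(s, b)"] Le[of "(0, b)"] ends[OF s] ends[of 0] b s cis_2pi_eq_iff[of "L (s, b)" "L (0, b)"] by auto
    qed auto
    then show ?thesis by simp
  qed
  have p: "circle_lift e p (\<lambda>t. L (0, t))"
    unfolding circle_lift_def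
  proof (intro conjI ballI)
    show "e (p t) = cis (2 * pi * L (0, t))" if "t \<in> {0..1}" for t
      using Le[of "(0, t)"] H0[OF that] that by simp
  qed (rule slice(1), simp)
  have q: "circle_lift e q (\<lambda>t. L (1, t))"
    unfolding circle_lift_def
  proof (intro conjI ballI)
    show "e (q t) = cis (2 * pi * L (1, t))" if "t \<in> {0..1}" for t
      using Le[of "(1, t)"] H1[OF that] that by simp
  qed (rule slice(1), simp)
  show ?thesis using edge[of 0] edge[of 1] winding_eq[OF p] winding_eq[OF q] by simp
qed

lemma winding_join:
  assumes e: "continuous_on S e" "\<And>y. y \<in> S \<Longrightarrow> cmod (e y) = 1"
    and p: "path_in S p u v" and q: "path_in S q v w"
  shows "winding e (p +++ q) = winding e p + winding e q"
proof -
  obtain L where L: "circle_lift e (p +++ q) L"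
    using circle_lift_exists[OF e path_in_join[OF p q]] .
  have c: "continuous_on {0..1} L" and l: "\<And>t. t \<in> {0..1} \<Longrightarrow> e ((p +++ q) t) = cis (2 * pi * L t)"
    using L by (auto simp: circle_lift_def)
  have vq: "q 0 = p 1" using p q by (auto simp: path_in_def pathstart_def pathfinish_def)
  have 1: "circle_lift e p (\<lambda>t. L (t / 2))"
    unfolding circle_lift_def
  proof (intro conjI ballI)
    show "continuous_on {0..1} (\<lambda>t. L (t / 2))" by (rule continuous_on_compose2[OF c]) (auto intro!: continuous_intros)
    show "e (p t) = cis (2 * pi * L (t / 2))" if "t \<in> {0..1}" for t
      using l[of "t / 2"] that by (auto simp: joinpaths_def)
  qed
  have 2: "circle_lift e q (\<lambda>t. L ((t + 1) / 2))"
    unfolding circle_lift_def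
  proof (intro conjI ballI)
    show "continuous_on {0..1} (\<lambda>t. L ((t + 1) / 2))" by (rule continuous_on_compose2[OF c]) (auto intro!: continuous_intros)
    show "e (q t) = cis (2 * pi * L ((t + 1) / 2))" if t: "t \<in> {0..1}" for t
    proof (cases "t = 0")
      case True
      then show ?thesis using l[of "1 / 2"] vq by (simp add: joinpaths_def)
    next
      case False
      moreover have "2 * ((t + 1) / 2) - 1 = t" by (simp add: field_simps)
      ultimately show ?thesis using l[of "(t + 1) / 2"] t by (auto simp: joinpaths_def)
    qed
  qed
  show ?thesis using winding_eq[OF L] winding_eq[OF 1] winding_eq[OF 2] by simp
qed

lemma winding_loop_int:
  assumes e: "continuous_on S e" "\<And>y. y \<in> S \<Longrightarrow> cmod (e y) = 1" and p: "path_in S p u u"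
  shows "winding e p \<in> \<int>"
proof -
  obtain L where L: "circle_lift e p L" using circle_lift_exists[OF e p] .
  have "p 0 = p 1" using p by (auto simp: path_in_def pathstart_def pathfinish_def)
  moreover have "e (p 0) = cis (2 * pi * L 0)" "e (p 1) = cis (2 * pi * L 1)"
    using L by (simp_all add: circle_lift_def)
  ultimately have "cis (2 * pi * L 1) = cis (2 * pi * L 0)" by simp
  then show ?thesis using winding_eq[OF L] cis_2pi_eq_iff by simp
qed

text \<open>If \<open>L\<close> and \<open>M\<close> are lifts of \<open>e\<close> and \<open>d\<close> along \<open>p\<close>, then \<open>L + k M + r \<circ> p\<close> is a lift of \<open>e\<close>
  along \<open>f \<circ> p\<close>. For a loop the summand \<open>r\<close> has no effect.\<close>

lemma winding_compose_twisted:
  assumes e: "continuous_on S e" "\<And>y. y \<in> S \<Longrightarrow> cmod (e y) = 1"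
    and d: "continuous_on S d" "\<And>y. y \<in> S \<Longrightarrow> cmod (d y) = 1"
    and r: "continuous_on S r" and f: "\<And>y. y \<in> S \<Longrightarrow> e (f y) = e y * (d y) powi k * cis (2 * pi * r y)"
    and p: "path_in S p u v"
  shows "winding e (f \<circ> p) = winding e p + of_int k * winding d p + (r v - r u)"
proof -
  obtain L where L: "circle_lift e p L" using circle_lift_exists[OF e p] .
  obtain M where M: "circle_lift d p M" using circle_lift_exists[OF d p] .
  have pS: "p t \<in> S" if "t \<in> {0..1}" for t using p that by (auto simp: path_in_def path_image_def)
  have "circle_lift e (f \<circ> p) (\<lambda>t. L t + of_int k * M t + r (p t))"
    unfolding circle_lift_def
  proof (intro conjI ballI)
    have "continuous_on {0..1} (\<lambda>t. r (p t))"
      using p pS by (intro continuous_on_compose2[OF r]) (auto simp: path_in_def path_def)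
    then show "continuous_on {0..1} (\<lambda>t. L t + of_int k * M t + r (p t))"
      using L M by (intro continuous_intros) (auto simp: circle_lift_def)
    fix t :: real assume t: "t \<in> {0..1}"
    have "(cis (2 * pi * M t)) powi k = cis (2 * pi * (of_int k * M t))"
      by (simp add: cis_power_int mult_ac)
    then show "e ((f \<circ> p) t) = cis (2 * pi * (L t + of_int k * M t + r (p t)))"
      using f[OF pS[OF t]] L M t by (simp add: circle_lift_def cis_mult ring_distribs mult.assoc add.assoc)
  qed
  note w = winding_eq[OF this]
  have "p 0 = u" "p 1 = v" using p by (auto simp: path_in_def pathstart_def pathfinish_def)
  then show ?thesis unfolding w winding_eq[OF L] winding_eq[OF M] by (simp add: algebra_simps)
qed

lemma winding_const: "cmod (e u) = 1 \<Longrightarrow> winding e (\<lambda>_. u) = 0"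
proof -
  assume "cmod (e u) = 1"
  then have "e u = cis (Arg (e u))" using cis_Arg[of "e u"] by (metis norm_zero sgn_eq zero_neq_one div_by_1 of_real_1)
  then have "circle_lift e (\<lambda>_. u) (\<lambda>_. Arg (e u) / (2 * pi))" by (simp add: circle_lift_def)
  from winding_eq[OF this] show ?thesis by simp
qed

text \<open>A lasso moves a loop to the base point; its rope is run through in both directions.\<close>

lemma winding_lasso:
  assumes e: "continuous_on S e" "\<And>y. y \<in> S \<Longrightarrow> cmod (e y) = 1"
    and c: "path_in S c x u" and l: "path_in S l u u"
  shows "winding e (c +++ (l +++ reversepath c)) = winding e l"
proof -
  note r = path_in_reverse[OF c]
  have "winding e c + winding e (reversepath c) = winding e (c +++ reversepath c)"
    by (rule winding_join[OF e c r, symmetric])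
  also have "\<dots> = winding e (\<lambda>_. x)"
    by (rule winding_homotopic[OF e]) (use homotopic_paths_rinv_const[of c S] c in \<open>auto simp: path_in_def\<close>)
  also have "\<dots> = 0" by (rule winding_const) (use e(2) path_in_mem[OF c] in blast)
  finally show ?thesis using winding_join[OF e c path_in_join[OF l r]] winding_join[OF e l r] by simp
qed

text \<open>The winding is the same integer for all members of a class; the floor merely changes its
  type.\<close>

definition loop_degree :: "('a::topological_space \<Rightarrow> complex) \<Rightarrow> (real \<Rightarrow> 'a) set \<Rightarrow> int" where
  "loop_degree e A = \<lfloor>winding e (SOME p. p \<in> A)\<rfloor>"

lemma loop_degree_path_class:
  assumes e: "continuous_on S e" "\<And>y. y \<in> S \<Longrightarrow> cmod (e y) = 1" and p: "path_in S p u u"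
  shows "real_of_int (loop_degree e (path_class S p)) = winding e p"
proof -
  have "(SOME q. q \<in> path_class S p) \<in> path_class S p"
    by (rule someI[of "\<lambda>q. q \<in> path_class S p", OF path_class_self[OF p]])
  then have "winding e (SOME q. q \<in> path_class S p) = winding e p"
    using winding_homotopic[OF e, of p] by (simp add: path_class_def)
  then show ?thesis using winding_loop_int[OF e p] by (auto simp: loop_degree_def elim: Ints_cases)
qed

lemma loop_degree_mult:
  assumes e: "continuous_on S e" "\<And>y. y \<in> S \<Longrightarrow> cmod (e y) = 1"
    and A: "A \<in> carrier (fundamental_group S x)" and B: "B \<in> carrier (fundamental_group S x)"
  shows "loop_degree e (A \<otimes>\<^bsub>fundamental_group S x\<^esub> B) = loop_degree e A + loop_degree e B"
proof -
  obtain p q where p: "path_in S p x x" "A = path_class S p" and q: "path_in S q x x" "B = path_class S q"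
    using A B by (auto simp: carrier_fundamental_group)
  have "real_of_int (loop_degree e (A \<otimes>\<^bsub>fundamental_group S x\<^esub> B)) = real_of_int (loop_degree e A + loop_degree e B)"
    using loop_degree_path_class[OF e p(1)] loop_degree_path_class[OF e q(1)]
      loop_degree_path_class[OF e path_in_join[OF p(1) q(1)]] winding_join[OF e p(1) q(1)]
      mult_path_class[OF p(1) q(1)] p(2) q(2) by simp
  then show ?thesis by linarith
qed

section \<open>Twists along an annulus\<close>

lemma continuous_on_open_cover2:
  assumes "openin (top_of_set D) A" "openin (top_of_set D) B" "D \<subseteq> A \<union> B"
    and "continuous_on A f" "continuous_on B f"
  shows "continuous_on D f"
  unfolding continuous_openin_preimage_eq
proof (intro allI impI)
  fix T :: "'b set" assume T: "open T"
  have "openin (top_of_set A) (A \<inter> f -` T)" "openin (top_of_set B) (B \<inter> f -` T)"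
    using assms(4,5) T unfolding continuous_openin_preimage_eq by simp_all
  then have "openin (top_of_set D) (A \<inter> f -` T)" "openin (top_of_set D) (B \<inter> f -` T)"
    using openin_trans assms(1,2) by metis+
  moreover have "D \<inter> f -` T = (A \<inter> f -` T) \<union> (B \<inter> f -` T)"
    using assms(1,2,3) openin_imp_subset by blast
  ultimately show "openin (top_of_set D) (D \<inter> f -` T)" by (simp add: openin_Un)
qed

text \<open>The map \<open>E\<close> presents an open annulus in \<open>S\<close> as the quotient of a strip by the unit
  translation in the second coordinate. Closed sub-annuli are required to be closed in the
  whole of \<open>S\<close>, so that a map of the annulus which is the identity near its ends extends by
  the identity. The interval from \<open>a\<close> to \<open>b\<close> carries the twist.\<close>

locale annulus =
  fixes S :: "'a::topological_space set" and E :: "real \<times> real \<Rightarrow> 'a" and lo a b hi :: real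
  assumes range: "lo < a" "a < b" "b < hi"
    and E_cont: "continuous_on ({lo<..<hi} \<times> UNIV) E"
    and E_mem: "w \<in> {lo<..<hi} \<times> UNIV \<Longrightarrow> E w \<in> S"
    and E_open: "open W \<Longrightarrow> W \<subseteq> {lo<..<hi} \<times> UNIV \<Longrightarrow> openin (top_of_set S) (E ` W)"
    and E_eq: "w \<in> {lo<..<hi} \<times> UNIV \<Longrightarrow> w' \<in> {lo<..<hi} \<times> UNIV \<Longrightarrow>
                 E w = E w' \<longleftrightarrow> fst w = fst w' \<and> snd w - snd w' \<in> \<int>"
    and E_closed: "lo < c \<Longrightarrow> d < hi \<Longrightarrow> openin (top_of_set S) (S - E ` ({c..d} \<times> UNIV))"
begin

abbreviation strip :: "(real \<times> real) set" where "strip \<equiv> {lo<..<hi} \<times> UNIV"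

definition coord :: "'a \<Rightarrow> real \<times> real" where "coord y = inv_into strip E y"

lemma coord: "y \<in> E ` strip \<Longrightarrow> coord y \<in> strip \<and> E (coord y) = y"
  unfolding coord_def by (simp add: inv_into_into f_inv_into_f)

lemma coord_E:
  assumes "w \<in> strip"
  obtains n :: int where "coord (E w) = (fst w, snd w + of_int n)"
proof -
  have c: "coord (E w) \<in> strip" "E (coord (E w)) = E w" using coord[of "E w"] assms by auto
  then have "fst (coord (E w)) = fst w" "snd (coord (E w)) - snd w \<in> \<int>" using E_eq[OF c(1) assms] by auto
  then obtain n :: int where "snd (coord (E w)) - snd w = of_int n" by (auto elim: Ints_cases)
  then show ?thesis using that[of n] \<open>fst _ = _\<close> by (simp add: prod_eq_iff)
qed

lemma open_strip: "open strip" by (intro open_Times) auto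

lemma open_annulus: "openin (top_of_set S) (E ` strip)"
  by (rule E_open[OF open_strip]) simp

lemma annulus_subset: "E ` strip \<subseteq> S" using E_mem by blast

lemma E_shift: "x \<in> {lo<..<hi} \<Longrightarrow> E (x, u + of_int n) = E (x, u)"
  by (subst E_eq) auto

lemma E_mem_closed_iff:
  assumes "lo < c" "d < hi" "w \<in> strip"
  shows "E w \<in> E ` ({c..d} \<times> UNIV) \<longleftrightarrow> fst w \<in> {c..d}"
proof
  assume "E w \<in> E ` ({c..d} \<times> UNIV)"
  then obtain w' where w': "w' \<in> {c..d} \<times> UNIV" "E w = E w'" by blast
  have "w' \<in> strip" using w'(1) assms by auto
  then have "fst w = fst w'" using E_eq[OF assms(3)] w'(2) by metis
  then show "fst w \<in> {c..d}" using w'(1) by (auto simp: mem_Times_iff)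
next
  assume "fst w \<in> {c..d}"
  then have "w \<in> {c..d} \<times> UNIV" by (auto simp: mem_Times_iff)
  then show "E w \<in> E ` ({c..d} \<times> UNIV)" by (rule imageI)
qed

text \<open>Being an open map onto the annulus, \<open>E\<close> is a quotient map, and it stays one after taking the
  product with a space of parameters.\<close>

lemma continuous_on_annulus:
  fixes f :: "'t::topological_space \<times> 'a \<Rightarrow> 'b::topological_space"
  assumes "continuous_on (T \<times> strip) (\<lambda>(t, w). f (t, E w))"
  shows "continuous_on (T \<times> E ` strip) f"
  unfolding continuous_openin_preimage_eq
proof (intro allI impI)
  fix B :: "'b set" assume B: "open B"
  let ?D = "T \<times> E ` strip" and ?g = "\<lambda>(t, w). f (t, E w)"
  have og: "openin (top_of_set (T \<times> strip)) ((T \<times> strip) \<inter> ?g -` B)"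
    using assms B unfolding continuous_openin_preimage_eq by blast
  show "openin (top_of_set ?D) (?D \<inter> f -` B)"
  proof (subst openin_subopen, intro ballI)
    fix z assume "z \<in> ?D \<inter> f -` B"
    then obtain t w where z: "z = (t, E w)" "t \<in> T" "w \<in> strip" "f (t, E w) \<in> B" by auto
    then have "(t, w) \<in> (T \<times> strip) \<inter> ?g -` B" by auto
    then obtain O' where O': "open O'" "(t, w) \<in> O'" "(T \<times> strip) \<inter> O' \<subseteq> ?g -` B"
      using og unfolding openin_open by blast
    obtain T0 W0 where TW: "open T0" "open W0" "(t, w) \<in> T0 \<times> W0" "T0 \<times> W0 \<subseteq> O'"
      using open_prod_elim[OF O'(1,2)] by metis
    let ?N = "(T \<inter> T0) \<times> E ` (W0 \<inter> strip)"
    have "openin (top_of_set S) (E ` (W0 \<inter> strip))"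
      by (rule E_open) (use TW open_strip in auto)
    then have "openin (top_of_set (E ` strip)) (E ` (W0 \<inter> strip))"
      by (rule openin_subset_trans) (use annulus_subset in auto)
    then have "openin (top_of_set ?D) ?N"
      by (intro openin_Times) (auto simp: TW openin_open_Int)
    moreover have "z \<in> ?N" using z TW by auto
    moreover have "?N \<subseteq> ?D \<inter> f -` B"
    proof
      fix y assume "y \<in> ?N"
      then obtain s v where y: "y = (s, E v)" "s \<in> T" "s \<in> T0" "v \<in> W0" "v \<in> strip" by auto
      then have "(s, v) \<in> (T \<times> strip) \<inter> O'" using TW by auto
      then have "(s, v) \<in> ?g -` B" using O'(3) by blast
      then have "f (s, E v) \<in> B" by simp
      then show "y \<in> ?D \<inter> f -` B" using y by auto
    qed
    ultimately show "\<exists>T. openin (top_of_set ?D) T \<and> z \<in> T \<and> T \<subseteq> ?D \<inter> f -` B" by blast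
  qed
qed

lemma continuous_on_glue_param:
  fixes f :: "'t::topological_space \<times> 'a \<Rightarrow> 'b::topological_space"
  assumes cd: "lo < c" "d < hi"
    and in_annulus: "continuous_on (T \<times> strip) (\<lambda>(t, w). f (t, E w))"
    and off: "continuous_on (T \<times> (S - E ` ({c..d} \<times> UNIV))) f"
  shows "continuous_on (T \<times> S) f"
proof (rule continuous_on_open_cover2[OF _ _ _ continuous_on_annulus[OF in_annulus] off])
  show "openin (top_of_set (T \<times> S)) (T \<times> E ` strip)"
    by (intro openin_Times open_annulus) simp
  show "openin (top_of_set (T \<times> S)) (T \<times> (S - E ` ({c..d} \<times> UNIV)))"
    by (intro openin_Times E_closed cd) simp
  have "E ` ({c..d} \<times> UNIV) \<subseteq> E ` strip" using cd by (intro image_mono) auto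
  then show "T \<times> S \<subseteq> T \<times> E ` strip \<union> T \<times> (S - E ` ({c..d} \<times> UNIV))" by blast
qed

lemma continuous_on_glue:
  fixes f :: "'a \<Rightarrow> 'b::topological_space"
  assumes cd: "lo < c" "d < hi"
    and in_annulus: "continuous_on strip (\<lambda>w. f (E w))"
    and off: "continuous_on (S - E ` ({c..d} \<times> UNIV)) f"
  shows "continuous_on S f"
proof -
  have "continuous_on ({0::real} \<times> S) (\<lambda>z. f (snd z))"
  proof (rule continuous_on_glue_param[OF cd])
    show "continuous_on ({0::real} \<times> strip) (\<lambda>(t, w). f (snd (t, E w)))"
      by (auto simp: case_prod_unfold intro!: continuous_on_compose2[OF in_annulus] continuous_intros)
    show "continuous_on ({0::real} \<times> (S - E ` ({c..d} \<times> UNIV))) (\<lambda>z. f (snd z))"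
      by (auto intro!: continuous_on_compose2[OF off] continuous_intros)
  qed
  then have "continuous_on S ((\<lambda>z. f (snd z)) \<circ> Pair (0::real))"
    by (intro continuous_on_compose) (auto intro!: continuous_intros elim!: continuous_on_subset)
  then show ?thesis by (simp add: o_def)
qed

text \<open>The self-map of \<open>S\<close> that a map \<open>F\<close> of the strip induces on the annulus, extended by the
  identity. It does not depend on the choice of coordinates when \<open>F\<close> commutes with the unit
  translation.\<close>

definition carry :: "(real \<times> real \<Rightarrow> real \<times> real) \<Rightarrow> 'a \<Rightarrow> 'a" where
  "carry F y = (if y \<in> E ` strip then E (F (coord y)) else y)"

definition equivariant :: "(real \<times> real \<Rightarrow> real \<times> real) \<Rightarrow> bool" where
  "equivariant F \<longleftrightarrow> (\<forall>w\<in>strip. F w \<in> strip \<and> (\<forall>n::int. F (fst w, snd w + of_int n) = (fst (F w), snd (F w) + of_int n)))"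

lemma equivariant_mem: "equivariant F \<Longrightarrow> w \<in> strip \<Longrightarrow> F w \<in> strip"
  unfolding equivariant_def by blast

lemma equivariant_shift:
  "equivariant F \<Longrightarrow> w \<in> strip \<Longrightarrow> F (fst w, snd w + of_int n) = (fst (F w), snd (F w) + of_int n)"
  unfolding equivariant_def by blast

lemma carry_E:
  assumes "equivariant F" "w \<in> strip" shows "carry F (E w) = E (F w)"
proof -
  obtain n :: int where n: "coord (E w) = (fst w, snd w + of_int n)" using coord_E[OF assms(2)] .
  have "E (F (coord (E w))) = E (fst (F w), snd (F w) + of_int n)"
    unfolding n equivariant_shift[OF assms] ..
  also have "\<dots> = E (fst (F w), snd (F w))"
    by (rule E_shift) (use equivariant_mem[OF assms] in \<open>auto simp: mem_Times_iff\<close>)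
  finally show ?thesis using assms(2) by (simp add: carry_def)
qed

lemma carry_off: "y \<notin> E ` strip \<Longrightarrow> carry F y = y"
  by (simp add: carry_def)

lemma carry_mem: "equivariant F \<Longrightarrow> y \<in> S \<Longrightarrow> carry F y \<in> S"
  using E_mem[OF equivariant_mem[of F "coord y"]] coord[of y] unfolding carry_def by simp

lemma carry_compose:
  assumes F: "equivariant F" and G: "equivariant G"
  shows "carry F (carry G y) = carry (F \<circ> G) y"
proof (cases "y \<in> E ` strip")
  case True
  have G': "G (coord y) \<in> strip" using equivariant_mem[OF G conjunct1[OF coord[OF True]]] .
  have eval: "carry H y = E (H (coord y))" for H unfolding carry_def if_P[OF True] ..
  show ?thesis unfolding eval carry_E[OF F G'] by simp
qed (simp add: carry_def)

lemma continuous_on_carry_param: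
  fixes F :: "'t::topological_space \<Rightarrow> real \<times> real \<Rightarrow> real \<times> real"
  assumes cd: "lo < c" "d < hi"
    and F: "continuous_on (T \<times> strip) (\<lambda>(t, w). F t w)" "\<And>t. t \<in> T \<Longrightarrow> equivariant (F t)"
    and off: "\<And>t w. t \<in> T \<Longrightarrow> w \<in> strip \<Longrightarrow> fst w \<notin> {c..d} \<Longrightarrow> E (F t w) = E w"
  shows "continuous_on (T \<times> S) (\<lambda>(t, y). carry (F t) y)"
proof (rule continuous_on_glue_param[OF cd])
  have "continuous_on (T \<times> strip) (\<lambda>z. E (F (fst z) (snd z)))"
  proof (rule continuous_on_compose2[OF E_cont])
    show "continuous_on (T \<times> strip) (\<lambda>z. F (fst z) (snd z))" using F(1) by (simp add: case_prod_unfold)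
    show "(\<lambda>z. F (fst z) (snd z)) ` (T \<times> strip) \<subseteq> strip"
    proof
      fix v assume "v \<in> (\<lambda>z. F (fst z) (snd z)) ` (T \<times> strip)"
      then obtain z where z: "z \<in> T \<times> strip" "v = F (fst z) (snd z)" by blast
      then show "v \<in> strip" using equivariant_mem[OF F(2), of "fst z" "snd z"] by (simp add: mem_Times_iff)
    qed
  qed
  then show "continuous_on (T \<times> strip) (\<lambda>(t, w). case (t, E w) of (t, y) \<Rightarrow> carry (F t) y)"
    by (rule continuous_on_eq) (use F(2) carry_E in \<open>auto simp: case_prod_unfold\<close>)
  have "carry (F t) y = y" if t: "t \<in> T" and y: "y \<notin> E ` ({c..d} \<times> UNIV)" for t y
  proof (cases "y \<in> E ` strip")
    case True
    then obtain w where w: "w \<in> strip" "y = E w" by blast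
    then have "fst w \<notin> {c..d}" using E_mem_closed_iff[OF cd w(1)] y by simp
    then show ?thesis using carry_E[OF F(2)[OF t] w(1)] off[OF t w(1)] w(2) by simp
  qed (rule carry_off)
  then show "continuous_on (T \<times> (S - E ` ({c..d} \<times> UNIV))) (\<lambda>(t, y). carry (F t) y)"
    by (intro continuous_on_eq[OF continuous_on_snd[OF continuous_on_id]]) auto
qed

lemma continuous_on_carry:
  assumes cd: "lo < c" "d < hi"
    and F: "continuous_on strip F" "equivariant F"
    and off: "\<And>w. w \<in> strip \<Longrightarrow> fst w \<notin> {c..d} \<Longrightarrow> E (F w) = E w"
  shows "continuous_on S (carry F)"
proof (rule continuous_on_glue[OF cd])
  have "continuous_on strip (\<lambda>w. E (F w))"
    using equivariant_mem[OF F(2)] by (intro continuous_on_compose2[OF E_cont F(1)] image_subsetI)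
  then show "continuous_on strip (\<lambda>w. carry F (E w))"
    by (rule continuous_on_eq) (use F(2) carry_E in auto)
  have "carry F y = y" if y: "y \<notin> E ` ({c..d} \<times> UNIV)" for y
  proof (cases "y \<in> E ` strip")
    case True
    then obtain w where w: "w \<in> strip" "y = E w" by blast
    then have "fst w \<notin> {c..d}" using E_mem_closed_iff[OF cd w(1)] y by simp
    then show ?thesis using carry_E[OF F(2) w(1)] off[OF w(1)] w(2) by simp
  qed (rule carry_off)
  then show "continuous_on (S - E ` ({c..d} \<times> UNIV)) (carry F)"
    by (intro continuous_on_eq[OF continuous_on_id]) auto
qed

subsection \<open>Rotating the annulus\<close>

definition ramp :: "real \<Rightarrow> real" where
  "ramp x = max 0 (min 1 ((x - a) / (b - a)))"

lemma ramp_low: "x \<le> a \<Longrightarrow> ramp x = 0" and ramp_high: "b \<le> x \<Longrightarrow> ramp x = 1"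
  using range by (auto simp: ramp_def divide_le_0_iff field_simps min_def max_def)

lemma ramp_integer: "x \<notin> {a..b} \<Longrightarrow> ramp x \<in> {0, 1}"
  using ramp_low[of x] ramp_high[of x] by force

lemma continuous_ramp: "continuous_on A ramp"
  unfolding ramp_def using range by (intro continuous_intros) auto

definition shear :: "real \<Rightarrow> real \<times> real \<Rightarrow> real \<times> real" where
  "shear s w = (fst w, snd w + s * ramp (fst w))"

lemma equivariant_shear: "equivariant (shear s)"
  by (auto simp: equivariant_def shear_def)

text \<open>Beyond the end \<open>b\<close> of the core the annulus is rotated rigidly by \<open>s\<close> turns. Unless \<open>s\<close> is an
  integer this does not fit together with the identity outside of the annulus; but on the
  annulus alone the rotations form a homotopy from the identity to the twists.\<close>

definition rotate :: "real \<Rightarrow> 'a \<Rightarrow> 'a" where "rotate s = carry (shear s)"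

text \<open>The \<open>k\<close>-fold Dehn twist along the annulus.\<close>

definition twist :: "int \<Rightarrow> 'a \<Rightarrow> 'a" where "twist k = rotate (of_int k)"

abbreviation core :: "'a set" where "core \<equiv> E ` ({a..b} \<times> UNIV)"

lemma core_subset: "core \<subseteq> E ` strip" using range by (intro image_mono) auto

lemma open_off_core: "openin (top_of_set S) (S - core)"
  by (rule E_closed) (use range in auto)

lemma rotate_E: "w \<in> strip \<Longrightarrow> rotate s (E w) = E (fst w, snd w + s * ramp (fst w))"
  using carry_E[OF equivariant_shear] by (simp add: rotate_def shear_def)

lemma rotate_off: "y \<notin> E ` strip \<Longrightarrow> rotate s y = y"
  by (simp add: rotate_def carry_off)

lemma rotate_mem: "y \<in> S \<Longrightarrow> rotate s y \<in> S"
  unfolding rotate_def by (rule carry_mem[OF equivariant_shear])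

lemma rotate_0 [simp]: "rotate 0 y = y"
  using coord[of y] by (auto simp: rotate_def carry_def shear_def)

lemma rotate_rotate: "rotate s (rotate t y) = rotate (s + t) y"
proof -
  have "shear s \<circ> shear t = shear (s + t)" by (auto simp: fun_eq_iff shear_def algebra_simps)
  then show ?thesis unfolding rotate_def by (simp add: carry_compose equivariant_shear)
qed

lemma continuous_on_rotate:
  assumes A: "A \<subseteq> E ` strip"
  shows "continuous_on (UNIV \<times> A) (\<lambda>(s, y). rotate s y)"
proof -
  have "continuous_on (UNIV \<times> strip) (\<lambda>z. E (shear (fst z) (snd z)))"
    unfolding shear_def
    by (intro continuous_on_compose2[OF E_cont] continuous_intros continuous_on_compose2[OF continuous_ramp]) auto
  then have "continuous_on (UNIV \<times> strip) (\<lambda>(t, w). case (t, E w) of (s, y) \<Rightarrow> rotate s y)"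
    by (rule continuous_on_eq) (auto simp: rotate_E shear_def)
  from continuous_on_annulus[OF this] show ?thesis by (rule continuous_on_subset) (use A in auto)
qed

lemma twist_fix: "y \<notin> core \<Longrightarrow> twist k y = y"
proof (cases "y \<in> E ` strip")
  case True
  assume y: "y \<notin> core"
  obtain w where w: "w \<in> strip" "y = E w" using True by blast
  then have "fst w \<notin> {a..b}" using E_mem_closed_iff[of a b w] range y by auto
  then obtain n :: int where n: "of_int k * ramp (fst w) = of_int n"
    using ramp_integer[of "fst w"] by (metis insertE mult.right_neutral mult_zero_right of_int_0 singletonD)
  have "fst w \<in> {lo<..<hi}" using w(1) by auto
  then show ?thesis using w rotate_E[OF w(1)] E_shift[of "fst w" "snd w" n] by (simp add: twist_def n)
qed (simp add: twist_def rotate_off)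

lemma twist_mem: "y \<in> S \<Longrightarrow> twist k y \<in> S"
  by (simp add: twist_def rotate_mem)

lemma twist_add: "twist k (twist l y) = twist (k + l) y"
  by (simp add: twist_def rotate_rotate)

lemma twist_0 [simp]: "twist 0 y = y"
  by (simp add: twist_def)

lemma continuous_on_twist: "continuous_on S (twist k)"
  unfolding twist_def rotate_def
proof (rule continuous_on_carry[of a b])
  show "continuous_on strip (shear (of_int k))"
    unfolding shear_def by (intro continuous_intros continuous_on_compose2[OF continuous_ramp]) auto
  fix w assume w: "w \<in> strip" "fst w \<notin> {a..b}"
  then have "E w \<notin> core" using E_mem_closed_iff[of a b w] range by auto
  then show "E (shear (of_int k) w) = E w"
    using twist_fix[of "E w" k] w rotate_E[OF w(1)] by (simp add: twist_def shear_def)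
qed (use range equivariant_shear in auto)

lemma homeomorphism_twist: "homeomorphism S S (twist k) (twist (- k))"
proof -
  have "twist k ` S = S" for k
  proof
    show "twist k ` S \<subseteq> S" using twist_mem by blast
    show "S \<subseteq> twist k ` S"
    proof
      fix y assume "y \<in> S"
      then have "twist (- k) y \<in> S" "y = twist k (twist (- k) y)" by (auto simp: twist_mem twist_add)
      then show "y \<in> twist k ` S" by blast
    qed
  qed
  then show ?thesis by (simp add: homeomorphism_def twist_add continuous_on_twist)
qed

subsection \<open>The action of twists on path functors\<close>

lemma E_vertical:
  assumes "x \<in> {lo<..<hi}"
  shows "continuous_on ({x} \<times> UNIV) E" "E \<in> {x} \<times> UNIV \<rightarrow> S"
  using assms E_mem by (auto intro: continuous_on_subset[OF E_cont])

lemma path_in_vertical: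
  assumes "x \<in> {lo<..<hi}"
  shows "path_in S (\<lambda>t. E (x, r + t * s)) (E (x, r)) (E (x, r + s))"
proof -
  have "path_in ({x} \<times> UNIV) (\<lambda>t. (x, r + t * s)) (x, r) (x, r + s)"
    by (auto simp: path_in_def path_def path_image_def pathstart_def pathfinish_def intro!: continuous_intros)
  from path_in_compose[OF this E_vertical[OF assms]] show ?thesis by (simp add: o_def)
qed

text \<open>The track of a point beyond the core under \<open>n\<close> rotations is the \<open>n\<close>-th power of the track of
  one rotation, for it is a reparametrization of it.\<close>

lemma full_turns:
  assumes \<Phi>: "path_functor S Q \<Phi>" and x: "x \<in> {lo<..<hi}"
  shows "\<Phi> (\<lambda>t. E (x, u + t * real n)) = \<Phi> (\<lambda>t. E (x, u + t)) [^]\<^bsub>Q\<^esub> n"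
    and "path_in S (\<lambda>t. E (x, u + t)) (E (x, u)) (E (x, u))"
proof -
  interpret \<Phi>: path_functor S Q \<Phi> by fact
  let ?C = "{x} \<times> (UNIV :: real set)"
  note C = E_vertical[OF x]
  note pth = path_in_vertical[OF x]
  show one: "path_in S (\<lambda>t. E (x, u + t)) (E (x, u)) (E (x, u))" for u
    using pth[of u 1] E_shift[OF x, of u 1] by simp
  show "\<Phi> (\<lambda>t. E (x, u + t * real n)) = \<Phi> (\<lambda>t. E (x, u + t)) [^]\<^bsub>Q\<^esub> n"
  proof (induction n)
    case 0
    have "E (x, u) \<in> S" using E_mem x by auto
    then show ?case using \<Phi>.const by simp
  next
    case (Suc n)
    have shift: "E (x, u + real n + t) = E (x, u + t)" for t
      using E_shift[OF x, of "u + t" "int n"] by (simp add: algebra_simps)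
    have h: "homotopic_paths S (E \<circ> ((\<lambda>t. (x, u + t * real n)) +++ (\<lambda>t. (x, u + real n + t))))
        (E \<circ> (\<lambda>t. (x, u + t * real (Suc n))))"
    proof (rule homotopic_paths_image_convex[OF _ C])
      show "convex ?C" by (intro convex_Times) auto
      let ?p = "\<lambda>t. (x, u + t * real n)" and ?q = "\<lambda>t. (x, u + real n + t)"
      have pq: "path_in ?C ?p (x, u) (x, u + real n)" "path_in ?C ?q (x, u + real n) (x, u + real n + 1)"
        by (auto simp: path_in_def path_def path_image_def pathstart_def pathfinish_def intro!: continuous_intros)
      show "path (?p +++ ?q)" "path_image (?p +++ ?q) \<subseteq> ?C"
        using path_in_join[OF pq] by (simp_all add: path_in_def)
      show "pathstart (\<lambda>t. (x, u + t * real (Suc n))) = pathstart (?p +++ ?q)"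
        "pathfinish (\<lambda>t. (x, u + t * real (Suc n))) = pathfinish (?p +++ ?q)"
        using path_in_join[OF pq] by (simp_all add: path_in_def pathstart_def pathfinish_def algebra_simps)
    qed (auto simp: path_def path_image_def intro!: continuous_intros)
    have "\<Phi> (\<lambda>t. E (x, u + t * real (Suc n))) =
        \<Phi> ((\<lambda>t. E (x, u + t * real n)) +++ (\<lambda>t. E (x, u + real n + t)))"
      using \<Phi>.homotopic[OF h, unfolded path_compose_join] unfolding o_def by (rule sym)
    also have "\<dots> = \<Phi> (\<lambda>t. E (x, u + t * real n)) \<otimes>\<^bsub>Q\<^esub> \<Phi> (\<lambda>t. E (x, u + t))"
      using \<Phi>.join[OF pth[of u "real n"] one[of "u + real n"]] shift by simp
    finally show ?case using Suc by simp
  qed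
qed

text \<open>On one side of the core the track is constant, on the other side it is a \<open>k\<close>-th power, and
  the order of \<open>Q\<close> divides \<open>k\<close>.\<close>

lemma rotation_track_trivial:
  assumes \<Phi>: "path_functor S Q \<Phi>" and Q: "finite (carrier Q)" "int (card (carrier Q)) dvd k"
    and y: "y \<in> S - core"
  shows "\<Phi> (\<lambda>t. rotate (t * of_int k) y) = \<one>\<^bsub>Q\<^esub>"
proof -
  interpret \<Phi>: path_functor S Q \<Phi> by fact
  show ?thesis
  proof (cases "y \<in> E ` strip")
    case False
    then show ?thesis using \<Phi>.const y by (simp add: rotate_off)
  next
    case True
    then obtain x u where w: "(x, u) \<in> strip" "y = E (x, u)" by (auto simp del: mem_Sigma_iff)
    have x: "x \<in> {lo<..<hi}" using w by auto
    have "x \<notin> {a..b}" using E_mem_closed_iff[of a b "(x, u)"] range y w by auto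
    then consider "ramp x = 0" | "ramp x = 1" using ramp_integer by blast
    then show ?thesis
    proof cases
      case 1
      then show ?thesis using \<Phi>.const y w rotate_E[OF w(1)] by simp
    next
      case 2
      have rot: "rotate s y = E (x, u + s)" for s using rotate_E[OF w(1)] w(2) 2 by simp
      obtain m where m: "int m = \<bar>k\<bar>" "card (carrier Q) dvd m"
        using Q(2) by (metis abs_ge_zero dvd_abs_iff nonneg_int_cases of_nat_dvd_iff)
      have loop: "\<Phi> (\<lambda>t. E (x, u + t * real m)) = \<one>\<^bsub>Q\<^esub>" for u
      proof -
        obtain j where "m = card (carrier Q) * j" using m(2) by blast
        moreover have "\<Phi> (\<lambda>t. E (x, u + t)) \<in> carrier Q" using \<Phi>.closed[OF full_turns(2)[OF \<Phi> x]] .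
        ultimately have "\<Phi> (\<lambda>t. E (x, u + t)) [^]\<^bsub>Q\<^esub> m = \<one>\<^bsub>Q\<^esub>"
          using \<Phi>.Q.pow_order_eq_1 Q(1) by (simp add: Coset.order_def flip: \<Phi>.Q.nat_pow_pow)
        then show ?thesis using full_turns(1)[OF \<Phi> x] by simp
      qed
      show ?thesis
      proof (cases "k \<ge> 0")
        case True
        then have "of_int k = real m" using m(1) by (metis abs_of_nonneg of_int_of_nat_eq)
        then show ?thesis using loop[of u] by (simp add: rot)
      next
        case False
        then have k: "of_int k = - real m" using m(1) by (metis abs_of_neg add.inverse_inverse linorder_not_le of_int_minus of_int_of_nat_eq)
        let ?p = "\<lambda>t. E (x, u + t * real m)"
        have "reversepath ?p = (\<lambda>t. rotate (t * of_int k) y)"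
        proof
          fix t
          have "reversepath ?p t = E (x, u - t * real m + of_int (int m))" by (simp add: reversepath_def algebra_simps)
          also have "\<dots> = E (x, u - t * real m)" by (rule E_shift[OF x])
          finally show "reversepath ?p t = rotate (t * of_int k) y" by (simp add: rot k)
        qed
        moreover have "path_in S ?p (E (x, u)) (E (x, u + real m))" by (rule path_in_vertical[OF x])
        ultimately show ?thesis using \<Phi>.reverse[of ?p] loop[of u] by simp
      qed
    qed
  qed
qed

lemma rotation_track:
  assumes "y \<in> S" shows "path_in S (\<lambda>t. rotate (t * of_int k) y) y (twist k y)"
proof (cases "y \<in> E ` strip")
  case True
  have "continuous_on {0..1} (\<lambda>t. (\<lambda>(s, y). rotate s y) (t * of_int k, y))"
    by (rule continuous_on_compose2[OF continuous_on_rotate[OF order_refl]]) (use True in \<open>auto intro!: continuous_intros\<close>)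
  then show ?thesis
    using rotate_mem[OF assms] by (auto simp: path_in_def path_def path_image_def pathstart_def pathfinish_def twist_def)
next
  case False
  then show ?thesis using path_in_const[OF assms] by (simp add: rotate_off twist_def)
qed

text \<open>Conjugating by the tracks of the rotation turns \<open>\<Phi> \<circ> twist k\<close> into another path functor \<open>\<Psi>\<close>,
  which agrees with \<open>\<Phi>\<close> on small paths: in the annulus the rotation is a homotopy from the
  identity to the twist, and off the core the twist is the identity while the tracks have
  trivial values. The conjugation is invisible for paths whose ends lie off the core.\<close>

lemma path_functor_twist:
  assumes \<Phi>: "path_functor S Q \<Phi>" and Q: "finite (carrier Q)" "int (card (carrier Q)) dvd k"
    and p: "path_in S p u v" and uv: "u \<notin> core" "v \<notin> core"
  shows "\<Phi> (twist k \<circ> p) = \<Phi> p"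
proof -
  interpret \<Phi>: path_functor S Q \<Phi> by fact
  define c where "c y = \<Phi> (\<lambda>t. rotate (t * of_int k) y)" for y
  have cQ: "c y \<in> carrier Q" if "y \<in> S" for y unfolding c_def by (rule \<Phi>.closed[OF rotation_track[OF that]])
  have tp: "path_in S (twist k \<circ> p) (twist k u) (twist k v)" if "path_in S p u v" for p u v
    using path_in_compose[OF that continuous_on_twist] twist_mem by blast
  \<comment> \<open>The tracks of the end points lead from the ends of \<open>p\<close> to the ends of its image.\<close>
  define \<Psi> where "\<Psi> p = c (pathstart p) \<otimes>\<^bsub>Q\<^esub> \<Phi> (twist k \<circ> p) \<otimes>\<^bsub>Q\<^esub> inv\<^bsub>Q\<^esub> c (pathfinish p)" for p
  have \<Psi>: "path_functor S Q \<Psi>"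
  proof unfold_locales
    show "\<Psi> p \<in> carrier Q" if "path_in S p u v" for p u v
      using \<Phi>.closed[OF tp[OF that]] path_in_mem[OF that] cQ that by (auto simp: \<Psi>_def path_in_def)
    show "\<Psi> p = \<Psi> q" if h: "homotopic_paths S p q" for p q
    proof -
      have "homotopic_paths S (twist k \<circ> p) (twist k \<circ> q)"
        using homotopic_paths_continuous_image[OF h continuous_on_twist] twist_mem by blast
      then show ?thesis
        using \<Phi>.homotopic homotopic_paths_imp_pathstart[OF h] homotopic_paths_imp_pathfinish[OF h]
        by (simp add: \<Psi>_def)
    qed
    show "\<Psi> (p +++ q) = \<Psi> p \<otimes>\<^bsub>Q\<^esub> \<Psi> q" if pq: "path_in S p u v" "path_in S q v w" for p q u v w
    proof -
      have ends: "pathstart p = u" "pathfinish p = v" "pathstart q = v" "pathfinish q = w"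
        using pq by (auto simp: path_in_def)
      have m: "c u \<in> carrier Q" "c v \<in> carrier Q" "c w \<in> carrier Q" "\<Phi> (twist k \<circ> p) \<in> carrier Q" "\<Phi> (twist k \<circ> q) \<in> carrier Q"
        using cQ path_in_mem[OF pq(1)] path_in_mem[OF pq(2)] \<Phi>.closed[OF tp[OF pq(1)]] \<Phi>.closed[OF tp[OF pq(2)]] by auto
      have c: "inv\<^bsub>Q\<^esub> c v \<otimes>\<^bsub>Q\<^esub> (c v \<otimes>\<^bsub>Q\<^esub> z) = z" if "z \<in> carrier Q" for z
        using m(2) that by (simp flip: \<Phi>.Q.m_assoc)
      show ?thesis
        using \<Phi>.join[OF tp[OF pq(1)] tp[OF pq(2)]] m c by (simp add: \<Psi>_def ends path_compose_join \<Phi>.Q.m_assoc)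
    qed
  qed
  have "\<Phi> p = \<Psi> p"
  proof (rule path_functor_unique[OF \<Phi> \<Psi> _ p])
    fix y assume y: "y \<in> S"
    show "\<exists>V. openin (top_of_set S) V \<and> y \<in> V \<and> (\<forall>p u v. path_in V p u v \<longrightarrow> \<Phi> p = \<Psi> p)"
    proof (cases "y \<in> core")
      case False
      have "\<Phi> p = \<Psi> p" if p: "path_in (S - core) p u v" for p u v
      proof -
        have pS: "path_in S p u v" using p by (rule path_in_subset) auto
        have "homotopic_paths S p (twist k \<circ> p)"
        proof (rule homotopic_paths_eq)
          fix t :: real assume "t \<in> {0..1}"
          then have "p t \<in> path_image p" by (simp add: path_image_def)
          then have "p t \<notin> core" using p unfolding path_in_def by blast
          then show "p t = (twist k \<circ> p) t" by (simp add: twist_fix)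
        qed (use pS in \<open>auto simp: path_in_def\<close>)
        moreover have "c u = \<one>\<^bsub>Q\<^esub>" "c v = \<one>\<^bsub>Q\<^esub>"
          unfolding c_def using rotation_track_trivial[OF \<Phi> Q] path_in_mem[OF p] by auto
        ultimately show ?thesis
          using \<Phi>.homotopic \<Phi>.closed[OF pS] \<Phi>.closed[OF tp[OF pS]] pS by (simp add: \<Psi>_def path_in_def)
      qed
      then show ?thesis using open_off_core False y by blast
    next
      case True
      have "\<Phi> p = \<Psi> p" if p: "path_in (E ` strip) p u v" for p u v
      proof -
        have pS: "path_in S p u v" using p annulus_subset by (rule path_in_subset)
        let ?C = "{0..1::real} \<times> {0..1::real}"
        let ?h = "\<lambda>(s, t). rotate (s * of_int k) (p t)"
        have pt: "p t \<in> E ` strip" if "t \<in> {0..1}" for t using p that by (auto simp: path_in_def path_image_def)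
        have cp: "continuous_on {0..1} p" using p by (simp add: path_in_def path_def)
        have "continuous_on ?C (\<lambda>z. (\<lambda>(s, y). rotate s y) (fst z * of_int k, p (snd z)))"
          by (rule continuous_on_compose2[OF continuous_on_rotate[OF order_refl]])
             (use pt in \<open>auto intro!: continuous_intros continuous_on_compose2[OF cp]\<close>)
        then have ch: "continuous_on ?C ?h" by (simp add: case_prod_unfold)
        have "p t \<in> S" if "t \<in> {0..1}" for t using pt[OF that] annulus_subset by blast
        then have hS: "?h \<in> ?C \<rightarrow> S" using rotate_mem by auto
        have "(\<lambda>t. ?h (0, t)) = p" "(\<lambda>s. ?h (s, 1)) = (\<lambda>t. rotate (t * of_int k) v)"
            "(\<lambda>s. ?h (s, 0)) = (\<lambda>t. rotate (t * of_int k) u)" "(\<lambda>t. ?h (1, t)) = twist k \<circ> p"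
          using p by (auto simp: fun_eq_iff twist_def path_in_def pathstart_def pathfinish_def)
        with homotopic_paths_square[OF ch hS]
        have h: "homotopic_paths S (p +++ (\<lambda>t. rotate (t * of_int k) v)) ((\<lambda>t. rotate (t * of_int k) u) +++ (twist k \<circ> p))"
          by (simp only:)
        have uvS: "u \<in> S" "v \<in> S" using path_in_mem[OF pS] by simp_all
        have eq: "\<Phi> p \<otimes>\<^bsub>Q\<^esub> c v = c u \<otimes>\<^bsub>Q\<^esub> \<Phi> (twist k \<circ> p)"
          using \<Phi>.homotopic[OF h] \<Phi>.join[OF pS rotation_track[OF uvS(2)], of k]
            \<Phi>.join[OF rotation_track[OF uvS(1)] tp[OF pS]]
          unfolding c_def by metis
        have m: "c u \<in> carrier Q" "c v \<in> carrier Q" "\<Phi> p \<in> carrier Q" using cQ path_in_mem[OF pS] \<Phi>.closed[OF pS] by auto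
        have "\<Psi> p = c u \<otimes>\<^bsub>Q\<^esub> \<Phi> (twist k \<circ> p) \<otimes>\<^bsub>Q\<^esub> inv\<^bsub>Q\<^esub> c v" using p by (simp add: \<Psi>_def path_in_def)
        also have "\<dots> = \<Phi> p \<otimes>\<^bsub>Q\<^esub> c v \<otimes>\<^bsub>Q\<^esub> inv\<^bsub>Q\<^esub> c v" unfolding eq ..
        also have "\<dots> = \<Phi> p" using m by (simp add: \<Phi>.Q.m_assoc)
        finally show ?thesis by (rule sym)
      qed
      moreover have "y \<in> E ` strip" using True core_subset by (rule rev_subsetD)
      ultimately show ?thesis using open_annulus by (intro exI[of _ "E ` strip"] conjI allI impI)
    qed
  qed
  moreover have "c u = \<one>\<^bsub>Q\<^esub>" "c v = \<one>\<^bsub>Q\<^esub>"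
    unfolding c_def using rotation_track_trivial[OF \<Phi> Q] path_in_mem[OF p] uv by auto
  ultimately show ?thesis
    using p \<Phi>.closed[OF tp[OF p]] by (simp add: \<Psi>_def path_in_def)
qed

subsection \<open>The action of twists on winding\<close>

text \<open>The Pontryagin-Thom collapse: the annulus is mapped across to the circle, and everything
  else goes to the point \<open>1\<close>. The winding along this map counts the signed crossings with
  the annulus.\<close>

definition collapse :: "'a \<Rightarrow> complex" where
  "collapse y = (if y \<in> E ` strip then cis (2 * pi * ramp (fst (coord y))) else 1)"

lemma collapse_E: "w \<in> strip \<Longrightarrow> collapse (E w) = cis (2 * pi * ramp (fst w))"
  by (rule coord_E[of w]) (auto simp: collapse_def)

lemma norm_collapse: "cmod (collapse y) = 1"
  by (simp add: collapse_def)

lemma collapse_off: "y \<notin> core \<Longrightarrow> collapse y = 1"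
proof (cases "y \<in> E ` strip")
  case True
  assume y: "y \<notin> core"
  obtain w where w: "w \<in> strip" "y = E w" using True by blast
  then have "ramp (fst w) \<in> {0, 1}" using E_mem_closed_iff[of a b w] range y ramp_integer by auto
  then show ?thesis using collapse_E[OF w(1)] w(2) by auto
qed (simp add: collapse_def)

lemma continuous_on_collapse: "continuous_on S collapse"
proof (rule continuous_on_glue[of a b])
  have "continuous_on strip (\<lambda>w. cis (2 * pi * ramp (fst w)))"
    by (intro continuous_on_compose2[OF continuous_on_cis] continuous_intros continuous_on_compose2[OF continuous_ramp]) auto
  then show "continuous_on strip (\<lambda>w. collapse (E w))"
    by (rule continuous_on_eq) (simp add: collapse_E)
  show "continuous_on (S - core) collapse"
    by (rule continuous_on_eq[OF continuous_on_const[of _ 1]]) (simp add: collapse_off)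
qed (use range in auto)

lemma collapse_twist: "collapse (twist k y) = collapse y"
proof (cases "y \<in> E ` strip")
  case True
  then obtain w where w: "w \<in> strip" "y = E w" by blast
  have "(fst w, snd w + of_int k * ramp (fst w)) \<in> strip" using w(1) by auto
  then show ?thesis using w rotate_E[OF w(1)] by (simp add: twist_def collapse_E)
qed (simp add: twist_def rotate_off)

text \<open>Lift \<open>e\<close> to a real function \<open>\<beta>\<close> on the strip. A full turn increases \<open>\<beta>\<close> by \<open>\<epsilon>\<close>, and the
  shear of the twist makes \<open>k \<cdot> ramp\<close> turns, which would increase \<open>\<beta>\<close> by \<open>k \<epsilon> \<cdot> ramp\<close> if \<open>\<beta>\<close>
  were linear. The deviation \<open>\<rho>\<close> from this is invariant under the translation and vanishes
  off the core, so it is a continuous real function \<open>r\<close> on the whole of \<open>S\<close> and does not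
  contribute to the winding of a loop.\<close>

lemma winding_twist:
  assumes e: "continuous_on S e" "\<And>y. y \<in> S \<Longrightarrow> cmod (e y) = 1"
    and \<epsilon>: "x \<in> {lo<..<hi}" "winding e (\<lambda>t. E (x, t)) = of_int \<epsilon>"
    and p: "path_in S p u u"
  shows "winding e (twist k \<circ> p) = winding e p + of_int (k * \<epsilon>) * winding collapse p"
proof -
  have cs: "convex strip" by (intro convex_Times) auto
  have "continuous_on strip (\<lambda>w. e (E w))"
    by (rule continuous_on_compose2[OF e(1) E_cont]) (use E_mem in auto)
  then obtain \<beta> where \<beta>: "continuous_on strip \<beta>" "\<And>w. w \<in> strip \<Longrightarrow> e (E w) = cis (2 * pi * \<beta> w)"
    by (rule circle_valued_lift[OF cs]) (use e(2) E_mem in auto)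
  have periodic1: "\<beta> (y, s + 1) = \<beta> (y, s) + of_int \<epsilon>" if y: "y \<in> {lo<..<hi}" for y s
  proof -
    let ?f = "\<lambda>w. \<beta> (fst w, snd w + 1) - \<beta> w"
    have "?f (y, s) = ?f (x, 0)"
    proof (rule integer_valued_constant[of strip ?f])
      show "connected strip" by (rule convex_connected[OF cs])
      show "continuous_on strip ?f"
        by (intro continuous_intros continuous_on_compose2[OF \<beta>(1)]) auto
      show "?f w \<in> \<int>" if w: "w \<in> strip" for w
      proof -
        have w': "(fst w, snd w + 1) \<in> strip" using w by auto
        have "E (fst w, snd w + 1) = E w" using E_eq[OF w' w] by simp
        then show ?thesis using \<beta>(2)[OF w] \<beta>(2)[OF w'] cis_2pi_eq_iff by metis
      qed
    qed (use y \<epsilon>(1) in auto)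
    moreover have "circle_lift e (\<lambda>t. E (x, t)) (\<lambda>t. \<beta> (x, t))"
      unfolding circle_lift_def using \<epsilon>(1)
      by (auto intro!: \<beta>(2) continuous_on_compose2[OF \<beta>(1)] continuous_intros)
    ultimately show ?thesis using winding_eq[of e "\<lambda>t. E (x, t)"] \<epsilon>(2) by fastforce
  qed
  have nat: "\<beta> (y, s + real n) = \<beta> (y, s) + real n * of_int \<epsilon>" if y: "y \<in> {lo<..<hi}" for y s n
  proof (induction n)
    case (Suc n)
    then show ?case using periodic1[OF y, of "s + real n"] by (simp add: algebra_simps)
  qed simp
  have periodic: "\<beta> (y, s + of_int n) = \<beta> (y, s) + of_int n * of_int \<epsilon>" if y: "y \<in> {lo<..<hi}" for y s n
  proof (cases n)
    case (nonneg m)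
    then show ?thesis using nat[OF y, of s m] by simp
  next
    case (neg m)
    then have n: "real_of_int n = - real (Suc m)" by simp
    then have e: "s + of_int n + real (Suc m) = s" by simp
    have "\<beta> (y, s) = \<beta> (y, s + of_int n) + real (Suc m) * of_int \<epsilon>"
      using nat[OF y, of "s + of_int n" "Suc m"] unfolding e .
    then show ?thesis unfolding n by (simp add: algebra_simps)
  qed
  define \<rho> where "\<rho> w = \<beta> (fst w, snd w + of_int k * ramp (fst w)) - \<beta> w - of_int (k * \<epsilon>) * ramp (fst w)" for w
  have \<rho>_shift: "\<rho> (y, s + of_int n) = \<rho> (y, s)" if y: "y \<in> {lo<..<hi}" for y s n
    using periodic[OF y, of s n] periodic[OF y, of "s + of_int k * ramp y" n] by (simp add: \<rho>_def algebra_simps)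
  have \<rho>_off: "\<rho> w = 0" if w: "w \<in> strip" "fst w \<notin> {a..b}" for w
  proof -
    have "fst w \<in> {lo<..<hi}" using w(1) by auto
    then show ?thesis using ramp_integer[OF w(2)] periodic[of "fst w" "snd w" k] by (auto simp: \<rho>_def)
  qed
  define r where "r y = (if y \<in> E ` strip then \<rho> (coord y) else 0)" for y
  have r_E: "r (E w) = \<rho> w" if w: "w \<in> strip" for w
  proof -
    obtain n where n: "coord (E w) = (fst w, snd w + of_int n)" using coord_E[OF w] .
    have "fst w \<in> {lo<..<hi}" using w by auto
    then show ?thesis using \<rho>_shift[of "fst w" "snd w" n] w by (simp add: r_def n)
  qed
  have r_off: "r y = 0" if "y \<notin> core" for y
  proof (cases "y \<in> E ` strip")
    case True
    then obtain w where w: "w \<in> strip" "y = E w" by blast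
    then have "fst w \<notin> {a..b}" using E_mem_closed_iff[of a b w] range that by auto
    then show ?thesis using r_E \<rho>_off w by simp
  qed (simp add: r_def)
  have rc: "continuous_on S r"
  proof (rule continuous_on_glue[of a b])
    have "continuous_on strip \<rho>"
      unfolding \<rho>_def
      by (intro continuous_intros continuous_on_compose2[OF \<beta>(1)] continuous_on_compose2[OF continuous_ramp]) auto
    then show "continuous_on strip (\<lambda>w. r (E w))" by (rule continuous_on_eq) (simp add: r_E)
    show "continuous_on (S - core) r"
      by (rule continuous_on_eq[OF continuous_on_const[of _ 0]]) (simp add: r_off)
  qed (use range in auto)
  have "e (twist k y) = e y * collapse y powi (k * \<epsilon>) * cis (2 * pi * r y)" for y
  proof (cases "y \<in> E ` strip")
    case True
    then obtain w where w: "w \<in> strip" "y = E w" by blast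
    have w': "(fst w, snd w + of_int k * ramp (fst w)) \<in> strip" using w(1) by auto
    have "e (twist k y) = cis (2 * pi * \<beta> (fst w, snd w + of_int k * ramp (fst w)))"
      using rotate_E[OF w(1)] w(2) \<beta>(2)[OF w'] by (simp add: twist_def)
    also have "\<beta> (fst w, snd w + of_int k * ramp (fst w)) = \<beta> w + of_int (k * \<epsilon>) * ramp (fst w) + \<rho> w"
      by (simp add: \<rho>_def)
    also have "cis (2 * pi * \<dots>) = cis (2 * pi * \<beta> w) * cis (2 * pi * ramp (fst w)) powi (k * \<epsilon>) * cis (2 * pi * \<rho> w)"
      by (simp add: cis_power_int cis_mult algebra_simps)
    finally show ?thesis using w \<beta>(2)[OF w(1)] by (simp add: collapse_E r_E)
  next
    case False
    then show ?thesis by (simp add: twist_def rotate_off collapse_def r_def)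
  qed
  from winding_compose_twisted[OF e continuous_on_collapse norm_collapse rc this p]
  show ?thesis by simp
qed

end

section \<open>Twists preserve orientations\<close>

text \<open>By excision a homology class at \<open>y\<close> comes from a neighbourhood on which \<open>f\<close> is the identity.\<close>

lemma hom_induced_id_locally:
  fixes S :: "'a::topological_space set"
  assumes closed: "openin (top_of_set S) (S - {y})"
    and V: "openin (top_of_set S) V" "y \<in> V" "\<And>z. z \<in> V \<Longrightarrow> f z = z"
    and f: "continuous_on S f" "f \<in> S \<rightarrow> S" "f \<in> S - {y} \<rightarrow> S - {y}"
    and c: "c \<in> carrier (relative_homology_group p (top_of_set S) (S - {y}))"
  shows "hom_induced p (top_of_set S) (S - {y}) (top_of_set S) (S - {y}) f c = c"
proof -
  let ?X = "top_of_set S"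
  have VS: "V \<subseteq> S" using V(1) openin_imp_subset by blast
  have "?X closure_of (S - V) = S - V"
    using V(1) VS by (intro closure_of_closedin) (simp add: closedin_def double_diff Diff_Diff_Int Int_absorb1)
  moreover have "?X interior_of (S - {y}) = S - {y}"
    by (rule interior_of_openin[OF closed])
  ultimately have "?X closure_of (S - V) \<subseteq> ?X interior_of (S - {y})" using V(2) by auto
  from homology_excision_axiom[OF this, of S p]
  have iso: "hom_induced p (subtopology ?X (S - (S - V))) (S - {y} - (S - V)) (subtopology ?X S) (S - {y}) id
    \<in> iso (relative_homology_group p (subtopology ?X (S - (S - V))) (S - {y} - (S - V)))
          (relative_homology_group p (subtopology ?X S) (S - {y}))" by auto
  let ?Y = "top_of_set V"
  have Y: "subtopology ?X (S - (S - V)) = ?Y" "subtopology ?X S = ?X" "S - {y} - (S - V) = V - {y}"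
    using VS by (auto simp: subtopology_subtopology double_diff Int_absorb1)
  have "hom_induced p ?Y (V - {y}) ?X (S - {y}) id \<in> iso (relative_homology_group p ?Y (V - {y}))
      (relative_homology_group p ?X (S - {y}))" using iso unfolding Y .
  then have "c \<in> hom_induced p ?Y (V - {y}) ?X (S - {y}) id ` carrier (relative_homology_group p ?Y (V - {y}))"
    using c by (simp add: iso_def bij_betw_def)
  then obtain d where d: "d \<in> carrier (relative_homology_group p ?Y (V - {y}))"
      "hom_induced p ?Y (V - {y}) ?X (S - {y}) id d = c"
    by (elim imageE) (rule that, simp_all)
  have ct: "continuous_map ?Y ?X id" "continuous_map ?X ?X f"
    using VS f by auto
  have "hom_induced p ?X (S - {y}) ?X (S - {y}) f c = hom_induced p ?Y (V - {y}) ?X (S - {y}) (f \<circ> id) d"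
    unfolding d(2)[symmetric]
    by (rule hom_induced_compose'[OF ct(1) _ ct(2) f(3)]) (use VS in auto)
  also have "\<dots> = hom_induced p ?Y (V - {y}) ?X (S - {y}) id d"
    by (subst hom_induced_eq[of ?Y "f \<circ> id" id]) (use V(3) in auto)
  finally show ?thesis using d(2) by simp
qed

text \<open>Functoriality, in the form in which it is used for local orientations: passing to a smaller
  set of points commutes with maps.\<close>

lemma hom_induced_restrict_commute:
  fixes S :: "'a::topological_space set"
  assumes f: "continuous_on S f" "f \<in> S \<rightarrow> S" and A: "f \<in> A \<rightarrow> A'" and B: "f \<in> B \<rightarrow> B'"
    and AB: "A \<subseteq> B" "A' \<subseteq> B'"
  shows "hom_induced p (top_of_set S) B (top_of_set S) B' f (hom_induced p (top_of_set S) A (top_of_set S) B id c)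
       = hom_induced p (top_of_set S) A' (top_of_set S) B' id (hom_induced p (top_of_set S) A (top_of_set S) A' f c)"
proof -
  have ct: "continuous_map (top_of_set S) (top_of_set S) f" "continuous_map (top_of_set S) (top_of_set S) id"
    using f by auto
  have i: "id \<in> A \<rightarrow> B" "id \<in> A' \<rightarrow> B'" using AB by auto
  show ?thesis
    unfolding hom_induced_compose'[OF ct(2) i(1) ct(1) B] hom_induced_compose'[OF ct(1) A ct(2) i(2)] by simp
qed

locale annulus_T1 = annulus S E lo a b hi for S :: "'a::topological_space set" and E lo a b hi +
  assumes points_closed: "y \<in> S \<Longrightarrow> openin (top_of_set S) (S - {y})"
begin

text \<open>A point of a small disc in the annulus is slid to another one by an isotopy that is
  supported in the disc. The isotopy is written in the strip; its speed depends on the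
  distance to all the translates of the centre, which makes it commute with the unit
  translation.\<close>

definition translates :: "real \<times> real \<Rightarrow> (real \<times> real) set" where
  "translates w = range (\<lambda>n::int. (fst w, snd w + of_int n))"

definition bump :: "real \<times> real \<Rightarrow> real \<Rightarrow> real \<times> real \<Rightarrow> real" where
  "bump w1 \<rho> w = max 0 (\<rho> - infdist w (translates w1))"

definition push :: "real \<times> real \<Rightarrow> real \<Rightarrow> real \<times> real \<Rightarrow> real \<Rightarrow> real \<times> real \<Rightarrow> real \<times> real" where
  "push w1 \<rho> v t w = w + (t * bump w1 \<rho> w) *\<^sub>R v"

lemma translates_ne: "translates w \<noteq> {}" by (simp add: translates_def)

lemma infdist_translates_shift: "infdist (fst w, snd w + of_int n) (translates w1) = infdist w (translates w1)"
proof -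
  have le: "infdist (fst w, snd w + of_int n) (translates w1) \<le> infdist w (translates w1)" for w n
  proof -
    have "infdist w (translates w1) = (INF z\<in>translates w1. dist w z)"
      by (simp add: infdist_notempty translates_ne)
    moreover have "infdist (fst w, snd w + of_int n) (translates w1) \<le> dist w z" if z: "z \<in> translates w1" for z
    proof -
      obtain m :: int where m: "z = (fst w1, snd w1 + of_int m)" using z by (auto simp: translates_def)
      have "(fst w1, snd w1 + of_int (m + n)) \<in> translates w1"
        unfolding translates_def by (rule rangeI)
      then have "infdist (fst w, snd w + of_int n) (translates w1) \<le>
          dist (fst w, snd w + of_int n) (fst w1, snd w1 + of_int (m + n))" by (rule infdist_le)
      also have "\<dots> = dist w z"
      proof -
        have "snd w + of_int n - (snd w1 + of_int (m + n)) = snd w - (snd w1 + of_int m)" by simp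
        then show ?thesis unfolding m by (simp only: dist_prod_def dist_real_def fst_conv snd_conv)
      qed
      finally show ?thesis .
    qed
    ultimately show ?thesis by (simp add: cINF_greatest translates_ne)
  qed
  show ?thesis using le[of w n] le[of "(fst w, snd w + of_int n)" "- n"] by simp
qed

lemma infdist_translates_less:
  assumes "infdist w (translates w1) < \<rho>"
  obtains n :: int where "dist w (fst w1, snd w1 + of_int n) < \<rho>"
proof -
  have "(INF z\<in>translates w1. dist w z) < \<rho>"
    using assms by (simp add: infdist_notempty translates_ne)
  then obtain z where "z \<in> translates w1" "dist w z < \<rho>"
    using cInf_lessD[of "dist w ` translates w1" \<rho>] translates_ne by auto
  then show ?thesis using that by (auto simp: translates_def)
qed

lemma infdist_translates_self: "infdist w (translates w) = 0"
  by (rule infdist_zero) (auto simp: translates_def intro: range_eqI[of _ _ 0])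

lemma bump_Lipschitz: "\<bar>bump w1 \<rho> w - bump w1 \<rho> w'\<bar> \<le> dist w w'"
  using infdist_triangle_abs[of w "translates w1" w'] by (auto simp: bump_def max_def)

lemma push_shift: "push w1 \<rho> v t (fst w, snd w + of_int n) = (fst (push w1 \<rho> v t w), snd (push w1 \<rho> v t w) + of_int n)"
  by (simp add: push_def bump_def infdist_translates_shift prod_eq_iff)

lemma push_support: "infdist w (translates w1) \<ge> \<rho> \<Longrightarrow> push w1 \<rho> v t w = w"
  by (simp add: push_def bump_def)

text \<open>The bump is 1-Lipschitz and \<open>v\<close> is shorter than \<open>1\<close>, so the displacement is a strict
  contraction and cannot move two points to the same place.\<close>

lemma inj_push:
  assumes "norm v < 1" "push w1 \<rho> v 1 w = push w1 \<rho> v 1 w'" shows "w = w'"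
proof (rule ccontr)
  assume ne: "w \<noteq> w'"
  have "w - w' = (bump w1 \<rho> w' - bump w1 \<rho> w) *\<^sub>R v" using assms(2) by (simp add: push_def algebra_simps)
  then have "norm (w - w') = \<bar>bump w1 \<rho> w' - bump w1 \<rho> w\<bar> * norm v" by (metis norm_scaleR)
  also have "\<dots> \<le> dist w' w * norm v" by (intro mult_right_mono bump_Lipschitz) auto
  also have "\<dots> < dist w' w * 1" using ne assms(1) by (intro mult_strict_left_mono) auto
  finally show False by (simp add: dist_norm norm_minus_commute)
qed

lemma push_stays:
  assumes "norm v < 1" "t \<in> {0..1}" "infdist w (translates w1) < \<rho>"
  shows "infdist (push w1 \<rho> v t w) (translates w1) < \<rho>"
proof -
  let ?d = "infdist w (translates w1)"
  have "infdist (push w1 \<rho> v t w) (translates w1) \<le> ?d + dist (push w1 \<rho> v t w) w"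
    by (rule infdist_triangle)
  also have "dist (push w1 \<rho> v t w) w = (t * (\<rho> - ?d)) * norm v"
    using assms by (simp add: push_def bump_def dist_norm max_def)
  also have "?d + (t * (\<rho> - ?d)) * norm v < ?d + (\<rho> - ?d)"
  proof -
    have "(t * (\<rho> - ?d)) * norm v \<le> (1 * (\<rho> - ?d)) * norm v"
      using assms by (intro mult_right_mono) auto
    also have "\<dots> < (\<rho> - ?d) * 1" using assms by (simp del: mult_1_right)
    finally show ?thesis by simp
  qed
  finally show ?thesis by simp
qed

text \<open>Let \<open>\<tau>\<close> slide \<open>E w1\<close> to \<open>E w2\<close> inside \<open>V\<close>. It is isotopic to the identity by maps that are
  the identity off \<open>V\<close>, so it acts trivially on the classes over \<open>V\<close>, and it carries their
  restrictions at \<open>E w1\<close> to their restrictions at \<open>E w2\<close>.\<close>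

lemma push_class:
  assumes V: "cball w1 \<rho> \<subseteq> strip" "E ` ball w1 \<rho> \<subseteq> V"
    and w2: "w2 \<in> ball w1 \<rho>"
    and c: "c \<in> carrier (relative_homology_group p (top_of_set S) (S - V))"
      "c' \<in> carrier (relative_homology_group p (top_of_set S) (S - V))"
    and eq: "hom_induced p (top_of_set S) (S - V) (top_of_set S) (S - {E w1}) id c =
       hom_induced p (top_of_set S) (S - V) (top_of_set S) (S - {E w1}) id c'"
  shows "hom_induced p (top_of_set S) (S - V) (top_of_set S) (S - {E w2}) id c =
     hom_induced p (top_of_set S) (S - V) (top_of_set S) (S - {E w2}) id c'"
proof -
  have \<rho>: "\<rho> > 0" using w2 zero_le_dist[of w1 w2] unfolding mem_ball by linarith
  define v where "v = (1 / \<rho>) *\<^sub>R (w2 - w1)"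
  have v: "norm v < 1" using w2 \<rho> by (simp add: v_def dist_norm norm_minus_commute[of w2 w1])
  let ?F = "push w1 \<rho> v"
  have F1: "?F 1 w1 = w2" using \<rho> by (simp add: push_def bump_def infdist_translates_self v_def)
  have near: "w \<in> strip \<and> E w \<in> V \<and> fst w \<in> {fst w1 - \<rho>..fst w1 + \<rho>}"
    if less: "infdist w (translates w1) < \<rho>" for w
  proof -
    obtain n :: int where n: "dist w (fst w1, snd w1 + of_int n) < \<rho>" using infdist_translates_less[OF less] .
    have "dist w (fst w1, snd w1 + of_int n) = dist w1 (fst w, snd w - of_int n)"
    proof -
      have "snd w - (snd w1 + of_int n) = - (snd w1 - (snd w - of_int n))" by simp
      then show ?thesis unfolding dist_prod_def dist_real_def
        by (simp only: fst_conv snd_conv abs_minus_cancel abs_minus_commute[of "fst w"])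
    qed
    then have b: "(fst w, snd w - of_int n) \<in> ball w1 \<rho>" using n by simp
    then have s: "(fst w, snd w - of_int n) \<in> strip" using V(1) ball_subset_cball by blast
    then have x: "fst w \<in> {lo<..<hi}" by auto
    have "E w = E (fst w, snd w - of_int n)"
      using E_shift[OF x, of "snd w - of_int n" n] by simp
    then have "E w \<in> V" using b V(2) by auto
    moreover have "dist w1 (fst w, snd w - of_int n) \<ge> \<bar>fst w1 - fst w\<bar>"
      using dist_fst_le[of w1 "(fst w, snd w - of_int n)"] by (simp add: dist_real_def)
    ultimately show ?thesis using x b by (auto simp: mem_Times_iff)
  qed
  have equiv: "equivariant (?F t)" if t: "t \<in> {0..1}" for t
    unfolding equivariant_def
  proof (intro ballI conjI allI push_shift)
    fix w assume w: "w \<in> strip"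
    show "?F t w \<in> strip"
    proof (cases "infdist w (translates w1) < \<rho>")
      case True
      then show ?thesis using near[OF push_stays[OF v t]] by blast
    next
      case False
      then show ?thesis using push_support w by simp
    qed
  qed
  have cd: "lo < fst w1 - \<rho>" "fst w1 + \<rho> < hi"
  proof -
    have "(fst w1 - \<rho>, snd w1) \<in> cball w1 \<rho>" "(fst w1 + \<rho>, snd w1) \<in> cball w1 \<rho>"
      using \<rho> by (simp_all add: dist_prod_def dist_real_def)
    then have "(fst w1 - \<rho>, snd w1) \<in> strip" "(fst w1 + \<rho>, snd w1) \<in> strip" using V(1) by blast+
    then show "lo < fst w1 - \<rho>" "fst w1 + \<rho> < hi" by auto
  qed
  have cont: "continuous_on ({0..1} \<times> S) (\<lambda>(t, y). carry (?F t) y)"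
  proof (rule continuous_on_carry_param[OF cd])
    have "continuous_on ({0..1::real} \<times> strip) (\<lambda>z. snd z + (fst z * max 0 (\<rho> - infdist (snd z) (translates w1))) *\<^sub>R v)"
      by (intro continuous_intros)
    then show "continuous_on ({0..1} \<times> strip) (\<lambda>(t, w). ?F t w)"
      by (simp add: case_prod_unfold push_def bump_def)
    fix t and w :: "real \<times> real" assume "fst w \<notin> {fst w1 - \<rho>..fst w1 + \<rho>}"
    then have "\<not> infdist w (translates w1) < \<rho>" using near by blast
    then show "E (?F t w) = E w" by (simp add: push_support)
  qed (rule equiv)
  let ?X = "top_of_set S"
  define \<tau> where "\<tau> = carry (?F 1)"
  have e1: "equivariant (?F 1)" by (rule equiv) simp
  have fix_off: "carry (?F t) y = y" if t: "t \<in> {0..1}" and y: "y \<notin> V" for t y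
  proof (cases "y \<in> E ` strip")
    case True
    have c: "coord y \<in> strip" "E (coord y) = y" using coord[OF True] by simp_all
    then have "\<not> infdist (coord y) (translates w1) < \<rho>" using near y by metis
    then have "?F t (coord y) = coord y" by (simp add: push_support)
    then show ?thesis using carry_E[OF equiv[OF t] c(1)] c(2) by simp
  qed (rule carry_off)
  have "homotopic_with (\<lambda>h. h \<in> S - V \<rightarrow> S - V) ?X ?X id \<tau>"
    unfolding homotopic_with_def
  proof (intro exI[of _ "\<lambda>(t, y). carry (?F t) y"] conjI allI ballI)
    show "continuous_map (prod_topology (top_of_set {0..1}) ?X) ?X (\<lambda>(t, y). carry (?F t) y)"
      using cont carry_mem[OF equiv] by (auto simp: prod_topology_subtopology_eu continuous_map_subtopology_eu)
    show "(case (0, y) of (t, y) \<Rightarrow> carry (?F t) y) = id y" for y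
      using coord[of y] by (simp add: carry_def push_def)
    show "(case (1, y) of (t, y) \<Rightarrow> carry (?F t) y) = \<tau> y" for y by (simp add: \<tau>_def)
    show "(\<lambda>y. case (t, y) of (t, y) \<Rightarrow> carry (?F t) y) \<in> S - V \<rightarrow> S - V" if "t \<in> {0..1}" for t
      using fix_off[OF that] by simp
  qed
  from homology_homotopy_axiom[OF this]
  have id: "hom_induced p ?X (S - V) ?X (S - V) \<tau> d = d" if "d \<in> carrier (relative_homology_group p ?X (S - V))" for d
    using hom_induced_id[OF that] by metis
  have \<tau>c: "continuous_on S \<tau>" "\<tau> \<in> S \<rightarrow> S"
  proof -
    have "continuous_on S ((\<lambda>(t, y). carry (?F t) y) \<circ> Pair (1::real))"
      by (intro continuous_on_compose continuous_on_subset[OF cont] continuous_intros) auto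
    then show "continuous_on S \<tau>" by (simp add: o_def \<tau>_def)
    show "\<tau> \<in> S \<rightarrow> S" using carry_mem[OF e1] by (auto simp: \<tau>_def)
  qed
  have w12: "w1 \<in> strip" "w2 \<in> strip" "E w1 \<in> V" "E w2 \<in> V"
  proof -
    have b: "w1 \<in> ball w1 \<rho>" using \<rho> by simp
    have s: "ball w1 \<rho> \<subseteq> strip" using V(1) ball_subset_cball by blast
    show "w1 \<in> strip" "w2 \<in> strip" using s b w2 by blast+
    show "E w1 \<in> V" "E w2 \<in> V" using V(2) b w2 by blast+
  qed
  have \<tau>V: "\<tau> \<in> S - V \<rightarrow> S - V" using fix_off[of 1] by (simp add: \<tau>_def)
  have "\<tau> \<in> S - {E w1} \<rightarrow> S - {E w2}"
  proof
    fix y assume y: "y \<in> S - {E w1}"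
    have "\<tau> y \<noteq> E w2"
    proof
      assume t: "\<tau> y = E w2"
      show False
      proof (cases "y \<in> E ` strip")
        case True
        have c: "coord y \<in> strip" "E (coord y) = y" using coord[OF True] by simp_all
        have "E (?F 1 (coord y)) = E w2" using carry_E[OF e1 c(1)] c(2) t by (simp add: \<tau>_def)
        then have "fst (?F 1 (coord y)) = fst w2 \<and> snd (?F 1 (coord y)) - snd w2 \<in> \<int>"
          using E_eq[OF equivariant_mem[OF e1 c(1)] w12(2)] by simp
        then obtain n :: int where "?F 1 (coord y) = (fst w2, snd w2 + of_int n)"
          by (auto simp: prod_eq_iff elim!: Ints_cases) (metis add_diff_cancel_left' diff_add_cancel add.commute)
        also have "\<dots> = ?F 1 (fst w1, snd w1 + of_int n)" using push_shift[of w1 \<rho> v 1 w1 n] by (simp add: F1)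
        finally have "coord y = (fst w1, snd w1 + of_int n)" by (rule inj_push[OF v])
        then have "y = E w1" using c(2) E_shift[of "fst w1" "snd w1" n] w12(1) by (auto simp: mem_Times_iff)
        then show False using y by simp
      next
        case False
        then show False using t carry_off w12(2) by (simp add: \<tau>_def)
      qed
    qed
    then show "\<tau> y \<in> S - {E w2}" using y \<tau>c(2) by auto
  qed
  note com = hom_induced_restrict_commute[OF \<tau>c \<tau>V this, of p]
  have "hom_induced p ?X (S - V) ?X (S - {E w2}) id d =
      hom_induced p ?X (S - {E w1}) ?X (S - {E w2}) \<tau> (hom_induced p ?X (S - V) ?X (S - {E w1}) id d)"
    if "d \<in> carrier (relative_homology_group p ?X (S - V))" for d
    using com[of d] id[OF that] w12(3,4) by auto
  then show ?thesis using c eq by simp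
qed

text \<open>Pulling \<open>\<mu>\<close> back along the twist gives another orientation \<open>\<nu>\<close>, which agrees with \<open>\<mu>\<close> at the
  points near which the twist is the identity. On a small disc both are restrictions of
  classes over the disc, so agreement at one point of the disc implies agreement at all of
  its points by sliding. Since the annulus is connected, the agreement spreads over it from
  a point off the core.\<close>

theorem twist_orientation_preserving: "orientation_preserving S (twist k)"
  unfolding orientation_preserving_def
proof (intro allI impI ballI)
  fix \<mu> y assume \<mu>: "orientation_of S \<mu>" and yS: "y \<in> S"
  let ?X = "top_of_set S"
  let ?H = "\<lambda>A. relative_homology_group 2 ?X A" and ?h = "\<lambda>A B f. hom_induced 2 ?X A ?X B f"
  define f where "f = twist k"
  define g where "g = twist (- k)"
  have fg: "f (g z) = z" "g (f z) = z" for z by (simp_all add: f_def g_def twist_add)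
  have fS: "continuous_on S f" "f \<in> S \<rightarrow> S" "f z \<in> S \<longleftrightarrow> z \<in> S" and gS: "continuous_on S g" "g \<in> S \<rightarrow> S" for z
    using continuous_on_twist twist_mem twist_mem[of "f z" "- k"] fg(2)[of z]
    unfolding f_def g_def by (blast, blast, metis, blast, blast)
  have ct: "continuous_map ?X ?X f" "continuous_map ?X ?X g" "continuous_map ?X ?X id" using fS gS by auto
  have fm: "f \<in> S - {z} \<rightarrow> S - {f z}" and gm: "g \<in> S - {f z} \<rightarrow> S - {z}" for z
    using fS(2) gS(2) fg(1)[of z] fg(2)[of z] by (auto simp: Pi_iff) (metis fg)+
  have \<mu>c: "\<mu> z \<in> carrier (?H (S - {z}))" if "z \<in> S" for z using \<mu> that by (simp add: orientation_of_def)
  let ?P = "\<lambda>z. ?h (S - {z}) (S - {f z}) f (\<mu> z) = \<mu> (f z)"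
  define \<nu> where "\<nu> z = ?h (S - {f z}) (S - {z}) g (\<mu> (f z))" for z
  have P_iff: "?P z \<longleftrightarrow> \<mu> z = \<nu> z" if z: "z \<in> S" for z
  proof
    assume "?P z"
    then have "\<nu> z = ?h (S - {f z}) (S - {z}) g (?h (S - {z}) (S - {f z}) f (\<mu> z))" by (simp add: \<nu>_def)
    also have "\<dots> = ?h (S - {z}) (S - {z}) (g \<circ> f) (\<mu> z)"
      by (rule hom_induced_compose'[OF ct(1) fm ct(2) gm])
    also have "\<dots> = \<mu> z" using fg by (intro hom_induced_id_gen \<mu>c z continuous_map_compose[OF ct(1,2)]) auto
    finally show "\<mu> z = \<nu> z" ..
  next
    assume "\<mu> z = \<nu> z"
    then have "?h (S - {z}) (S - {f z}) f (\<mu> z) = ?h (S - {z}) (S - {f z}) f (?h (S - {f z}) (S - {z}) g (\<mu> (f z)))"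
      by (simp add: \<nu>_def)
    also have "\<dots> = ?h (S - {f z}) (S - {f z}) (f \<circ> g) (\<mu> (f z))"
      by (rule hom_induced_compose'[OF ct(2) gm ct(1) fm])
    also have "\<dots> = \<mu> (f z)"
      using fg fS z by (intro hom_induced_id_gen \<mu>c continuous_map_compose[OF ct(2,1)]) auto
    finally show "?P z" .
  qed
  have off: "?P z" if z: "z \<in> S - core" for z
  proof -
    have "f z = z" using z twist_fix by (simp add: f_def)
    moreover have "?h (S - {z}) (S - {z}) f (\<mu> z) = \<mu> z"
    proof (rule hom_induced_id_locally[OF _ open_off_core z _ fS(1,2)])
      show "f \<in> S - {z} \<rightarrow> S - {z}" using fm[of z] \<open>f z = z\<close> by simp
      show "f x = x" if "x \<in> S - core" for x using that twist_fix by (simp add: f_def)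
    qed (use z \<mu>c points_closed in auto)
    ultimately show ?thesis by simp
  qed
  have "?P y"
  proof (cases "y \<in> core")
    case False
    then show ?thesis using off yS by blast
  next
    case True
    show ?thesis
    proof (rule connected_induction_simple[of "E ` strip" "E ((lo + a) / 2, 0)" y ?P])
      show "connected (E ` strip)"
        by (intro connected_continuous_image E_cont convex_connected convex_Times) auto
      show "y \<in> E ` strip" using True core_subset by (rule rev_subsetD)
      have s: "((lo + a) / 2, 0) \<in> strip" using range by auto
      then show "E ((lo + a) / 2, 0) \<in> E ` strip" by (rule imageI)
      have "E ((lo + a) / 2, 0) \<notin> core" using E_mem_closed_iff[of a b, OF _ _ s] range by auto
      then show "?P (E ((lo + a) / 2, 0))" using off E_mem[OF s] by blast
    next
      fix z assume z: "z \<in> E ` strip"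
      then obtain w0 where w0: "w0 \<in> strip" "z = E w0" by blast
      have zS: "z \<in> S" using z annulus_subset by blast
      obtain V0 c0 where V0: "openin ?X V0" "z \<in> V0" "c0 \<in> carrier (?H (S - V0))"
        "\<And>y. y \<in> V0 \<Longrightarrow> ?h (S - V0) (S - {y}) id c0 = \<mu> y"
        using \<mu> zS unfolding orientation_of_def by meson
      have "f z \<in> S" using zS fS(3) by simp
      then obtain V1 c1 where V1: "openin ?X V1" "f z \<in> V1" "c1 \<in> carrier (?H (S - V1))"
        "\<And>y. y \<in> V1 \<Longrightarrow> ?h (S - V1) (S - {y}) id c1 = \<mu> y"
        using \<mu> unfolding orientation_of_def by meson
      define V2 where "V2 = V0 \<inter> (S \<inter> f -` V1)"
      have "openin ?X V2"
        unfolding V2_def by (intro openin_Int V0(1) continuous_openin_preimage[OF fS(1,2) V1(1)])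
      then have "openin (top_of_set strip) (strip \<inter> E -` V2)"
        using E_mem by (intro continuous_openin_preimage[OF E_cont]) auto
      then have "open (strip \<inter> E -` V2)" using open_strip openin_open_trans by blast
      moreover have "w0 \<in> strip \<inter> E -` V2" using w0 V0(2) V1(2) zS by (auto simp: V2_def)
      ultimately obtain \<rho> where \<rho>: "\<rho> > 0" "cball w0 \<rho> \<subseteq> strip \<inter> E -` V2"
        using open_contains_cball by blast
      define V where "V = E ` ball w0 \<rho>"
      have VV: "V \<subseteq> V2" using \<rho>(2) ball_subset_cball unfolding V_def by blast
      have V01: "S - V0 \<subseteq> S - V" "g \<in> S - V1 \<rightarrow> S - V"
      proof -
        show "S - V0 \<subseteq> S - V" using VV by (auto simp: V2_def)
        show "g \<in> S - V1 \<rightarrow> S - V"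
        proof
          fix x assume x: "x \<in> S - V1"
          have "g x \<notin> V2" using x fg(1)[of x] by (auto simp: V2_def)
          then show "g x \<in> S - V" using VV x gS(2) by blast
        qed
      qed
      define c where "c = ?h (S - V0) (S - V) id c0"
      define d where "d = ?h (S - V1) (S - V) g c1"
      have cd: "c \<in> carrier (?H (S - V))" "d \<in> carrier (?H (S - V))"
        using hom_induced_carrier by (auto simp: c_def d_def)
      have rc: "?h (S - V) (S - {y}) id c = \<mu> y" if y: "y \<in> V" for y
      proof -
        have "?h (S - V) (S - {y}) id c = ?h (S - V0) (S - {y}) (id \<circ> id) c0"
          unfolding c_def by (rule hom_induced_compose'[OF ct(3) _ ct(3)]) (use V01 y in auto)
        then show ?thesis using V0(4)[of y] y VV by (auto simp: V2_def)
      qed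
      have rd: "?h (S - V) (S - {y}) id d = \<nu> y" if y: "y \<in> V" for y
      proof -
        have fy: "f y \<in> V1" using y VV by (auto simp: V2_def)
        have "?h (S - {f y}) (S - {y}) g (?h (S - V1) (S - {f y}) id c1) = ?h (S - V) (S - {y}) id d"
          unfolding d_def by (rule hom_induced_restrict_commute[OF gS V01(2) gm]) (use y fy in auto)
        then show ?thesis using V1(4)[OF fy] by (simp add: \<nu>_def)
      qed
      have step: "?P (E w2)" if w: "w1 \<in> ball w0 (\<rho> / 3)" "w2 \<in> ball w0 (\<rho> / 3)" and P: "?P (E w1)" for w1 w2
      proof -
        have sub: "cball w1 (2 * \<rho> / 3) \<subseteq> ball w0 \<rho>"
        proof
          fix w assume "w \<in> cball w1 (2 * \<rho> / 3)"
          then show "w \<in> ball w0 \<rho>" using w(1) dist_triangle[of w0 w w1] by simp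
        qed
        have in_strip: "cball w1 (2 * \<rho> / 3) \<subseteq> strip" using sub \<rho>(2) ball_subset_cball by blast
        have inV: "E ` ball w1 (2 * \<rho> / 3) \<subseteq> V" using sub ball_subset_cball unfolding V_def by blast
        have w2: "w2 \<in> ball w1 (2 * \<rho> / 3)"
          using w dist_triangle2[of w1 w2 w0] by (simp add: dist_commute)
        have E12: "E w1 \<in> V" "E w2 \<in> V" using w \<rho>(1) unfolding V_def by auto
        then have S12: "E w1 \<in> S" "E w2 \<in> S" using VV by (auto simp: V2_def)
        have "?h (S - V) (S - {E w1}) id c = ?h (S - V) (S - {E w1}) id d"
          using rc[OF E12(1)] rd[OF E12(1)] P P_iff[OF S12(1)] by simp
        from push_class[OF in_strip inV w2 cd this]
        have "\<mu> (E w2) = \<nu> (E w2)" using rc[OF E12(2)] rd[OF E12(2)] by simp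
        then show ?thesis using P_iff[OF S12(2)] by simp
      qed
      show "\<exists>T. openin (top_of_set (E ` strip)) T \<and> z \<in> T \<and> (\<forall>x\<in>T. \<forall>y\<in>T. ?P x \<longrightarrow> ?P y)"
      proof (intro exI conjI)
        have "ball w0 (\<rho> / 3) \<subseteq> ball w0 \<rho>" using \<rho>(1) by (intro subset_ball) simp
        then have bs: "ball w0 (\<rho> / 3) \<subseteq> strip" using \<rho>(2) ball_subset_cball by blast
        have "openin ?X (E ` ball w0 (\<rho> / 3))" by (rule E_open[OF open_ball bs])
        then show "openin (top_of_set (E ` strip)) (E ` ball w0 (\<rho> / 3))"
          by (rule openin_subset_trans) (use bs annulus_subset in auto)
        show "z \<in> E ` ball w0 (\<rho> / 3)" using w0(2) \<rho>(1) by auto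
        show "\<forall>x\<in>E ` ball w0 (\<rho> / 3). \<forall>y\<in>E ` ball w0 (\<rho> / 3). ?P x \<longrightarrow> ?P y"
          using step by blast
      qed
    qed
  qed
  then show "?h (S - {y}) (S - {twist k y}) (twist k) (\<mu> y) = \<mu> (twist k y)" by (simp add: f_def)
qed

end

section \<open>Annuli in the polygon\<close>

text \<open>The sides \<open>0, 1, 2, 3\<close> of the polygon are identified in the pairs \<open>0, 2\<close> and \<open>1, 3\<close>. The
  reflection of the disc in the line through the middle of side \<open>j + 1\<close> exchanges the sides
  \<open>j\<close> and \<open>j + 2\<close>, and for \<open>j = 0, 1\<close> it is the identification of these two sides. So the
  band of chords orthogonal to this line that join the two sides becomes an annulus.\<close>

locale polygon_surface =
  fixes g :: nat and X :: "'a::topological_space set" and q :: "complex \<Rightarrow> 'a"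
  assumes g: "g \<ge> 1"
    and quot: "quotient_map (top_of_set (cball (0::complex) 1)) (top_of_set X) q"
    and fibres: "\<And>z w. z \<in> cball 0 1 \<Longrightarrow> w \<in> cball 0 1 \<Longrightarrow> q z = q w \<longleftrightarrow> equivclp (side_pairing g) z w"
begin

abbreviation disc :: "complex set" where "disc \<equiv> cball 0 1"

text \<open>The angle that a side subtends.\<close>

definition \<theta> :: real where "\<theta> = pi / (2 * real g)"

lemma \<theta>: "0 < \<theta>" "\<theta> \<le> pi / 2" "4 * real g * \<theta> = 2 * pi"
proof -
  show "0 < \<theta>" "4 * real g * \<theta> = 2 * pi" using g by (auto simp: \<theta>_def)
  have "pi / (2 * real g) \<le> pi / 2" using g by (intro divide_left_mono) auto
  then show "\<theta> \<le> pi / 2" by (simp add: \<theta>_def)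
qed

lemma polygon_point: "polygon_point g t = cis (\<theta> * t)"
  by (simp add: polygon_point_def \<theta>_def field_simps)

lemma side_pairing_iff:
  "side_pairing g z w \<longleftrightarrow> (\<exists>i<g. \<exists>j\<in>{0, 1::nat}. \<exists>s\<in>{0..1}. z = cis (\<theta> * (4 * real i + real j + s)) \<and>
     w = cis (\<theta> * (8 * real i + 2 * real j + 3 - (4 * real i + real j + s))))"
proof -
  have e: "8 * real i + 2 * real j + 3 - (4 * real i + real j + s) = 4 * real i + real j + 3 - s" for i j s by simp
  show ?thesis unfolding side_pairing_def polygon_point e
    by (auto simp: algebra_simps)
qed

lemma side_pairingE:
  assumes "side_pairing g z w"
  obtains i j s t where "i < g" "j \<in> {0, 1::nat}" "s \<in> {0..1::real}" "t = 4 * real i + real j + s"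
    "z = cis (\<theta> * t)" "w = cis (\<theta> * (8 * real i + 2 * real j + 3 - t))"
  using assms unfolding side_pairing_iff by blast

lemma q_continuous: "continuous_on disc q" and q_image: "q ` disc = X"
  using quotient_imp_continuous_map[OF quot] quotient_imp_surjective_map[OF quot] by auto

lemma q_mem: "z \<in> disc \<Longrightarrow> q z \<in> X"
  using q_image by blast

lemma openin_q: "U \<subseteq> X \<Longrightarrow> openin (top_of_set X) U \<longleftrightarrow> openin (top_of_set disc) {z \<in> disc. q z \<in> U}"
  using quot unfolding quotient_map_def by auto

text \<open>The middle of side \<open>j + 1\<close>.\<close>

definition axis :: "nat \<Rightarrow> complex" where "axis j = cis (\<theta> * (real j + 3 / 2))"

text \<open>The coordinates along the axis and orthogonal to it, and the reflection in the axis.\<close>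

definition xc :: "nat \<Rightarrow> complex \<Rightarrow> real" where "xc j z = Re (z * cnj (axis j))"
definition yc :: "nat \<Rightarrow> complex \<Rightarrow> real" where "yc j z = Im (z * cnj (axis j))"
definition mirror :: "nat \<Rightarrow> complex \<Rightarrow> complex" where "mirror j z = axis j * axis j * cnj z"

lemma axis_unit: "axis j * cnj (axis j) = 1" "cmod (axis j) = 1"
  by (simp_all add: axis_def cis_cnj cis_mult)

lemma coords: "z = axis j * Complex (xc j z) (yc j z)"
proof -
  have "Complex (xc j z) (yc j z) = z * cnj (axis j)" by (simp only: xc_def yc_def complex.collapse)
  then have "axis j * Complex (xc j z) (yc j z) = z * (axis j * cnj (axis j))" by (simp add: mult_ac)
  then show ?thesis by (simp add: axis_unit)
qed

lemma coords_axis: "xc j (axis j * w) = Re w" "yc j (axis j * w) = Im w"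
proof -
  have e: "axis j * w * cnj (axis j) = w" using axis_unit(1)[of j] by (metis mult.assoc mult.commute mult_1)
  show "xc j (axis j * w) = Re w" "yc j (axis j * w) = Im w" unfolding xc_def yc_def e by (rule refl)+
qed

lemma norm_coords: "(cmod z)\<^sup>2 = (xc j z)\<^sup>2 + (yc j z)\<^sup>2"
proof -
  have "cmod z = cmod (z * cnj (axis j))" by (simp add: norm_mult axis_unit)
  then show ?thesis by (simp add: xc_def yc_def cmod_power2)
qed

lemma mirror_coords: "xc j (mirror j z) = xc j z" "yc j (mirror j z) = - yc j z"
proof -
  have "mirror j z = axis j * cnj (z * cnj (axis j))" by (simp add: mirror_def mult_ac)
  then show "xc j (mirror j z) = xc j z" "yc j (mirror j z) = - yc j z"
    using coords_axis[of j "cnj (z * cnj (axis j))"] by (simp_all add: xc_def yc_def)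
qed

lemma mirror_mirror: "mirror j (mirror j z) = z"
  using coords[of "mirror j (mirror j z)" j] coords[of z j] by (simp add: mirror_coords)

lemma norm_mirror: "cmod (mirror j z) = cmod z"
  by (simp add: mirror_def norm_mult axis_unit)

text \<open>The boundary points whose coordinate along axis \<open>j\<close> lies in this interval are at an angle
  between \<open>\<theta> / 2\<close> and \<open>3 \<theta> / 2\<close> from the axis, that is, they are the interior points of the
  sides \<open>j\<close> and \<open>j + 2\<close>.\<close>

definition J0 :: "real set" where "J0 = {cos (3 / 2 * \<theta>)<..<cos (\<theta> / 2)}"

text \<open>Here \<open>\<tau>\<close> is the distance from the axis, measured in sides along the boundary. The bound
  covers all the boundary parameters that occur in the side pairing.\<close>

lemma J0_cos:
  assumes "\<bar>\<tau>\<bar> \<le> 4 * real g - 3 / 2" "cos (\<theta> * \<tau>) \<in> J0"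
  shows "1 / 2 < \<bar>\<tau>\<bar>" "\<bar>\<tau>\<bar> < 3 / 2"
proof -
  have c: "cos (\<theta> * \<tau>) = cos (\<theta> * \<bar>\<tau>\<bar>)" by (cases "\<tau> \<ge> 0") auto
  show "1 / 2 < \<bar>\<tau>\<bar>"
  proof (rule ccontr)
    assume "\<not> 1 / 2 < \<bar>\<tau>\<bar>"
    then have "\<theta> * \<bar>\<tau>\<bar> \<le> \<theta> * (1 / 2)" using \<theta> by (intro mult_left_mono) auto
    then have "cos (\<theta> / 2) \<le> cos (\<theta> * \<bar>\<tau>\<bar>)" using \<theta> by (intro cos_monotone_0_pi_le) auto
    then show False using assms(2) c by (simp add: J0_def)
  qed
  show "\<bar>\<tau>\<bar> < 3 / 2"
  proof (rule ccontr)
    assume "\<not> \<bar>\<tau>\<bar> < 3 / 2"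
    then have l: "\<theta> * (3 / 2) \<le> \<theta> * \<bar>\<tau>\<bar>" using \<theta> by (intro mult_left_mono) auto
    have "\<theta> * \<bar>\<tau>\<bar> \<le> \<theta> * (4 * real g - 3 / 2)" using \<theta> assms(1) by (intro mult_left_mono) auto
    then have u: "\<theta> * \<bar>\<tau>\<bar> \<le> 2 * pi - 3 / 2 * \<theta>" using \<theta>(3) by (simp add: algebra_simps)
    have "cos (\<theta> * \<bar>\<tau>\<bar>) \<le> cos (3 / 2 * \<theta>)"
    proof (cases "\<theta> * \<bar>\<tau>\<bar> \<le> pi")
      case True
      then show ?thesis using l \<theta> by (intro cos_monotone_0_pi_le) auto
    next
      case False
      have "cos (\<theta> * \<bar>\<tau>\<bar>) = cos (2 * pi - \<theta> * \<bar>\<tau>\<bar>)" by (simp add: cos_diff)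
      also have "\<dots> \<le> cos (3 / 2 * \<theta>)" using False u \<theta> by (intro cos_monotone_0_pi_le) auto
      finally show ?thesis .
    qed
    then show False using assms(2) c by (simp add: J0_def)
  qed
qed

lemma xc_cis: "xc j (cis (\<theta> * t)) = cos (\<theta> * (t - real j - 3 / 2))"
  by (simp add: xc_def axis_def cis_cnj cis_mult algebra_simps)

lemma mirror_cis: "mirror j (cis (\<theta> * t)) = cis (\<theta> * (2 * real j + 3 - t))"
  by (simp add: mirror_def axis_def cis_cnj cis_mult algebra_simps)

lemma side_pairing_in_J0:
  assumes sp: "side_pairing g z w \<or> side_pairing g w z" and j: "j \<in> {0, 1}" and x: "xc j z \<in> J0"
  shows "cmod z = 1" "w = mirror j z"
proof -
  obtain i j' s t where i: "i < g" and j': "j' \<in> {0, 1::nat}" and s: "s \<in> {0..1::real}"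
    and t: "t = 4 * real i + real j' + s \<or> t = 4 * real i + real j' + 3 - s"
    and z: "z = cis (\<theta> * t)" and w: "w = cis (\<theta> * (8 * real i + 2 * real j' + 3 - t))"
    using sp
  proof
    assume "side_pairing g z w"
    then obtain i j' s t where "i < g" "j' \<in> {0, 1::nat}" "s \<in> {0..1::real}" "t = 4 * real i + real j' + s"
      "z = cis (\<theta> * t)" "w = cis (\<theta> * (8 * real i + 2 * real j' + 3 - t))" by (rule side_pairingE)
    then show ?thesis using that by blast
  next
    assume "side_pairing g w z"
    then obtain i j' s t where *: "i < g" "j' \<in> {0, 1::nat}" "s \<in> {0..1::real}" "t = 4 * real i + real j' + s"
      "w = cis (\<theta> * t)" "z = cis (\<theta> * (8 * real i + 2 * real j' + 3 - t))" by (rule side_pairingE)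
    show ?thesis
    proof (rule that[of i j' s "8 * real i + 2 * real j' + 3 - t"])
      have e: "8 * real i + 2 * real j' + 3 - (8 * real i + 2 * real j' + 3 - t) = t" by simp
      show "w = cis (\<theta> * (8 * real i + 2 * real j' + 3 - (8 * real i + 2 * real j' + 3 - t)))"
        unfolding e by (rule *)
      show "8 * real i + 2 * real j' + 3 - t = 4 * real i + real j' + s \<or>
          8 * real i + 2 * real j' + 3 - t = 4 * real i + real j' + 3 - s" using *(4) by simp
    qed (rule *)+
  qed
  have i': "real i \<le> real g - 1" using i by linarith
  have g': "real g \<ge> 1" using g by simp
  define \<tau> where "\<tau> = t - real j - 3 / 2"
  have "\<bar>\<tau>\<bar> \<le> 4 * real g - 3 / 2" using t s i' g' j j' unfolding \<tau>_def by auto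
  moreover have "cos (\<theta> * \<tau>) \<in> J0" using x z xc_cis by (simp add: \<tau>_def)
  ultimately have \<tau>: "1 / 2 < \<bar>\<tau>\<bar>" "\<bar>\<tau>\<bar> < 3 / 2" by (rule J0_cos)+
  have "i = 0"
  proof (rule ccontr)
    assume "i \<noteq> 0"
    then have "real i \<ge> 1" by simp
    then show False using \<tau> t s j j' unfolding \<tau>_def by auto
  qed
  moreover have "j' = j"
    using \<tau> t s j j' \<open>i = 0\<close> unfolding \<tau>_def by (auto simp: abs_if split: if_splits)
  ultimately show "w = mirror j z" using z w mirror_cis by simp
  show "cmod z = 1" using z by simp
qed

text \<open>In the band a class has at most two members, because the only partner of a point is its
  mirror image, whose only partner is the point again.\<close>

lemma equivclp_in_J0:
  assumes "equivclp (side_pairing g) z w" and j: "j \<in> {0, 1}" and x: "xc j z \<in> J0"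
  shows "w = z \<or> cmod z = 1 \<and> w = mirror j z"
  using assms(1)
proof (induction rule: equivclp_induct)
  case (step y w)
  show ?case using step.IH
  proof
    assume "y = z"
    then show ?thesis using side_pairing_in_J0[OF step.hyps(2) j] x by simp
  next
    assume y: "cmod z = 1 \<and> y = mirror j z"
    then have "w = mirror j y" using side_pairing_in_J0[OF step.hyps(2) j] x mirror_coords by simp
    then show ?thesis using y by (simp add: mirror_mirror)
  qed
qed simp

text \<open>On the lower of the two sides the point is written in terms of the side parameter \<open>s\<close>; the
  upper side follows by reflection.\<close>

lemma opposite_sides:
  assumes j: "j \<in> {0, 1}" and x: "xc j z \<in> J0" and z: "cmod z = 1"
  shows "equivclp (side_pairing g) z (mirror j z)"
proof -
  have *: "equivclp (side_pairing g) z (mirror j z)" if x: "xc j z \<in> J0" and z: "cmod z = 1" and y: "yc j z \<le> 0" for z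
  proof -
    define \<alpha> where "\<alpha> = arccos (xc j z)"
    have xy: "(xc j z)\<^sup>2 + (yc j z)\<^sup>2 = 1" using norm_coords[of z j] z by simp
    then have x1: "\<bar>xc j z\<bar> \<le> 1" by (metis abs_square_le_1 le_add_same_cancel1 zero_le_power2)
    have c: "cos \<alpha> = xc j z" "0 \<le> \<alpha>" "\<alpha> \<le> pi" using x1 by (auto simp: \<alpha>_def arccos_lbound arccos_ubound)
    have "sin \<alpha> = sqrt (1 - (xc j z)\<^sup>2)" using x1 by (simp add: \<alpha>_def sin_arccos_abs)
    also have "\<dots> = - yc j z" using xy y by (intro real_sqrt_unique) (auto simp: algebra_simps)
    finally have s: "sin \<alpha> = - yc j z" .
    have "Complex (xc j z) (yc j z) = cis (- \<alpha>)" using c s by (simp add: complex_eq_iff)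
    then have "z = axis j * cis (- \<alpha>)" using coords[of z j] by simp
    then have zc: "z = cis (\<theta> * (real j + 3 / 2 - \<alpha> / \<theta>))"
      using \<theta>(1) by (simp add: axis_def cis_mult algebra_simps)
    have "\<theta> * (\<alpha> / \<theta>) = \<alpha>" using \<theta>(1) by simp
    then have cJ: "cos (\<theta> * (\<alpha> / \<theta>)) \<in> J0" using c x by simp
    have "\<alpha> / \<theta> \<le> pi / \<theta>" using c \<theta> by (intro divide_right_mono) auto
    also have "pi / \<theta> = 2 * real g" using \<theta>(1,3) by (simp add: field_simps)
    finally have "\<bar>\<alpha> / \<theta>\<bar> \<le> 4 * real g - 3 / 2" using c \<theta> g by simp
    from J0_cos[OF this cJ] have r: "1 / 2 < \<alpha> / \<theta>" "\<alpha> / \<theta> < 3 / 2" using c \<theta> by auto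
    define s where "s = 3 / 2 - \<alpha> / \<theta>"
    have "z = cis (\<theta> * (4 * real 0 + real j + s))" using zc by (simp add: s_def algebra_simps)
    moreover have "mirror j z = cis (\<theta> * (8 * real 0 + 2 * real j + 3 - (4 * real 0 + real j + s)))"
      unfolding zc mirror_cis by (simp add: s_def algebra_simps)
    moreover have "s \<in> {0..1}" using r by (simp add: s_def)
    ultimately have "side_pairing g z (mirror j z)"
      unfolding side_pairing_iff using g j by (intro exI[of _ 0] conjI bexI[of _ j] bexI[of _ s]) auto
    then show ?thesis by (rule r_into_equivclp)
  qed
  show ?thesis
  proof (cases "yc j z \<le> 0")
    case True
    then show ?thesis using * x z by blast
  next
    case False
    then have "equivclp (side_pairing g) (mirror j z) (mirror j (mirror j z))"
      using *[of "mirror j z"] x z by (simp add: mirror_coords norm_mirror)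
    then show ?thesis by (simp add: mirror_mirror equivclp_sym)
  qed
qed

lemma q_eq_in_J0:
  assumes j: "j \<in> {0, 1}" and z: "z \<in> disc" "w \<in> disc" and x: "xc j z \<in> J0"
  shows "q z = q w \<longleftrightarrow> w = z \<or> cmod z = 1 \<and> w = mirror j z"
  using fibres[OF z] equivclp_in_J0[OF _ j x] opposite_sides[OF j x] by auto

subsection \<open>The fibres are finite\<close>

text \<open>Every identification of two sides has the form \<open>z \<mapsto> c \<cdot> cnj z\<close> for a root of unity \<open>c\<close> of
  order dividing \<open>4g\<close>, and the compositions of such maps form a finite set.\<close>

lemma finite_fibre: "finite {w \<in> disc. q w = q z}" if z: "z \<in> disc"
proof -
  let ?R = "{c::complex. c ^ (4 * g) = 1}"
  have sp: "\<exists>c\<in>?R. w = c * cnj z" if h: "side_pairing g z w \<or> side_pairing g w z" for z w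
  proof -
    have 1: "\<exists>c\<in>?R. w = c * cnj z \<and> z = c * cnj w" if pair: "side_pairing g z w" for z w
    proof -
      obtain i j' t where *: "z = cis (\<theta> * t)" "w = cis (\<theta> * (8 * real i + 2 * real j' + 3 - t))"
        using pair by (rule side_pairingE)
      let ?c = "cis (\<theta> * (8 * real i + 2 * real j' + 3))"
      have "?c ^ (4 * g) = cis (2 * pi * real (8 * i + 2 * j' + 3))"
      proof -
        have "real (4 * g) * (\<theta> * (8 * real i + 2 * real j' + 3)) = (4 * real g * \<theta>) * (8 * real i + 2 * real j' + 3)"
          by simp
        also have "\<dots> = 2 * pi * real (8 * i + 2 * j' + 3)" unfolding \<theta>(3) by simp
        finally show ?thesis by (simp only: Complex.DeMoivre)
      qed
      also have "\<dots> = 1" by (rule cis_multiple_2pi) (rule Ints_of_nat)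
      finally have "?c \<in> ?R" by simp
      moreover have "w = ?c * cnj z" "z = ?c * cnj w"
        unfolding * by (simp_all add: cis_cnj cis_mult algebra_simps)
      ultimately show ?thesis by blast
    qed
    then show ?thesis using h by blast
  qed
  have reach: "w \<in> (\<lambda>c. c * z) ` ?R \<union> (\<lambda>c. c * cnj z) ` ?R" if "equivclp (side_pairing g) z w" for w
    using that
  proof (induction rule: equivclp_induct)
    case base
    show ?case by (auto intro!: image_eqI[of _ _ 1])
  next
    case (step y w)
    obtain c where c: "c \<in> ?R" "w = c * cnj y" using sp[OF step.hyps(2)] by blast
    from step.IH obtain d where d: "d \<in> ?R" "y = d * z \<or> y = d * cnj z" by blast
    have "c * cnj d \<in> ?R" using c d by (simp add: power_mult_distrib flip: complex_cnj_power)
    then show ?case using c(2) d(2) by (auto simp: mult.assoc)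
  qed
  have "{w \<in> disc. q w = q z} \<subseteq> (\<lambda>c. c * z) ` ?R \<union> (\<lambda>c. c * cnj z) ` ?R"
  proof (intro subsetI)
    fix w assume "w \<in> {w \<in> disc. q w = q z}"
    then have "w \<in> disc" "q z = q w" by simp_all
    then show "w \<in> (\<lambda>c. c * z) ` ?R \<union> (\<lambda>c. c * cnj z) ` ?R" using reach fibres[OF z] by blast
  qed
  moreover have "finite ?R" using card_complex_roots_unity[of "4 * g"] g by (intro card_ge_0_finite) simp
  ultimately show ?thesis using finite_subset by blast
qed

lemma finite_preimage:
  assumes "finite F" "F \<subseteq> X" shows "finite {z \<in> disc. q z \<in> F}"
proof -
  have "finite {z \<in> disc. q z = y}" if y: "y \<in> F" for y
  proof -
    obtain w where "w \<in> disc" "q w = y" using q_image assms(2) y by (metis imageE subsetD)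
    then show ?thesis using finite_fibre[of w] by simp
  qed
  moreover have "{z \<in> disc. q z \<in> F} = (\<Union>y\<in>F. {z \<in> disc. q z = y})" by blast
  ultimately show ?thesis using assms(1) by simp
qed

lemma open_minus_finite:
  assumes "finite F" shows "openin (top_of_set X) (X - F)"
proof -
  define B where "B = {z \<in> disc. q z \<in> F \<inter> X}"
  have mem: "z \<in> B \<longleftrightarrow> q z \<in> F" if "z \<in> disc" for z using q_mem[OF that] that by (simp add: B_def)
  have "finite B" unfolding B_def by (rule finite_preimage) (use assms in auto)
  then have "open (- B)" by (simp add: finite_imp_closed open_Compl)
  then have "openin (top_of_set disc) (disc \<inter> - B)" by (rule openin_open_Int)
  moreover have "{z \<in> disc. q z \<in> X - F} = disc \<inter> - B"
  proof (intro equalityI subsetI)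
    fix z assume "z \<in> {z \<in> disc. q z \<in> X - F}"
    then have "z \<in> disc" "q z \<notin> F" by simp_all
    then show "z \<in> disc \<inter> - B" using mem by blast
  next
    fix z assume "z \<in> disc \<inter> - B"
    then have "z \<in> disc" "z \<notin> B" by simp_all
    then show "z \<in> {z \<in> disc. q z \<in> X - F}" using mem q_mem by blast
  qed
  ultimately show ?thesis using openin_q[of "X - F"] by simp
qed

lemma path_connected_minus_finite:
  assumes "finite F" shows "path_connected (X - F)"
proof -
  let ?B = "{z \<in> disc. q z \<in> F \<inter> X}"
  have fin: "finite ?B" by (rule finite_preimage) (use assms in auto)
  have "\<not> collinear disc"
    by (simp add: collinear_aff_dim aff_dim_cball)
  then have "path_connected (disc - ?B)"
    by (intro path_connected_convex_diff_countable convex_cball countable_finite fin)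
  then have "path_connected (q ` (disc - ?B))"
    by (intro path_connected_continuous_image continuous_on_subset[OF q_continuous]) auto
  moreover have "q ` (disc - ?B) = X - F" using q_image by blast
  ultimately show ?thesis by simp
qed

subsection \<open>The strips\<close>

text \<open>The chord at position \<open>x\<close> on the axis has half length \<open>half x\<close> and is parametrized by \<open>pt j
  x v\<close> for \<open>v\<close> between \<open>0\<close> and \<open>1\<close>, from side \<open>j\<close> to side \<open>j + 2\<close>; \<open>vc\<close> recovers the
  parameter. The fractional part in \<open>E\<close> makes the chord periodic, which is continuous after
  the two ends of the chord have been identified.\<close>

definition half :: "real \<Rightarrow> real" where "half x = sqrt (1 - x\<^sup>2)"
definition pt :: "nat \<Rightarrow> real \<Rightarrow> real \<Rightarrow> complex" where "pt j x v = axis j * Complex x (half x * (2 * v - 1))"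
definition vc :: "nat \<Rightarrow> complex \<Rightarrow> real" where "vc j z = (yc j z / half (xc j z) + 1) / 2"
definition E :: "nat \<Rightarrow> real \<times> real \<Rightarrow> 'a" where "E j w = q (pt j (fst w) (frac (snd w)))"

lemma J0_bounds: "x \<in> J0 \<Longrightarrow> -1 < x \<and> x < 1"
  using cos_ge_minus_one[of "3 / 2 * \<theta>"] cos_le_one[of "\<theta> / 2"] by (auto simp: J0_def simp del: cos_ge_minus_one cos_le_one)

lemma half_pos: "x \<in> J0 \<Longrightarrow> half x > 0"
  using J0_bounds[of x] by (simp add: half_def abs_square_less_1 abs_less_iff)

lemma half_square: "x \<in> J0 \<Longrightarrow> (half x)\<^sup>2 = 1 - x\<^sup>2"
  using J0_bounds[of x] abs_square_le_1[of x] by (simp add: half_def abs_le_iff)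

lemma pt_coords: "xc j (pt j x v) = x" "yc j (pt j x v) = half x * (2 * v - 1)"
  by (simp_all add: pt_def coords_axis)

lemma norm_pt: "x \<in> J0 \<Longrightarrow> (cmod (pt j x v))\<^sup>2 = 1 - (half x)\<^sup>2 * (1 - (2 * v - 1)\<^sup>2)"
proof -
  assume x: "x \<in> J0"
  have "x\<^sup>2 + (half x)\<^sup>2 * t = 1 - (half x)\<^sup>2 * (1 - t)" for t
    unfolding half_square[OF x] by (simp add: right_diff_distrib)
  then show ?thesis unfolding norm_coords[of _ j] pt_coords power_mult_distrib .
qed

lemma pt_disc:
  assumes "x \<in> J0" "v \<in> {0..1}" shows "pt j x v \<in> disc"
proof -
  have "(2 * v - 1)\<^sup>2 \<le> 1" using assms(2) by (simp add: abs_square_le_1 abs_le_iff)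
  then have "(cmod (pt j x v))\<^sup>2 \<le> 1" unfolding norm_pt[OF assms(1)] by simp
  then show ?thesis by (simp add: abs_square_le_1)
qed

lemma vc_pt: "x \<in> J0 \<Longrightarrow> vc j (pt j x v) = v"
  using half_pos[of x] by (simp add: vc_def pt_coords)

lemma pt_vc: "xc j z \<in> J0 \<Longrightarrow> pt j (xc j z) (vc j z) = z"
proof -
  assume "xc j z \<in> J0"
  then have h: "half (xc j z) > 0" by (rule half_pos)
  have "2 * ((t + 1) / 2) - 1 = t" for t :: real by (simp add: add_divide_distrib)
  then have "2 * vc j z - 1 = yc j z / half (xc j z)" unfolding vc_def .
  then have "half (xc j z) * (2 * vc j z - 1) = yc j z" using h by simp
  then show ?thesis using coords[of z j] by (simp add: pt_def)
qed

lemma vc_range: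
  assumes z: "z \<in> disc" and x: "xc j z \<in> J0" shows "vc j z \<in> {0..1}"
proof -
  have "(cmod z)\<^sup>2 \<le> 1" using z by (simp add: abs_square_le_1)
  then have "(half (xc j z))\<^sup>2 * (1 - (2 * vc j z - 1)\<^sup>2) \<ge> 0"
    using norm_pt[OF x, of j "vc j z"] pt_vc[OF x] by simp
  then have "(2 * vc j z - 1)\<^sup>2 \<le> 1" using half_pos[OF x] by (simp add: zero_le_mult_iff)
  then show ?thesis by (simp add: abs_square_le_1 abs_le_iff)
qed

lemma mirror_pt: "mirror j (pt j x v) = pt j x (1 - v)"
  using coords[of "mirror j (pt j x v)" j] by (simp add: mirror_coords pt_coords) (simp add: pt_def algebra_simps)

lemma boundary_pt: "x \<in> J0 \<Longrightarrow> cmod (pt j x v) = 1 \<longleftrightarrow> v = 0 \<or> v = 1"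
proof -
  assume x: "x \<in> J0"
  have "cmod (pt j x v) = 1 \<longleftrightarrow> (cmod (pt j x v))\<^sup>2 = 1" by (simp add: abs_square_eq_1)
  also have "\<dots> \<longleftrightarrow> (2 * v - 1)\<^sup>2 = 1" using norm_pt[OF x] half_pos[OF x] by simp
  also have "\<dots> \<longleftrightarrow> v = 0 \<or> v = 1" by (auto simp: power2_eq_1_iff)
  finally show ?thesis .
qed

lemma q_pt_eq:
  assumes j: "j \<in> {0, 1}" and x: "x \<in> J0" and v: "v \<in> {0..1}" and w: "w \<in> disc"
  shows "q (pt j x v) = q w \<longleftrightarrow> w = pt j x v \<or> (v = 0 \<or> v = 1) \<and> w = pt j x (1 - v)"
  using q_eq_in_J0[OF j pt_disc[OF x v] w] x by (auto simp: pt_coords boundary_pt mirror_pt)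

lemma E_piece:
  assumes j: "j \<in> {0, 1}" and x: "x \<in> J0" and u: "u \<in> {of_int m..of_int m + 1}"
  shows "E j (x, u) = q (pt j x (u - of_int m))"
proof (cases "u = of_int m + 1")
  case True
  then have "frac u = 0" by simp
  then show ?thesis using True q_pt_eq[OF j x, of 0 "pt j x 1"] pt_disc[OF x] by (simp add: E_def)
next
  case False
  then have "frac u = u - of_int m" using u by (auto simp: frac_unique_iff)
  then show ?thesis by (simp add: E_def)
qed

lemma frac_range: "frac u \<in> {0..1}" using frac_lt_1[of u] by (simp add: less_imp_le)

lemma E_eq_q:
  assumes j: "j \<in> {0, 1}" and x: "fst w \<in> J0" and z: "z \<in> disc"
  shows "E j w = q z \<longleftrightarrow> xc j z = fst w \<and> vc j z - snd w \<in> \<int>"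
proof
  assume "E j w = q z"
  then have "z = pt j (fst w) (frac (snd w)) \<or>
      (frac (snd w) = 0 \<or> frac (snd w) = 1) \<and> z = pt j (fst w) (1 - frac (snd w))"
    using q_pt_eq[OF j x frac_range z, of "snd w"] unfolding E_def by blast
  then have "z = pt j (fst w) (frac (snd w)) \<or> frac (snd w) = 0 \<and> z = pt j (fst w) 1"
    using frac_lt_1[of "snd w"] by (metis diff_zero less_irrefl)
  then show "xc j z = fst w \<and> vc j z - snd w \<in> \<int>"
  proof
    assume z: "z = pt j (fst w) (frac (snd w))"
    have "frac (snd w) - snd w = of_int (- \<lfloor>snd w\<rfloor>)" by (simp add: frac_def)
    then show ?thesis using z x by (metis Ints_of_int pt_coords(1) vc_pt)
  next
    assume z: "frac (snd w) = 0 \<and> z = pt j (fst w) 1"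
    then have "snd w \<in> \<int>" by simp
    then show ?thesis using z x by (simp add: pt_coords vc_pt)
  qed
next
  assume a: "xc j z = fst w \<and> vc j z - snd w \<in> \<int>"
  then have xz: "xc j z \<in> J0" using x by simp
  have v: "vc j z \<in> {0..1}" by (rule vc_range[OF z xz])
  obtain n :: int where n: "vc j z - snd w = of_int n" using a by (auto elim: Ints_cases)
  have "E j (fst w, snd w) = q (pt j (fst w) (snd w - of_int (- n)))"
    by (rule E_piece[OF j x]) (use n v in auto)
  also have "snd w - of_int (- n) = vc j z" using n by simp
  finally show "E j w = q z" using a pt_vc[OF xz] by simp
qed

lemma continuous_pt: "continuous_on A (\<lambda>w. pt j (fst w) (snd w - c))"
  unfolding pt_def half_def by (intro continuous_intros continuous_on_Complex)

lemma E_continuous: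
  assumes j: "j \<in> {0, 1}" shows "continuous_on (J0 \<times> UNIV) (E j)"
proof -
  \<comment> \<open>On each closed period \<open>E\<close> is a chord followed by \<open>q\<close>. Consecutive periods overlap in a
    line, and the interiors of two consecutive periods cover the strip by open sets.\<close>
  have piece: "continuous_on (J0 \<times> {of_int m..of_int m + 1}) (E j)" for m :: int
  proof -
    have "continuous_on (J0 \<times> {of_int m..of_int m + 1}) (\<lambda>w. q (pt j (fst w) (snd w - of_int m)))"
      by (rule continuous_on_compose2[OF q_continuous continuous_pt])
         (use pt_disc in \<open>force simp del: mem_cball\<close>)
    then show ?thesis
      by (rule continuous_on_eq) (use E_piece[OF j] in auto)
  qed
  have two: "continuous_on (J0 \<times> {of_int m..of_int m + 2}) (E j)" for m :: int
  proof -
    have c1: "closedin (top_of_set (J0 \<times> {real_of_int m..of_int m + 2})) (J0 \<times> {of_int m..of_int m + 1})"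
      by (intro closedin_Times closedin_self closed_subset) auto
    have c2: "closedin (top_of_set (J0 \<times> {real_of_int m..of_int m + 2})) (J0 \<times> {of_int m + 1..of_int m + 2})"
      by (intro closedin_Times closedin_self closed_subset) auto
    have e: "J0 \<times> {real_of_int m..of_int m + 2} = J0 \<times> {of_int m..of_int m + 1} \<union> J0 \<times> {of_int m + 1..of_int m + 2}" by auto
    show ?thesis
      unfolding e
      by (rule continuous_on_Un_local) (use c1 c2 piece[of m] piece[of "m + 1"] in \<open>simp_all add: add.assoc flip: e\<close>)
  qed
  have "continuous_on (\<Union>m::int. J0 \<times> {of_int m<..<of_int m + 2}) (E j)"
  proof (rule continuous_on_open_UN)
    show "open (J0 \<times> {real_of_int m<..<of_int m + 2})" for m by (intro open_Times) (auto simp: J0_def)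
    show "continuous_on (J0 \<times> {of_int m<..<of_int m + 2}) (E j)" for m
      using two[of m] by (rule continuous_on_subset) auto
  qed
  moreover have "J0 \<times> UNIV \<subseteq> (\<Union>m::int. J0 \<times> {real_of_int m<..<of_int m + 2})"
  proof
    fix w assume w: "w \<in> J0 \<times> (UNIV :: real set)"
    have "snd w \<in> {of_int (\<lfloor>snd w\<rfloor> - 1)<..<of_int (\<lfloor>snd w\<rfloor> - 1) + 2}" by simp linarith
    then show "w \<in> (\<Union>m::int. J0 \<times> {real_of_int m<..<of_int m + 2})"
      using w by (intro UN_I[of "\<lfloor>snd w\<rfloor> - 1"]) (auto simp: mem_Times_iff)
  qed
  ultimately show ?thesis by (rule continuous_on_subset)
qed

lemma E_image:
  assumes j: "j \<in> {0, 1}" and W: "W \<subseteq> J0 \<times> UNIV"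
  shows "E j ` W \<subseteq> X" "{z \<in> disc. q z \<in> E j ` W} = {z \<in> disc. xc j z \<in> J0 \<and> (\<exists>n::int. (xc j z, vc j z + of_int n) \<in> W)}"
proof -
  show "E j ` W \<subseteq> X"
  proof (rule image_subsetI)
    fix w assume "w \<in> W"
    then have "fst w \<in> J0" using W by auto
    then show "E j w \<in> X" unfolding E_def by (intro q_mem pt_disc frac_range)
  qed
  show "{z \<in> disc. q z \<in> E j ` W} = {z \<in> disc. xc j z \<in> J0 \<and> (\<exists>n::int. (xc j z, vc j z + of_int n) \<in> W)}"
  proof (intro Collect_cong conj_cong refl iffI)
    fix z assume z: "z \<in> disc" and "q z \<in> E j ` W"
    then obtain w where w: "w \<in> W" "E j w = q z" by force
    have x: "fst w \<in> J0" using w W by auto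
    have e: "xc j z = fst w" "vc j z - snd w \<in> \<int>" using E_eq_q[OF j x z] w(2) by auto
    then obtain n :: int where "vc j z - snd w = of_int n" by (auto elim: Ints_cases)
    then have "(xc j z, vc j z + of_int (- n)) = w" using e by (simp add: prod_eq_iff)
    then show "xc j z \<in> J0 \<and> (\<exists>n::int. (xc j z, vc j z + of_int n) \<in> W)" using w(1) x e(1) by metis
  next
    fix z assume z: "z \<in> disc" and a: "xc j z \<in> J0 \<and> (\<exists>n::int. (xc j z, vc j z + of_int n) \<in> W)"
    then obtain n :: int where n: "(xc j z, vc j z + of_int n) \<in> W" by blast
    have "E j (xc j z, vc j z + of_int n) = q z" by (subst E_eq_q[OF j _ z]) (use a in auto)
    then show "q z \<in> E j ` W" using n by (metis imageI)
  qed
qed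

lemma continuous_xc: "continuous_on A (xc j)" and continuous_yc: "continuous_on A (yc j)"
  unfolding xc_def[abs_def] yc_def[abs_def] by (intro continuous_intros)+

lemma E_open_map:
  assumes j: "j \<in> {0, 1}" and W: "open W" "W \<subseteq> J0 \<times> UNIV"
  shows "openin (top_of_set X) (E j ` W)"
proof -
  let ?D = "{z \<in> disc. xc j z \<in> J0}"
  have D: "openin (top_of_set disc) ?D"
  proof -
    have "openin (top_of_set disc) (disc \<inter> xc j -` J0)"
      using continuous_xc by (rule continuous_openin_preimage_gen) (simp add: J0_def)
    moreover have "disc \<inter> xc j -` J0 = ?D" by blast
    ultimately show ?thesis by simp
  qed
  have "continuous_on ?D (\<lambda>z. (xc j z, vc j z + of_int n))" for n :: int
    unfolding vc_def half_def
    by (intro continuous_intros continuous_xc continuous_yc)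
       (use half_pos in \<open>force simp: half_def\<close>)+
  then have "openin (top_of_set ?D) (?D \<inter> (\<lambda>z. (xc j z, vc j z + of_int n)) -` W)" for n :: int
    using W(1) by (rule continuous_openin_preimage_gen)
  then have "openin (top_of_set disc) (\<Union>n::int. ?D \<inter> (\<lambda>z. (xc j z, vc j z + of_int n)) -` W)"
    using D openin_trans by (intro openin_Union) blast
  moreover have "(\<Union>n::int. ?D \<inter> (\<lambda>z. (xc j z, vc j z + of_int n)) -` W) = {z \<in> disc. q z \<in> E j ` W}"
    unfolding E_image(2)[OF j W(2)] by blast
  ultimately show ?thesis using openin_q[OF E_image(1)[OF j W(2)]] by simp
qed

lemma E_closed_strip:
  assumes j: "j \<in> {0, 1}" and cd: "{c..d} \<subseteq> J0"
  shows "openin (top_of_set X) (X - E j ` ({c..d} \<times> UNIV))"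
proof -
  have W: "{c..d} \<times> UNIV \<subseteq> J0 \<times> UNIV" using cd by auto
  have "{z \<in> disc. q z \<in> X - E j ` ({c..d} \<times> UNIV)} = disc - {z \<in> disc. q z \<in> E j ` ({c..d} \<times> UNIV)}"
    using q_image by blast
  also have "\<dots> = disc \<inter> xc j -` (- {c..d})"
    unfolding E_image(2)[OF j W] using cd by auto
  finally have "{z \<in> disc. q z \<in> X - E j ` ({c..d} \<times> UNIV)} = disc \<inter> xc j -` (- {c..d})" .
  moreover have "openin (top_of_set disc) (disc \<inter> xc j -` (- {c..d}))"
    using continuous_xc by (rule continuous_openin_preimage_gen) (simp add: open_Compl)
  ultimately show ?thesis using openin_q[of "X - E j ` ({c..d} \<times> UNIV)"] by auto
qed

lemma E_eq_iff:
  assumes j: "j \<in> {0, 1}" and w: "w \<in> J0 \<times> UNIV" "w' \<in> J0 \<times> UNIV"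
  shows "E j w = E j w' \<longleftrightarrow> fst w = fst w' \<and> snd w - snd w' \<in> \<int>"
proof -
  have x: "fst w \<in> J0" "fst w' \<in> J0" using w by auto
  let ?z = "pt j (fst w') (frac (snd w'))"
  have "E j w = E j w' \<longleftrightarrow> fst w' = fst w \<and> frac (snd w') - snd w \<in> \<int>"
    using E_eq_q[OF j x(1) pt_disc[OF x(2) frac_range]] x by (simp add: E_def[of _ w'] pt_coords vc_pt)
  moreover have "frac (snd w') - snd w \<in> \<int> \<longleftrightarrow> snd w - snd w' \<in> \<int>"
  proof -
    have e: "frac (snd w') - snd w = - (snd w - snd w') - of_int \<lfloor>snd w'\<rfloor>" by (simp add: frac_def)
    show ?thesis unfolding e by (metis Ints_diff Ints_minus Ints_of_int add_diff_cancel_right' diff_add_cancel minus_minus Ints_add)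
  qed
  ultimately show ?thesis by auto
qed

lemma annulus_in_minus_finite:
  assumes j: "j \<in> {0, 1}" and F: "finite F" and r: "lo < a" "a < b" "b < hi" "{lo<..<hi} \<subseteq> J0"
    and avoid: "\<And>z. z \<in> disc \<Longrightarrow> q z \<in> F \<Longrightarrow> xc j z \<notin> {lo<..<hi}"
  shows "annulus_T1 (X - F) (E j) lo a b hi"
proof
  let ?S = "{lo<..<hi} \<times> (UNIV :: real set)"
  have sub: "?S \<subseteq> J0 \<times> UNIV" using r by auto
  show "lo < a" "a < b" "b < hi" by fact+
  show "continuous_on ?S (E j)" using E_continuous[OF j] sub by (rule continuous_on_subset)
  have mem: "E j w \<in> X - F" if w: "w \<in> ?S" for w
  proof -
    have x: "fst w \<in> J0" using w sub by auto
    have "pt j (fst w) (frac (snd w)) \<in> disc" by (rule pt_disc[OF x frac_range])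
    moreover have "xc j (pt j (fst w) (frac (snd w))) \<in> {lo<..<hi}" using w by (auto simp: pt_coords)
    ultimately show ?thesis using avoid q_image by (force simp: E_def simp del: mem_cball)
  qed
  then show "\<And>w. w \<in> ?S \<Longrightarrow> E j w \<in> X - F" .
  show "openin (top_of_set (X - F)) (E j ` W)" if W: "open W" "W \<subseteq> ?S" for W
  proof (rule openin_subset_trans[OF E_open_map[OF j W(1)]])
    show "E j ` W \<subseteq> X - F" using mem W(2) by blast
  qed (use W(2) sub in auto)
  show "E j w = E j w' \<longleftrightarrow> fst w = fst w' \<and> snd w - snd w' \<in> \<int>" if "w \<in> ?S" "w' \<in> ?S" for w w'
    using E_eq_iff[OF j] that sub by blast
  show "openin (top_of_set (X - F)) (X - F - E j ` ({c..d} \<times> UNIV))" if "lo < c" "d < hi" for c d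
  proof -
    have "{c..d} \<subseteq> J0" using that r(4) by force
    from E_closed_strip[OF j this]
    have "openin (top_of_set X) ((X - E j ` ({c..d} \<times> UNIV)) \<inter> (X - F))"
      using open_minus_finite[OF F] by (rule openin_Int)
    moreover have "(X - E j ` ({c..d} \<times> UNIV)) \<inter> (X - F) = X - F - E j ` ({c..d} \<times> UNIV)" by blast
    ultimately show ?thesis by (metis Diff_subset openin_subset_trans)
  qed
  show "openin (top_of_set (X - F)) (X - F - {y})" for y
  proof -
    have "openin (top_of_set X) (X - insert y F)" by (rule open_minus_finite) (use F in auto)
    moreover have "X - insert y F = X - F - {y}" by blast
    ultimately show ?thesis by (metis Diff_subset openin_subset_trans)
  qed
qed

text \<open>Only finitely many positions on the axis are forbidden, since the fibres of \<open>q\<close> are finite.\<close>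

lemma strip_avoiding:
  assumes F: "finite F" "F \<subseteq> X"
  obtains lo a b hi where "lo < a" "a < b" "b < hi" "{lo<..<hi} \<subseteq> J0"
    "\<And>z. z \<in> disc \<Longrightarrow> q z \<in> F \<Longrightarrow> xc j z \<notin> {lo<..<hi}"
proof -
  let ?L = "xc j ` {z \<in> disc. q z \<in> F}"
  have fin: "finite ?L" using finite_preimage[OF F] by simp
  have "cos (3 / 2 * \<theta>) < cos (\<theta> / 2)" using \<theta> by (intro cos_monotone_0_pi) auto
  then have "infinite J0" by (simp add: J0_def infinite_Ioo)
  then have "J0 - ?L \<noteq> {}" using fin by (metis Diff_eq_empty_iff finite_subset)
  then obtain c where c: "c \<in> J0 - ?L" by blast
  have "open (J0 - ?L)" using fin by (intro open_Diff finite_imp_closed) (simp_all add: J0_def)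
  then obtain e where e: "e > 0" "ball c e \<subseteq> J0 - ?L" using c open_contains_ball by blast
  have sub: "{c - e<..<c + e} \<subseteq> J0 - ?L" using e(2) by (simp add: ball_eq_greaterThanLessThan)
  show ?thesis
    by (rule that[of "c - e" "c - e / 2" "c + e / 2" "c + e"]) (use e(1) sub in auto)
qed

subsection \<open>The two annuli meet once\<close>

text \<open>Axis \<open>0\<close> passes through the middle of side \<open>1\<close>, hence a chord from side \<open>1\<close> to side \<open>3\<close>
  starts beyond the upper end of \<open>J0\<close> on axis \<open>0\<close>, and it ends below the lower end. Likewise
  a chord from side \<open>0\<close> to side \<open>2\<close> ends near the middle of side \<open>2\<close>, which is on axis \<open>1\<close>,
  and starts far from it.\<close>

lemma crossing_ends:
  assumes x: "x \<in> J0"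
  shows "xc 0 (pt 1 x 0) \<ge> cos (\<theta> / 2)" "xc 0 (pt 1 x 1) \<le> cos (3 / 2 * \<theta>)"
    "xc 1 (pt 0 x 0) \<le> cos (3 / 2 * \<theta>)" "xc 1 (pt 0 x 1) \<ge> cos (\<theta> / 2)"
proof -
  define \<alpha> where "\<alpha> = arccos x"
  have x1: "\<bar>x\<bar> \<le> 1" using J0_bounds[OF x] by auto
  have c: "cos \<alpha> = x" "sin \<alpha> = half x" "0 \<le> \<alpha>" "\<alpha> \<le> pi"
    using x1 by (auto simp: \<alpha>_def half_def sin_arccos_abs arccos_lbound arccos_ubound)
  have \<alpha>1: "\<theta> / 2 < \<alpha>"
  proof (rule ccontr)
    assume "\<not> \<theta> / 2 < \<alpha>"
    then have "cos (\<theta> / 2) \<le> cos \<alpha>" using c \<theta> by (intro cos_monotone_0_pi_le) auto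
    then show False using x c by (simp add: J0_def)
  qed
  have \<alpha>2: "\<alpha> < 3 / 2 * \<theta>"
  proof (rule ccontr)
    assume "\<not> \<alpha> < 3 / 2 * \<theta>"
    then have "cos \<alpha> \<le> cos (3 / 2 * \<theta>)" using c \<theta> by (intro cos_monotone_0_pi_le) auto
    then show False using x c by (simp add: J0_def)
  qed
  have p0: "pt j x 0 = axis j * cis (- \<alpha>)" and p1: "pt j x 1 = axis j * cis \<alpha>" for j
    using c by (simp_all add: pt_def complex_eq_iff)
  have near: "cos (\<theta> / 2) \<le> cos \<beta>" if "\<bar>\<beta>\<bar> \<le> \<theta> / 2" for \<beta>
  proof -
    have "cos (\<theta> / 2) \<le> cos \<bar>\<beta>\<bar>" using that \<theta> by (intro cos_monotone_0_pi_le) auto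
    then show ?thesis by simp
  qed
  have far: "cos \<beta> \<le> cos (3 / 2 * \<theta>)" if "3 / 2 * \<theta> \<le> \<beta>" "\<beta> \<le> 5 / 2 * \<theta>" for \<beta>
  proof (cases "\<beta> \<le> pi")
    case True
    then show ?thesis using that \<theta> by (intro cos_monotone_0_pi_le) auto
  next
    case False
    have "cos \<beta> = cos (2 * pi - \<beta>)" by (simp add: cos_diff)
    also have "\<dots> \<le> cos (3 / 2 * \<theta>)" using False that \<theta> by (intro cos_monotone_0_pi_le) auto
    finally show ?thesis .
  qed
  have xa: "xc i (axis j * cis \<beta>) = cos (\<theta> * (real j - real i) + \<beta>)" for i j \<beta>
    by (simp add: xc_def axis_def cis_cnj cis_mult algebra_simps)
  have "cos (- \<theta> - \<alpha>) = cos (\<theta> + \<alpha>)" using cos_minus[of "\<theta> + \<alpha>"] by simp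
  then have vals: "xc 0 (pt 1 x 0) = cos (\<theta> - \<alpha>)" "xc 0 (pt 1 x 1) = cos (\<theta> + \<alpha>)"
    "xc 1 (pt 0 x 0) = cos (\<theta> + \<alpha>)" "xc 1 (pt 0 x 1) = cos (\<alpha> - \<theta>)"
    unfolding p0 p1 xa by simp_all
  have "\<bar>\<theta> - \<alpha>\<bar> \<le> \<theta> / 2" "\<bar>\<alpha> - \<theta>\<bar> \<le> \<theta> / 2" using \<alpha>1 \<alpha>2 by linarith+
  then show "xc 0 (pt 1 x 0) \<ge> cos (\<theta> / 2)" "xc 0 (pt 1 x 1) \<le> cos (3 / 2 * \<theta>)"
    "xc 1 (pt 0 x 0) \<le> cos (3 / 2 * \<theta>)" "xc 1 (pt 0 x 1) \<ge> cos (\<theta> / 2)"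
    unfolding vals using near far[of "\<theta> + \<alpha>"] \<alpha>1 \<alpha>2 by simp_all
qed

lemma collapse_q:
  assumes ann: "annulus S (E j) lo a b hi" and j: "j \<in> {0, 1}" and r: "{lo<..<hi} \<subseteq> J0" and z: "z \<in> disc"
  shows "annulus.collapse (E j) lo a b hi (q z) = cis (2 * pi * annulus.ramp a b (xc j z))"
proof -
  interpret annulus S "E j" lo a b hi by (rule ann)
  show ?thesis
  proof (cases "xc j z \<in> {lo<..<hi}")
    case True
    then have w: "(xc j z, vc j z) \<in> {lo<..<hi} \<times> UNIV" by simp
    have "E j (xc j z, vc j z) = q z" by (subst E_eq_q[OF j _ z]) (use True r in auto)
    then show ?thesis using collapse_E[OF w] by simp
  next
    case False
    have "q z \<notin> E j ` strip"
    proof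
      assume "q z \<in> E j ` strip"
      then obtain w where w: "w \<in> strip" "E j w = q z" by force
      then have "fst w \<in> J0" using r by auto
      then have "xc j z = fst w" using E_eq_q[OF j _ z] w(2) by blast
      then show False using False w(1) by auto
    qed
    moreover have "ramp (xc j z) \<in> {0, 1}" using False range by (intro ramp_integer) auto
    ultimately show ?thesis by (auto simp: collapse_def)
  qed
qed

text \<open>Along a chord of one band the ramp of the other band is a lift of the collapse. It passes
  from one of its extreme values to the other, so the chord crosses the other band once.\<close>

lemma crossing_winding:
  assumes ann: "annulus S (E j) lo a b hi" and ij: "j \<in> {0, 1}" "i = 1 - j" and r: "{lo<..<hi} \<subseteq> J0"
    and x: "x \<in> J0"
  shows "winding (annulus.collapse (E j) lo a b hi) (\<lambda>t. E i (x, t)) = (if j = 0 then -1 else 1)"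
proof -
  interpret annulus S "E j" lo a b hi by (rule ann)
  have i: "i \<in> {0, 1}" using ij by auto
  let ?L = "\<lambda>t. ramp (xc j (pt i x t))"
  have "circle_lift collapse (\<lambda>t. E i (x, t)) ?L"
    unfolding circle_lift_def
  proof (intro conjI ballI)
    have "continuous_on {0..1} (\<lambda>t. xc j (pt i x t))"
      unfolding xc_def pt_def by (intro continuous_intros continuous_on_Complex)
    then show "continuous_on {0..1} ?L"
      by (rule continuous_on_compose2[OF continuous_ramp[of UNIV]]) simp
    fix t :: real assume t: "t \<in> {0..1}"
    have "E i (x, t) = q (pt i x t)" using E_piece[OF i x, of t 0] t by simp
    then show "collapse (E i (x, t)) = cis (2 * pi * ?L t)"
      using collapse_q[OF ann ij(1) r pt_disc[OF x t]] by simp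
  qed
  then have w: "winding collapse (\<lambda>t. E i (x, t)) = ?L 1 - ?L 0" by (rule winding_eq)
  have "(a + b) / 2 \<in> J0" "a \<in> J0" "b \<in> J0" using range r by auto
  then have ab: "cos (3 / 2 * \<theta>) \<le> a" "b \<le> cos (\<theta> / 2)" by (auto simp: J0_def)
  show ?thesis
  proof (cases "j = 0")
    case True
    then have "?L 0 = 1" "?L 1 = 0" using ij crossing_ends(1,2)[OF x] ab by (auto intro!: ramp_low ramp_high)
    then show ?thesis using w True by simp
  next
    case False
    then have "j = 1" "i = 0" using ij by auto
    then have "?L 0 = 0" "?L 1 = 1" using crossing_ends(3,4)[OF x] ab by (auto intro!: ramp_low ramp_high)
    then show ?thesis using w False by simp
  qed
qed

end

section \<open>Automorphisms of the fundamental group induced by homeomorphisms\<close>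

text \<open>The auxiliary path to the base point itself is chosen to be constant, so that loops keep
  their classes.\<close>

lemma based_path_functor:
  assumes S: "path_connected S" and x: "x \<in> S"
  obtains \<Phi> where "path_functor S (fundamental_group S x) \<Phi>"
    "\<And>p. path_in S p x x \<Longrightarrow> \<Phi> p = path_class S p"
proof -
  define k where "k z = (if z = x then (\<lambda>_. x) else (SOME p. path_in S p x z))" for z
  have k: "path_in S (k z) x z" if z: "z \<in> S" for z
  proof (cases "z = x")
    case True
    then show ?thesis using path_in_const[OF x] by (simp add: k_def)
  next
    case False
    have "\<exists>p. path_in S p x z" using S x z by (auto simp: path_connected_def path_in_def)
    then show ?thesis using False by (simp add: k_def someI_ex[of "\<lambda>p. path_in S p x z"])
  qed
  let ?\<Phi> = "\<lambda>p. path_class S ((k (pathstart p) +++ p) +++ reversepath (k (pathfinish p)))"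
  have "?\<Phi> p = path_class S p" if p: "path_in S p x x" for p
  proof (rule path_class_eqI)
    have e: "k x = (\<lambda>_. x)" "reversepath (\<lambda>_. x) = (\<lambda>_. x)" "pathstart p = x" "pathfinish p = x"
      using p by (auto simp: k_def reversepath_def path_in_def)
    note c = path_in_const[OF x]
    have 1: "homotopic_paths S ((\<lambda>_. x) +++ p) p" and 2: "homotopic_paths S (p +++ (\<lambda>_. x)) p"
      using homotopic_paths_lid_const[of p S] homotopic_paths_rid_const[of p S] p by (auto simp: path_in_def)
    show "homotopic_paths S ((k (pathstart p) +++ p) +++ reversepath (k (pathfinish p))) p"
      unfolding e using homotopic_paths_trans[OF homotopic_join_left[OF 1 path_in_join[OF c p] c] 2] .
  qed
  then show ?thesis using that path_functor_based_loops[OF x k] by blast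
qed

abbreviation fixed_map :: "'a::topological_space set \<Rightarrow> 'a \<Rightarrow> ('a \<Rightarrow> 'a) \<Rightarrow> (real \<Rightarrow> 'a) set \<Rightarrow> (real \<Rightarrow> 'a) set" where
  "fixed_map S x f \<equiv> pi1_map S (\<lambda>_. x) f"

lemma fixed_map_path_class:
  assumes f: "continuous_on S f" "f \<in> S \<rightarrow> S" "f x = x" and p: "path_in S p x x"
  shows "fixed_map S x f (path_class S p) = path_class S (f \<circ> p)"
proof -
  have x: "x \<in> S" using path_in_mem[OF p] by simp
  note c = path_in_const[OF x]
  have fp: "path_in S (f \<circ> p) x x" using path_in_compose[OF p f(1,2)] f(3) by simp
  have r: "reversepath (\<lambda>_. x) = (\<lambda>_. x)" by (auto simp: reversepath_def)
  have "homotopic_paths S ((\<lambda>_. x) +++ (f \<circ> p) +++ (\<lambda>_. x)) ((f \<circ> p) +++ (\<lambda>_. x))"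
    using homotopic_paths_lid_const[of "(f \<circ> p) +++ (\<lambda>_. x)" S] path_in_join[OF fp c] by (simp add: path_in_def)
  also have "homotopic_paths S \<dots> (f \<circ> p)"
    using homotopic_paths_rid_const[of "f \<circ> p" S] fp by (simp add: path_in_def)
  finally have "homotopic_paths S ((\<lambda>_. x) +++ (f \<circ> p) +++ (\<lambda>_. x)) (f \<circ> p)" .
  then show ?thesis
    using pi1_map_path_class[OF f(1,2) _ p, of "\<lambda>_. x"] c f(3) r path_class_eqI by metis
qed

lemma fixed_map_hom:
  assumes f: "continuous_on S f" "f \<in> S \<rightarrow> S" "f x = x"
  shows "fixed_map S x f \<in> hom (fundamental_group S x) (fundamental_group S x)"
proof (rule homI)
  fix A assume "A \<in> carrier (fundamental_group S x)"
  then obtain p where p: "path_in S p x x" "A = path_class S p" by (auto simp: carrier_fundamental_group)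
  have fp: "path_in S (f \<circ> p) x x" using path_in_compose[OF p(1) f(1,2)] f(3) by simp
  show "fixed_map S x f A \<in> carrier (fundamental_group S x)"
    using fixed_map_path_class[OF f p(1)] path_class_closed[OF fp] p(2) by simp
  fix B assume "B \<in> carrier (fundamental_group S x)"
  then obtain r where r: "path_in S r x x" "B = path_class S r" by (auto simp: carrier_fundamental_group)
  have fr: "path_in S (f \<circ> r) x x" using path_in_compose[OF r(1) f(1,2)] f(3) by simp
  show "fixed_map S x f (A \<otimes>\<^bsub>fundamental_group S x\<^esub> B) =
      fixed_map S x f A \<otimes>\<^bsub>fundamental_group S x\<^esub> fixed_map S x f B"
    using fixed_map_path_class[OF f p(1)] fixed_map_path_class[OF f r(1)]
      fixed_map_path_class[OF f path_in_join[OF p(1) r(1)]]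
      mult_path_class[OF p(1) r(1)] mult_path_class[OF fp fr] p(2) r(2) by (simp add: path_compose_join)
qed

lemma fixed_map_iso:
  assumes h: "homeomorphism S S f f'" and x: "x \<in> S" "f x = x"
  shows "fixed_map S x f \<in> iso (fundamental_group S x) (fundamental_group S x)"
proof -
  have f: "continuous_on S f" "f \<in> S \<rightarrow> S" and f': "continuous_on S f'" "f' \<in> S \<rightarrow> S"
    and inv: "\<And>y. y \<in> S \<Longrightarrow> f' (f y) = y" "\<And>y. y \<in> S \<Longrightarrow> f (f' y) = y"
    using h by (auto simp: homeomorphism_def)
  have fx': "f' x = x" using inv(1)[OF x(1)] x(2) by simp
  have cancel: "fixed_map S x f2 (fixed_map S x f1 A) = A"
    if f1: "continuous_on S f1" "f1 \<in> S \<rightarrow> S" "f1 x = x" and f2: "continuous_on S f2" "f2 \<in> S \<rightarrow> S" "f2 x = x"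
      and i: "\<And>y. y \<in> S \<Longrightarrow> f2 (f1 y) = y" and A: "A \<in> carrier (fundamental_group S x)" for f1 f2 A
  proof -
    obtain p where p: "path_in S p x x" "A = path_class S p" using A by (auto simp: carrier_fundamental_group)
    have fp: "path_in S (f1 \<circ> p) x x" using path_in_compose[OF p(1) f1(1,2)] f1(3) by simp
    have "homotopic_paths S p (f2 \<circ> (f1 \<circ> p))"
    proof (rule homotopic_paths_eq)
      fix t :: real assume "t \<in> {0..1}"
      then have "p t \<in> S" using p(1) by (auto simp: path_in_def path_image_def)
      then show "p t = (f2 \<circ> (f1 \<circ> p)) t" using i by simp
    qed (use p in \<open>auto simp: path_in_def\<close>)
    then show ?thesis
      using fixed_map_path_class[OF f1 p(1)] fixed_map_path_class[OF f2 fp] path_class_eqI p(2) by metis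
  qed
  have hm: "fixed_map S x f \<in> hom (fundamental_group S x) (fundamental_group S x)"
      "fixed_map S x f' \<in> hom (fundamental_group S x) (fundamental_group S x)"
    using fixed_map_hom f f' x(2) fx' by blast+
  have "bij_betw (fixed_map S x f) (carrier (fundamental_group S x)) (carrier (fundamental_group S x))"
    by (rule bij_betw_byWitness[where f' = "fixed_map S x f'"])
       (use cancel[OF f x(2) f' fx' inv(1)] cancel[OF f' fx' f x(2) inv(2)] hm in \<open>auto simp: hom_def\<close>)
  then show ?thesis using hm by (simp add: iso_def)
qed

text \<open>A homotopy moves the base point along a path \<open>\<eta>\<close>, and the two induced maps differ by the
  conjugation with the loop that runs along \<open>c\<close> and back along \<open>\<eta>\<close>.\<close>

lemma pi1_map_homotopic:
  assumes S: "path_connected S" and x: "x \<in> S" and fx: "f x = x"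
    and h: "homotopic_with_canon P S S f h" and c: "path_in S c x (h x)"
  obtains A0 where "A0 \<in> carrier (fundamental_group S x)"
    "\<And>A. A \<in> carrier (fundamental_group S x) \<Longrightarrow> pi1_map S c h A =
        A0 \<otimes>\<^bsub>fundamental_group S x\<^esub> fixed_map S x f A \<otimes>\<^bsub>fundamental_group S x\<^esub> inv\<^bsub>fundamental_group S x\<^esub> A0"
proof -
  let ?G = "fundamental_group S x"
  interpret group ?G by (rule group_fundamental_group[OF x])
  obtain \<Phi> where \<Phi>: "path_functor S ?G \<Phi>" and loop: "\<And>p. path_in S p x x \<Longrightarrow> \<Phi> p = path_class S p"
    using based_path_functor[OF S x] by metis
  interpret \<Phi>: path_functor S ?G \<Phi> by (rule \<Phi>)
  obtain H where H: "continuous_on ({0..1::real} \<times> S) H" "H \<in> {0..1} \<times> S \<rightarrow> S"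
      "\<And>y. H (0, y) = f y" "\<And>y. H (1, y) = h y"
    using h unfolding homotopic_with_def by (auto simp: prod_topology_subtopology_eu)
  have f: "continuous_on S f" "f \<in> S \<rightarrow> S" and hh: "continuous_on S h" "h \<in> S \<rightarrow> S"
    using homotopic_with_imp_continuous_maps[OF h] by auto
  define \<eta> where "\<eta> s = H (s, x)" for s
  have \<eta>: "path_in S \<eta> x (h x)"
  proof -
    have "continuous_on {0..1} \<eta>" unfolding \<eta>_def
      by (rule continuous_on_compose2[OF H(1)]) (use x in \<open>auto intro!: continuous_intros\<close>)
    then show ?thesis using H x fx
      by (auto simp: path_in_def path_def path_image_def pathstart_def pathfinish_def \<eta>_def)
  qed
  define A0 where "A0 = \<Phi> c \<otimes>\<^bsub>?G\<^esub> inv\<^bsub>?G\<^esub> \<Phi> \<eta>"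
  have m: "\<Phi> c \<in> carrier ?G" "\<Phi> \<eta> \<in> carrier ?G" using \<Phi>.closed c \<eta> by blast+
  have "pi1_map S c h A = A0 \<otimes>\<^bsub>?G\<^esub> fixed_map S x f A \<otimes>\<^bsub>?G\<^esub> inv\<^bsub>?G\<^esub> A0" if A: "A \<in> carrier ?G" for A
  proof -
    obtain p where p: "path_in S p x x" "A = path_class S p" using A by (auto simp: carrier_fundamental_group)
    have fp: "path_in S (f \<circ> p) x x" using path_in_compose[OF p(1) f] fx by simp
    have hp: "path_in S (h \<circ> p) (h x) (h x)" using path_in_compose[OF p(1) hh] .
    let ?C = "{0..1::real} \<times> {0..1::real}"
    let ?h = "\<lambda>(s, t). H (s, p t)"
    have pt: "p t \<in> S" if "t \<in> {0..1}" for t using p(1) that by (auto simp: path_in_def path_image_def)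
    have cp: "continuous_on {0..1} p" using p(1) by (simp add: path_in_def path_def)
    have "continuous_on ?C (\<lambda>z. H (fst z, p (snd z)))"
      by (rule continuous_on_compose2[OF H(1)])
         (use pt in \<open>auto intro!: continuous_intros continuous_on_compose2[OF cp]\<close>)
    then have ch: "continuous_on ?C ?h" by (simp add: case_prod_unfold)
    have hS: "?h \<in> ?C \<rightarrow> S" using H(2) pt by auto
    have "(\<lambda>t. ?h (0, t)) = f \<circ> p" "(\<lambda>s. ?h (s, 1)) = \<eta>" "(\<lambda>s. ?h (s, 0)) = \<eta>" "(\<lambda>t. ?h (1, t)) = h \<circ> p"
      using p(1) H(3,4) by (auto simp: fun_eq_iff \<eta>_def path_in_def pathstart_def pathfinish_def)
    with homotopic_paths_square[OF ch hS]
    have "homotopic_paths S ((f \<circ> p) +++ \<eta>) (\<eta> +++ (h \<circ> p))" by (simp only:)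
    from \<Phi>.homotopic[OF this]
    have sq: "\<Phi> (f \<circ> p) \<otimes>\<^bsub>?G\<^esub> \<Phi> \<eta> = \<Phi> \<eta> \<otimes>\<^bsub>?G\<^esub> \<Phi> (h \<circ> p)"
      unfolding \<Phi>.join[OF fp \<eta>] \<Phi>.join[OF \<eta> hp] .
    have fpG: "\<Phi> (f \<circ> p) \<in> carrier ?G" and hpG: "\<Phi> (h \<circ> p) \<in> carrier ?G"
      using \<Phi>.closed fp hp by blast+
    have "inv\<^bsub>?G\<^esub> \<Phi> \<eta> \<otimes>\<^bsub>?G\<^esub> (\<Phi> (f \<circ> p) \<otimes>\<^bsub>?G\<^esub> \<Phi> \<eta>) = \<Phi> (h \<circ> p)"
      unfolding sq using m hpG by (simp flip: m_assoc)
    then have hp_eq: "\<Phi> (h \<circ> p) = inv\<^bsub>?G\<^esub> \<Phi> \<eta> \<otimes>\<^bsub>?G\<^esub> \<Phi> (f \<circ> p) \<otimes>\<^bsub>?G\<^esub> \<Phi> \<eta>"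
      using m fpG by (simp add: m_assoc)
    have L: "path_in S (c +++ (h \<circ> p) +++ reversepath c) x x"
      using path_in_join[OF c path_in_join[OF hp path_in_reverse[OF c]]] .
    have "pi1_map S c h A = \<Phi> (c +++ (h \<circ> p) +++ reversepath c)"
      using pi1_map_path_class[OF hh c p(1)] loop[OF L] p(2) by simp
    also have "\<dots> = \<Phi> c \<otimes>\<^bsub>?G\<^esub> (\<Phi> (h \<circ> p) \<otimes>\<^bsub>?G\<^esub> inv\<^bsub>?G\<^esub> \<Phi> c)"
      using \<Phi>.join[OF c path_in_join[OF hp path_in_reverse[OF c]]] \<Phi>.join[OF hp path_in_reverse[OF c]]
        \<Phi>.reverse[OF c] by simp
    also have "\<dots> = A0 \<otimes>\<^bsub>?G\<^esub> \<Phi> (f \<circ> p) \<otimes>\<^bsub>?G\<^esub> inv\<^bsub>?G\<^esub> A0"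
      unfolding A0_def hp_eq using m fpG by (simp add: m_assoc inv_mult_group)
    also have "\<Phi> (f \<circ> p) = fixed_map S x f A"
      using fixed_map_path_class[OF f fx p(1)] loop[OF fp] p(2) by simp
    finally show ?thesis .
  qed
  moreover have "A0 \<in> carrier ?G" using m by (simp add: A0_def)
  ultimately show ?thesis using that by blast
qed

section \<open>The mapping class of a twist\<close>

context annulus_T1
begin

lemma fixed_map_twist:
  assumes x: "x \<in> S" "x \<notin> core" and p: "path_in S p x x"
  shows "path_in S (twist k \<circ> p) x x"
    and "fixed_map S x (twist k) (path_class S p) = path_class S (twist k \<circ> p)"
proof -
  have f: "continuous_on S (twist k)" "twist k \<in> S \<rightarrow> S" using continuous_on_twist twist_mem by auto
  have fx: "twist k x = x" by (rule twist_fix[OF x(2)])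
  show "path_in S (twist k \<circ> p) x x" using path_in_compose[OF p f] fx by simp
  show "fixed_map S x (twist k) (path_class S p) = path_class S (twist k \<circ> p)"
    by (rule fixed_map_path_class[OF f fx p])
qed

text \<open>The projection of \<open>\<pi>\<^sub>1\<close> to a finite quotient extends to a path functor, on which the twist
  has no effect.\<close>

lemma twist_fixed_map_trivial:
  assumes S: "path_connected S" and x: "x \<in> S" "x \<notin> core"
    and N: "N \<lhd> fundamental_group S x" "finite (rcosets\<^bsub>fundamental_group S x\<^esub> N)"
    and k: "int (card (rcosets\<^bsub>fundamental_group S x\<^esub> N)) dvd k" and A: "A \<in> carrier (fundamental_group S x)"
  shows "fixed_map S x (twist k) A \<in> N #>\<^bsub>fundamental_group S x\<^esub> A"
proof -
  let ?G = "fundamental_group S x"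
  interpret N: normal N ?G by (rule N(1))
  obtain \<Phi> where \<Phi>: "path_functor S ?G \<Phi>" and loop: "\<And>p. path_in S p x x \<Longrightarrow> \<Phi> p = path_class S p"
    using based_path_functor[OF S x(1)] by metis
  obtain p where p: "path_in S p x x" "A = path_class S p" using A by (auto simp: carrier_fundamental_group)
  note fp = fixed_map_twist[OF x p(1)]
  have Q: "path_functor S (?G Mod N) (\<lambda>p. N #>\<^bsub>?G\<^esub> \<Phi> p)"
    by (rule path_functor_compose[OF \<Phi> N.r_coset_hom_Mod N.factorgroup_is_group])
  have "N #>\<^bsub>?G\<^esub> \<Phi> (twist k \<circ> p) = N #>\<^bsub>?G\<^esub> \<Phi> p"
    by (rule path_functor_twist[OF Q _ _ p(1) x(2) x(2)]) (use N(2) k in \<open>simp_all add: FactGroup_def\<close>)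
  then have "N #>\<^bsub>?G\<^esub> fixed_map S x (twist k) A = N #>\<^bsub>?G\<^esub> A"
    using loop[OF p(1)] loop[OF fp(1)[of k]] fp(2)[of k] p(2) by simp
  moreover have "fixed_map S x (twist k) A \<in> carrier ?G"
    using fp(2)[of k] path_class_closed[OF fp(1)[of k]] p(2) by simp
  ultimately show ?thesis using N.rcos_self[OF _ N.subgroup_axioms] by metis
qed

lemma twist_fixed_map_iso:
  assumes x: "x \<in> S" "x \<notin> core"
  shows "fixed_map S x (twist k) \<in> iso (fundamental_group S x) (fundamental_group S x)"
  by (rule fixed_map_iso[OF homeomorphism_twist x(1) twist_fix[OF x(2)]])

lemma twist_degree_collapse:
  assumes x: "x \<in> S" "x \<notin> core" and A: "A \<in> carrier (fundamental_group S x)"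
  shows "loop_degree collapse (fixed_map S x (twist k) A) = loop_degree collapse A"
proof -
  obtain p where p: "path_in S p x x" "A = path_class S p" using A by (auto simp: carrier_fundamental_group)
  note fp = fixed_map_twist[OF x p(1)]
  have "winding collapse (twist k \<circ> p) = winding collapse p"
    by (simp add: winding_def circle_lift_def collapse_twist)
  then have "real_of_int (loop_degree collapse (fixed_map S x (twist k) A)) = loop_degree collapse A"
    using loop_degree_path_class[OF continuous_on_collapse norm_collapse fp(1)[of k]]
      loop_degree_path_class[OF continuous_on_collapse norm_collapse p(1)] fp(2)[of k] p(2) by simp
  then show ?thesis by simp
qed

lemma twist_degree:
  assumes e: "continuous_on S e" "\<And>y. y \<in> S \<Longrightarrow> cmod (e y) = 1"
    and \<epsilon>: "y \<in> {lo<..<hi}" "winding e (\<lambda>t. E (y, t)) = of_int \<epsilon>"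
    and x: "x \<in> S" "x \<notin> core" and A: "A \<in> carrier (fundamental_group S x)"
  shows "loop_degree e (fixed_map S x (twist k) A) = loop_degree e A + k * \<epsilon> * loop_degree collapse A"
proof -
  obtain p where p: "path_in S p x x" "A = path_class S p" using A by (auto simp: carrier_fundamental_group)
  note fp = fixed_map_twist[OF x p(1)]
  have "real_of_int (loop_degree e (fixed_map S x (twist k) A)) =
      real_of_int (loop_degree e A + k * \<epsilon> * loop_degree collapse A)"
    using winding_twist[OF e \<epsilon> p(1), of k] loop_degree_path_class[OF e fp(1)[of k]] loop_degree_path_class[OF e p(1)]
      loop_degree_path_class[OF continuous_on_collapse norm_collapse p(1)] fp(2)[of k] p(2) by simp
  then show ?thesis by linarith
qed

text \<open>The core is closed in \<open>X\<close>, so the twist is the identity near every puncture.\<close>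

lemma twist_pure_homeo:
  assumes S: "S = X - P" and off: "openin (top_of_set X) (X - core)"
  and P: "P \<subseteq> X"
  shows "twist k \<in> pure_homeos X P"
proof -
  have "(twist k \<longlongrightarrow> p) (at p within (X - P))" if p: "p \<in> P" for p
  proof -
    have "core \<subseteq> S" using core_subset annulus_subset by (rule order_trans)
    then have "p \<in> X - core" using p P S by blast
    moreover obtain T where T: "open T" "X - core = X \<inter> T" using off by (auto simp: openin_open)
    ultimately have "p \<in> T" by blast
    have "eventually (\<lambda>y. y = twist k y) (at p within (X - P))"
      unfolding eventually_at_topological
      using T \<open>p \<in> T\<close> twist_fix[of _ k] by (intro exI[of _ T]) (metis DiffD1 DiffD2 IntI)
    then show ?thesis by (rule Lim_transform_eventually[OF tendsto_ident_at])
  qed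
  then show ?thesis
    using homeomorphism_twist[of k] twist_orientation_preserving[of k] S by (auto simp: pure_homeos_def)
qed

text \<open>All members of the mapping class are homotopic to the twist, hence induce the same outer
  automorphism as the action of the twist on the fundamental group at its fixed point.\<close>

lemma outer_representation_twist:
  assumes S: "S = X - P" and f: "twist k \<in> pure_homeos X P"
    and con: "path_connected S" and x: "x \<in> S" "x \<notin> core"
  shows "outer_representation X P x (isotopy_rel X P `` {twist k}) =
     Inn (Pi_hat X P x) #>\<^bsub>Aut_group (Pi_hat X P x) (Pi_hat_topology X P x)\<^esub>
       completion_map (fundamental_group S x) (fixed_map S x (twist k))"
proof -
  let ?G = "fundamental_group S x"
  interpret discrete_group ?G by (simp add: discrete_group_def group_fundamental_group[OF x(1)])
  let ?cos = "Top.to_Out (completion_map ?G (fixed_map S x (twist k)))"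
  have iso: "fixed_map S x (twist k) \<in> iso ?G ?G" by (rule twist_fixed_map_iso[OF x])
  have fx: "twist k x = x" by (rule twist_fix[OF x(2)])
  have member: "Top.to_Out (completion_map ?G (pi1_map S c h)) = ?cos"
    if h: "h \<in> isotopy_rel X P `` {twist k}" and c: "path_in S c x (h x)" for h c
  proof -
    have hom: "homotopic_with_canon (\<lambda>k. \<exists>k'. homeomorphism S S k k') S S (twist k) h"
      using h by (simp add: isotopy_rel_def S)
    obtain A0 where A0: "A0 \<in> carrier ?G"
      and eq: "\<And>A. A \<in> carrier ?G \<Longrightarrow> pi1_map S c h A = A0 \<otimes>\<^bsub>?G\<^esub> fixed_map S x (twist k) A \<otimes>\<^bsub>?G\<^esub> inv\<^bsub>?G\<^esub> A0"
      by (rule pi1_map_homotopic[where f = "twist k", OF con x(1) fx hom c]) (rule that)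
    have "(\<lambda>A. A0 \<otimes>\<^bsub>?G\<^esub> fixed_map S x (twist k) A \<otimes>\<^bsub>?G\<^esub> inv\<^bsub>?G\<^esub> A0) \<in> iso ?G ?G"
      using iso_set_trans[OF iso conj_iso[OF A0]] by (simp add: comp_def)
    from completion_map_cong[OF eq[symmetric] this]
    show ?thesis using to_Out_completion_conj[OF iso A0] by simp
  qed
  have self: "twist k \<in> isotopy_rel X P `` {twist k}"
    using f homeomorphism_twist[of k] continuous_on_twist[of k] twist_mem[of _ k]
    by (auto simp: isotopy_rel_def homotopic_with_refl S)
  have c0: "path_in S (\<lambda>_. x) x (twist k x)" using path_in_const[OF x(1)] fx by simp
  have "outer_representation X P x (isotopy_rel X P `` {twist k}) =
      \<Union>{Top.to_Out (completion_map ?G (pi1_map S c h)) | h c. h \<in> isotopy_rel X P `` {twist k} \<and> path_in S c x (h x)}"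
    unfolding outer_representation_def S[symmetric] path_in_def by (simp add: conj_assoc)
  also have "{Top.to_Out (completion_map ?G (pi1_map S c h)) | h c. h \<in> isotopy_rel X P `` {twist k} \<and> path_in S c x (h x)} = {?cos}"
    using member self c0 by blast
  finally show ?thesis by (simp add: S)
qed

lemma twist_in_congruence_mcg:
  assumes S: "S = X - P" and f: "twist k \<in> pure_homeos X P"
    and con: "path_connected S" and x: "x \<in> S" "x \<notin> core"
  shows "Inn (Pi_hat X P x) #>\<^bsub>Aut_group (Pi_hat X P x) (Pi_hat_topology X P x)\<^esub>
       completion_map (fundamental_group S x) (fixed_map S x (twist k)) \<in> congruence_mcg_carrier X P x"
    (is "?cos \<in> _")
proof -
  let ?G = "fundamental_group S x"
  interpret discrete_group ?G by (simp add: discrete_group_def group_fundamental_group[OF x(1)])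
  have "isotopy_rel X P `` {twist k} \<in> carrier (pure_mapping_class_group X P)"
    using f by (simp add: pure_mapping_class_group_def quotientI)
  then have im: "?cos \<in> outer_representation X P x ` carrier (pure_mapping_class_group X P)"
    using outer_representation_twist[OF assms] by (metis imageI)
  have "completion_map ?G (fixed_map S x (twist k)) \<in> carrier Top.AutH"
    by (rule completion_map_Aut[OF twist_fixed_map_iso[OF x]])
  then have "?cos \<in> topspace (Out_topology (Pi_hat X P x) (Pi_hat_topology X P x))"
    using hom_carrier[OF Top.to_Out_hom] Top.topspace_Out by (auto simp flip: S)
  then show ?thesis
    unfolding congruence_mcg_carrier_def using im closure_of_subset_Int by fastforce
qed

end

theorem proposition2p5:
  fixes g n :: nat and X P :: "'a::topological_space set" and x :: 'a
  assumes "g \<ge> 1"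
    and "2 * int g - 2 + int n > 0"
    and "closed_orientable_surface g X"
    and "P \<subseteq> X" and "finite P" and "card P = n"
    and "x \<in> X - P"
  shows "\<not> virtually_prosolvable (congruence_mcg X P x) (congruence_mcg_topology X P x) \<and>
    \<not> virtually_prosolvable (Out_group (Pi_hat X P x) (Pi_hat_topology X P x))
        (Out_topology (Pi_hat X P x) (Pi_hat_topology X P x)) \<and>
    \<not> virtually_prosolvable (Aut_group (Pi_hat X P x) (Pi_hat_topology X P x))
        (Aut_topology (Pi_hat X P x) (Pi_hat_topology X P x))"
proof -
  obtain q where "quotient_map (top_of_set (cball (0::complex) 1)) (top_of_set X) q"
    and "\<forall>z\<in>cball 0 1. \<forall>w\<in>cball 0 1. q z = q w \<longleftrightarrow> equivclp (side_pairing g) z w"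
    using assms(3) unfolding closed_orientable_surface_def by blast
  then interpret polygon_surface g X q by unfold_locales (use assms(1) in auto)
  define S where "S = X - P"
  let ?G = "fundamental_group S x"
  have xS: "x \<in> S" and F: "finite (insert x P)" "insert x P \<subseteq> X" using assms by (auto simp: S_def)
  have con: "path_connected S" unfolding S_def by (rule path_connected_minus_finite[OF assms(5)])
  \<comment> \<open>Band \<open>1\<close> will carry the annulus \<open>A\<close> and band \<open>0\<close> the annulus \<open>B\<close>, both off the
    punctures and the base point.\<close>
  obtain lo1 a1 b1 hi1 where r1: "lo1 < a1" "a1 < b1" "b1 < hi1" "{lo1<..<hi1} \<subseteq> J0"
    and av1: "\<And>z. z \<in> disc \<Longrightarrow> q z \<in> insert x P \<Longrightarrow> xc 1 z \<notin> {lo1<..<hi1}"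
    using strip_avoiding[OF F, of 1] by metis
  obtain lo0 a0 b0 hi0 where r0: "lo0 < a0" "a0 < b0" "b0 < hi0" "{lo0<..<hi0} \<subseteq> J0"
    and av0: "\<And>z. z \<in> disc \<Longrightarrow> q z \<in> insert x P \<Longrightarrow> xc 0 z \<notin> {lo0<..<hi0}"
    using strip_avoiding[OF F, of 0] by metis
  interpret A: annulus_T1 S "E 1" lo1 a1 b1 hi1
    unfolding S_def by (rule annulus_in_minus_finite[OF _ assms(5) r1]) (use av1 in auto)
  interpret B: annulus_T1 S "E 0" lo0 a0 b0 hi0
    unfolding S_def by (rule annulus_in_minus_finite[OF _ assms(5) r0]) (use av0 in auto)
  have not_core: "x \<notin> E j ` ({a..b} \<times> UNIV)"
    if j: "j \<in> {0, 1}" and r: "lo < a" "b < hi" "{lo<..<hi} \<subseteq> J0"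
      and av: "\<And>z. z \<in> disc \<Longrightarrow> q z \<in> insert x P \<Longrightarrow> xc j z \<notin> {lo<..<hi}" for j lo a b hi
  proof
    assume "x \<in> E j ` ({a..b} \<times> UNIV)"
    then obtain w where w: "fst w \<in> {a..b}" "x = E j w" by force
    obtain z where z: "z \<in> disc" "x = q z" using q_image F(2) by blast
    have "fst w \<in> {lo<..<hi}" using w(1) r by auto
    moreover have "xc j z = fst w" using E_eq_q[OF j _ z(1), of w] w z calculation r(3) by auto
    ultimately show False using av[OF z(1)] z(2) by auto
  qed
  have xA: "x \<notin> A.core" by (rule not_core[OF _ r1(1,3,4) av1]) simp
  have xB: "x \<notin> B.core" by (rule not_core[OF _ r0(1,3,4) av0]) simp
  have eA: "continuous_on S A.collapse" "\<And>y. y \<in> S \<Longrightarrow> cmod (A.collapse y) = 1"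
    and eB: "continuous_on S B.collapse" "\<And>y. y \<in> S \<Longrightarrow> cmod (B.collapse y) = 1"
    using A.continuous_on_collapse A.norm_collapse B.continuous_on_collapse B.norm_collapse by blast+
  have y1: "a1 \<in> {lo1<..<hi1}" "a1 \<in> J0" and y0: "a0 \<in> {lo0<..<hi0}" "a0 \<in> J0" using r1 r0 by auto
  have wAB: "winding B.collapse (\<lambda>t. E 1 (a1, t)) = of_int (- 1)"
    using crossing_winding[OF B.annulus_axioms _ _ r0(4) y1(2), of 1] by simp
  have wBA: "winding A.collapse (\<lambda>t. E 0 (a0, t)) = of_int 1"
    using crossing_winding[OF A.annulus_axioms _ _ r1(4) y0(2), of 0] by simp
  \<comment> \<open>The core of \<open>A\<close> crosses \<open>B\<close> in the negative direction, which is compensated by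
    the sign of the twist along \<open>A\<close>.\<close>
  let ?low = "\<lambda>k. fixed_map S x (A.twist (- k))" and ?up = "\<lambda>k. fixed_map S x (B.twist k)"
  have U: "unipotent_twists ?G (loop_degree A.collapse) (loop_degree B.collapse) ?low ?up"
  proof (intro unipotent_twists.intro unipotent_twists_axioms.intro)
    show "discrete_group ?G" by (simp add: discrete_group_def group_fundamental_group[OF xS])
    show "loop_degree A.collapse (C \<otimes>\<^bsub>?G\<^esub> D) = loop_degree A.collapse C + loop_degree A.collapse D"
      "loop_degree B.collapse (C \<otimes>\<^bsub>?G\<^esub> D) = loop_degree B.collapse C + loop_degree B.collapse D"
      if "C \<in> carrier ?G" "D \<in> carrier ?G" for C D
      using loop_degree_mult[OF eA, where x = x, of C D] loop_degree_mult[OF eB, where x = x, of C D] that by blast+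
    \<comment> \<open>The core of \<open>A\<close>, joined to the base point by a path, crosses \<open>B\<close> once.\<close>
    show "\<exists>C\<in>carrier ?G. \<bar>loop_degree B.collapse C\<bar> = 1"
    proof -
      obtain \<Phi> where "path_functor S ?G \<Phi>" using based_path_functor[OF con xS] by metis
      then have l: "path_in S (\<lambda>t. E 1 (a1, 0 + t)) (E 1 (a1, 0)) (E 1 (a1, 0))"
        by (rule A.full_turns(2)[OF _ y1(1)])
      obtain c where c: "path_in S c x (E 1 (a1, 0))"
        using con xS path_in_mem[OF l] unfolding path_connected_def path_in_def by metis
      let ?p = "c +++ ((\<lambda>t. E 1 (a1, 0 + t)) +++ reversepath c)"
      have p: "path_in S ?p x x" by (rule path_in_join[OF c path_in_join[OF l path_in_reverse[OF c]]])
      have "real_of_int (loop_degree B.collapse (path_class S ?p)) = - 1"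
        using loop_degree_path_class[OF eB p] winding_lasso[OF eB c l] wAB by simp
      then have "\<bar>loop_degree B.collapse (path_class S ?p)\<bar> = 1" by linarith
      then show ?thesis using path_class_closed[OF p] by blast
    qed
    show "?low k \<in> iso ?G ?G" "?up k \<in> iso ?G ?G" for k
      using A.twist_fixed_map_iso[OF xS xA] B.twist_fixed_map_iso[OF xS xB] .
    show "loop_degree A.collapse (?low k C) = loop_degree A.collapse C"
      "loop_degree B.collapse (?low k C) = loop_degree B.collapse C + k * loop_degree A.collapse C"
      "loop_degree A.collapse (?up k C) = loop_degree A.collapse C + k * loop_degree B.collapse C"
      "loop_degree B.collapse (?up k C) = loop_degree B.collapse C"
      if C: "C \<in> carrier ?G" for k C
      using A.twist_degree_collapse[OF xS xA C] A.twist_degree[OF eB y1(1) wAB xS xA C, of "- k"]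
        B.twist_degree[OF eA y0(1) wBA xS xB C, of k] B.twist_degree_collapse[OF xS xB C] by simp_all
    show "?low k C \<in> N #>\<^bsub>?G\<^esub> C" "?up k C \<in> N #>\<^bsub>?G\<^esub> C"
      if N: "N \<in> solvable_quotient_kernels ?G" and k: "int (card (rcosets\<^bsub>?G\<^esub> N)) dvd k"
        and C: "C \<in> carrier ?G" for N k C
    proof -
      have N': "N \<lhd> ?G" "finite (rcosets\<^bsub>?G\<^esub> N)"
        using N by (simp_all add: solvable_quotient_kernels_def FactGroup_def)
      have k': "int (card (rcosets\<^bsub>?G\<^esub> N)) dvd - k" using k by simp
      show "?low k C \<in> N #>\<^bsub>?G\<^esub> C" by (rule A.twist_fixed_map_trivial[OF con xS xA N' k' C])
      show "?up k C \<in> N #>\<^bsub>?G\<^esub> C" by (rule B.twist_fixed_map_trivial[OF con xS xB N' k C])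
    qed
  qed
  interpret U: unipotent_twists ?G "loop_degree A.collapse" "loop_degree B.collapse" ?low ?up by (rule U)
  have pureA: "A.twist k \<in> pure_homeos X P" for k
    by (rule A.twist_pure_homeo[OF S_def E_closed_strip assms(4)]) (use r1 in auto)
  have pureB: "B.twist k \<in> pure_homeos X P" for k
    by (rule B.twist_pure_homeo[OF S_def E_closed_strip assms(4)]) (use r0 in auto)
  note memA = A.twist_in_congruence_mcg[OF S_def pureA con xS xA]
    and memB = B.twist_in_congruence_mcg[OF S_def pureB con xS xB]
  have sub: "congruence_mcg_carrier X P x \<subseteq> carrier (Out_group U.Ghat U.That)"
    unfolding congruence_mcg_carrier_def S_def[symmetric] U.Top.topspace_Out[symmetric]
    by (rule closure_of_subset_topspace)
  have mcg: "\<not> virtually_prosolvable (congruence_mcg X P x) (congruence_mcg_topology X P x)"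
    using U.not_virtually_prosolvable_Out[OF sub] memA memB
    unfolding congruence_mcg_def congruence_mcg_topology_def S_def by blast
  have "\<not> virtually_prosolvable ((Out_group U.Ghat U.That)\<lparr>carrier := carrier (Out_group U.Ghat U.That)\<rparr>)
      (subtopology (Out_topology U.Ghat U.That) (carrier (Out_group U.Ghat U.That)))"
    by (rule U.not_virtually_prosolvable_Out[OF order_refl])
       (use memA memB sub in \<open>auto simp flip: S_def\<close>)
  moreover have "subtopology (Out_topology U.Ghat U.That) (carrier (Out_group U.Ghat U.That)) = Out_topology U.Ghat U.That"
    using U.Top.topspace_Out subtopology_topspace by metis
  ultimately have out: "\<not> virtually_prosolvable (Out_group U.Ghat U.That) (Out_topology U.Ghat U.That)" by simp
  show ?thesis using mcg out U.not_virtually_prosolvable_Aut unfolding S_def by blast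
qed

end
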